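(* Fix $\alpha<\omega_{1}$. If $f:G\rightarrow H$ is a Borel-definable homomorphism between abelian groups with a Polish cover, then $f(s_{\alpha}(G))\subseteq s_{\alpha}(H)$. Thus $G\mapsto s_{\alpha}(G)$ is a subfunctor of the identity functor on the category of abelian groups with a (non-Archimedean) Polish cover and Borel-definable homomorphisms.
   Context: An abelian group with a Polish cover is $G=\hat{G}/N$ with $\hat{G}$ an abelian Polish group and $N$ a Polishable subgroup (a Borel subgroup carrying a Polish group topology whose open sets are Borel in $\hat{G}$). A homomorphism $f:\hat G/N\to\hat H/M$ is Borel-definable if it has a Borel lift $\hat f:\hat G\to\hat H$, $f(x+N)=\hat f(x)+M$. A subgroup $H$ of $G$ is Polishable if $\{x\in\hat G:x+N\in H\}$ is Polishable in $\hat G$; then $H$ is itself regarded as the group with a Polish cover $\hat H/N$. Solecki subgroups: $s_0(G)$ is the closure of $\{0\}$ in $G$ for the quotient topology (i.e. $\overline{N}/N$); $s_1(G)=s_1^N(\hat{G})/N$ where $s_1^N(\hat{G})=\bigcap_{V}\bigcup_{z\in N}\overline{z+V}$, $V$ ranging over open neighborhoods of $0$ in the Polish topology of $N$ and the closure taken in $\hat{G}$ (this is a Polishable subgroup, the smallest $\boldsymbol{\Pi}^0_3$ Polishable subgroup of $G$); $s_{\alpha+1}(G)=s_1(s_\alpha(G))$; $s_\lambda(G)=\bigcap_{\beta<\lambda}s_\beta(G)$ for limit $\lambda$. *)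

theory Defs
  imports "HOL-Analysis.Analysis" "HOL-Algebra.Coset"
begin

section \<open>Countable ordinals\<close>

text \<open>The elements of \<open>\<omega>\<^sub>1\<close>, as isomorphism classes of well-orders on subsets of \<open>nat\<close>.\<close>

quotient_type countable_ordinal = "nat rel" / partial: "\<lambda>r s. (r, s) \<in> ordIso"
proof (rule part_equivpI)
  show "\<exists>r::nat rel. (r, r) \<in> ordIso"
    using ordIso_reflexive[OF natLeq_Well_order] by blast
  show "symp (\<lambda>r s :: nat rel. (r, s) \<in> ordIso)"
    by (auto intro!: sympI ordIso_symmetric)
  show "transp (\<lambda>r s :: nat rel. (r, s) \<in> ordIso)"
    by (auto intro!: transpI elim: ordIso_transitive)
qed

instantiation countable_ordinal :: wellorder
begin

lift_definition less_eq_countable_ordinal :: "countable_ordinal \<Rightarrow> countable_ordinal \<Rightarrow> bool"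
  is "\<lambda>r s. (r, s) \<in> ordLeq"
  by (meson ordIso_ordLeq_trans ordLeq_ordIso_trans ordIso_symmetric)

lift_definition less_countable_ordinal :: "countable_ordinal \<Rightarrow> countable_ordinal \<Rightarrow> bool"
  is "\<lambda>r s. (r, s) \<in> ordLess"
  by (meson ordIso_ordLess_trans ordLess_ordIso_trans ordIso_symmetric)

instance
proof
  fix x y z :: countable_ordinal
  show "x < y \<longleftrightarrow> x \<le> y \<and> \<not> y \<le> x"
    by transfer (metis not_ordLess_ordLeq not_ordLeq_iff_ordLess ordIso_iff_ordLeq
        ordLeq_Well_order_simp ordLess_imp_ordLeq)
  show "x \<le> x" by transfer (simp add: ordIso_iff_ordLeq)
  show "x \<le> y \<Longrightarrow> y \<le> z \<Longrightarrow> x \<le> z" by transfer (rule ordLeq_transitive)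
  show "x \<le> y \<Longrightarrow> y \<le> x \<Longrightarrow> x = y" by transfer (simp add: ordIso_iff_ordLeq)
  show "x \<le> y \<or> y \<le> x"
    by transfer (meson ordIso_iff_ordLeq ordLeq_Well_order_simp ordLeq_total)
next
  fix P :: "countable_ordinal \<Rightarrow> bool" and a :: countable_ordinal
  assume step: "\<And>x. (\<And>y. y < x \<Longrightarrow> P y) \<Longrightarrow> P x"
  have "(r, r) \<in> ordIso \<longrightarrow> P (abs_countable_ordinal r)" for r :: "nat rel"
  proof (induction r rule: wf_induct_rule[OF wf_ordLess])
    case (1 r)
    show ?case
    proof
      assume r: "(r, r) \<in> ordIso"
      show "P (abs_countable_ordinal r)"
      proof (rule step)
        fix y assume y: "y < abs_countable_ordinal r"
        obtain s where s: "(s, s) \<in> ordIso" "y = abs_countable_ordinal s"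
          by (metis Quotient_abs_rep[OF Quotient_countable_ordinal]
              Quotient_rep_reflp[OF Quotient_countable_ordinal])
        have "(s, r) \<in> ordLess" using y s r by (simp add: less_countable_ordinal.abs_eq)
        then show "P y" using 1 s by blast
      qed
    qed
  qed
  then show "P a"
    by (metis Quotient_abs_rep[OF Quotient_countable_ordinal]
        Quotient_rep_reflp[OF Quotient_countable_ordinal])
qed

end


section \<open>Abelian groups with a Polish cover\<close>

definition polish_space_top :: "'a topology \<Rightarrow> bool" where
  "polish_space_top T \<longleftrightarrow> completely_metrizable_space T \<and> separable_space T"

definition borel_of :: "'a topology \<Rightarrow> 'a measure" where
  "borel_of T = sigma (topspace T) {U. openin T U}"

definition abelian_polish_group :: "('a, 'm) monoid_scheme \<Rightarrow> 'a topology \<Rightarrow> bool" where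
  "abelian_polish_group G T \<longleftrightarrow>
     comm_group G \<and> topspace T = carrier G \<and> polish_space_top T \<and>
     continuous_map (prod_topology T T) T (\<lambda>(x, y). x \<otimes>\<^bsub>G\<^esub> y) \<and>
     continuous_map T T (\<lambda>x. inv\<^bsub>G\<^esub> x)"

definition polishing_topology ::
    "('a, 'm) monoid_scheme \<Rightarrow> 'a topology \<Rightarrow> 'a set \<Rightarrow> 'a topology \<Rightarrow> bool" where
  "polishing_topology G T S T' \<longleftrightarrow>
     abelian_polish_group (G\<lparr>carrier := S\<rparr>) T' \<and> (\<forall>U. openin T' U \<longrightarrow> U \<in> sets (borel_of T))"

definition polishable_subgroup ::
    "('a, 'm) monoid_scheme \<Rightarrow> 'a topology \<Rightarrow> 'a set \<Rightarrow> bool" where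
  "polishable_subgroup G T S \<longleftrightarrow>
     subgroup S G \<and> S \<in> sets (borel_of T) \<and> (\<exists>T'. polishing_topology G T S T')"

text \<open>The Polish group topology of a Polishable subgroup is unique.\<close>

definition polish_top_of :: "('a, 'm) monoid_scheme \<Rightarrow> 'a topology \<Rightarrow> 'a set \<Rightarrow> 'a topology" where
  "polish_top_of G T S = (THE T'. polishing_topology G T S T')"

text \<open>The monoid part of the record is the covering group \<open>G'\<close> (written multiplicatively),
  \<open>cover_top\<close> is its topology and \<open>cover_ker\<close> is the subgroup \<open>N\<close>.\<close>

record 'a cover = "'a monoid" +
  cover_top :: "'a topology"
  cover_ker :: "'a set"

definition abelian_polish_cover :: "'a cover \<Rightarrow> bool" where
  "abelian_polish_cover G \<longleftrightarrow>
     abelian_polish_group G (cover_top G) \<and> polishable_subgroup G (cover_top G) (cover_ker G)"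

abbreviation cover_quot :: "'a cover \<Rightarrow> 'a set monoid" where
  "cover_quot G \<equiv> G Mod cover_ker G"

definition ker_top :: "'a cover \<Rightarrow> 'a topology" where
  "ker_top G = polish_top_of G (cover_top G) (cover_ker G)"

definition non_archimedean :: "('a, 'm) monoid_scheme \<Rightarrow> 'a topology \<Rightarrow> bool" where
  "non_archimedean G T \<longleftrightarrow>
     (\<forall>U. openin T U \<and> \<one>\<^bsub>G\<^esub> \<in> U \<longrightarrow> (\<exists>V. openin T V \<and> subgroup V G \<and> V \<subseteq> U))"

definition non_archimedean_polish_cover :: "'a cover \<Rightarrow> bool" where
  "non_archimedean_polish_cover G \<longleftrightarrow>
     abelian_polish_cover G \<and> non_archimedean G (cover_top G) \<and>
     non_archimedean (G\<lparr>carrier := cover_ker G\<rparr>) (ker_top G)"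

definition borel_definable_hom :: "'a cover \<Rightarrow> 'b cover \<Rightarrow> ('a set \<Rightarrow> 'b set) \<Rightarrow> bool" where
  "borel_definable_hom G H f \<longleftrightarrow>
     f \<in> hom (cover_quot G) (cover_quot H) \<and>
     (\<exists>f' \<in> borel_of (cover_top G) \<rightarrow>\<^sub>M borel_of (cover_top H).
        \<forall>x\<in>carrier G. f (cover_ker G #>\<^bsub>G\<^esub> x) = cover_ker H #>\<^bsub>H\<^esub> f' x)"

text \<open>A Polishable subgroup of \<open>G'/N\<close> with preimage \<open>S\<close> in \<open>G'\<close>, regarded as the group with a
  Polish cover \<open>S/N\<close>; its elements are literally cosets belonging to \<open>G'/N\<close>.\<close>

definition subcover :: "'a cover \<Rightarrow> 'a set \<Rightarrow> 'a cover" where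
  "subcover G S = G\<lparr>carrier := S, cover_top := polish_top_of G (cover_top G) S\<rparr>"


section \<open>Solecki subgroups\<close>

definition solecki_one_set :: "'a cover \<Rightarrow> 'a set" where
  "solecki_one_set G =
     (\<Inter>V\<in>{V. openin (ker_top G) V \<and> \<one>\<^bsub>G\<^esub> \<in> V}.
        \<Union>z\<in>cover_ker G. cover_top G closure_of (z <#\<^bsub>G\<^esub> V))"

text \<open>The preimage of \<open>s\<^sub>\<alpha>(G)\<close> in \<open>G'\<close>. The condition \<open>{..<\<alpha>} = {..\<beta>}\<close> says that
  \<open>\<alpha> = \<beta> + 1\<close>.\<close>

function solecki_set :: "'a cover \<Rightarrow> countable_ordinal \<Rightarrow> 'a set" where
  "solecki_set G \<alpha> =
     (if {..<\<alpha>} = {} then cover_top G closure_of cover_ker G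
      else if \<exists>\<beta>. {..<\<alpha>} = {..\<beta>}
        then solecki_one_set (subcover G (solecki_set G (THE \<beta>. {..<\<alpha>} = {..\<beta>})))
      else (\<Inter>\<beta>\<in>{..<\<alpha>}. solecki_set G \<beta>))"
  by auto
termination
proof (relation "inv_image {(\<beta>, \<alpha>). \<beta> < \<alpha>} snd", goal_cases)
  case 1
  show ?case by (intro wf_inv_image wf)
next
  case (2 G \<alpha>)
  then obtain \<beta> where \<beta>: "{..<\<alpha>} = {..\<beta>}" by blast
  then have "(THE \<beta>. {..<\<alpha>} = {..\<beta>}) = \<beta>" by (intro the_equality) auto
  with \<beta> show ?case by auto
qed auto

declare solecki_set.simps [simp del]

definition solecki :: "countable_ordinal \<Rightarrow> 'a cover \<Rightarrow> 'a cover" where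
  "solecki \<alpha> G = subcover G (solecki_set G \<alpha>)"

lemma solecki_set_zero:
  "{..<\<alpha>} = {} \<Longrightarrow> solecki_set G \<alpha> = cover_top G closure_of cover_ker G"
  by (subst solecki_set.simps) simp

lemma solecki_set_succ:
  assumes "{..<\<alpha>} = {..\<beta>}"
  shows "solecki_set G \<alpha> = solecki_one_set (solecki \<beta> G)"
proof -
  have "(THE \<beta>. {..<\<alpha>} = {..\<beta>}) = \<beta>" using assms by (intro the_equality) auto
  moreover have "{..<\<alpha>} \<noteq> {}" using assms by auto
  ultimately show ?thesis
    using assms by (subst solecki_set.simps) (auto simp: solecki_def)
qed

lemma solecki_set_limit:
  assumes "{..<\<alpha>} \<noteq> {}" "\<nexists>\<beta>. {..<\<alpha>} = {..\<beta>}"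
  shows "solecki_set G \<alpha> = (\<Inter>\<beta>\<in>{..<\<alpha>}. solecki_set G \<beta>)"
  using assms by (subst solecki_set.simps) simp


section \<open>Categories and subfunctors\<close>

text \<open>In \<open>comp_arr C X Y Z g f\<close>, \<open>f\<close> is an arrow from \<open>X\<close> to \<open>Y\<close> and \<open>g\<close> one from \<open>Y\<close> to \<open>Z\<close>.\<close>

record ('o, 'm) precategory =
  objs :: "'o set"
  arrs :: "'o \<Rightarrow> 'o \<Rightarrow> 'm set"
  id_arr :: "'o \<Rightarrow> 'm"
  comp_arr :: "'o \<Rightarrow> 'o \<Rightarrow> 'o \<Rightarrow> 'm \<Rightarrow> 'm \<Rightarrow> 'm"

definition is_category :: "('o, 'm) precategory \<Rightarrow> bool" where
  "is_category C \<longleftrightarrow>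
     (\<forall>X\<in>objs C. id_arr C X \<in> arrs C X X) \<and>
     (\<forall>X\<in>objs C. \<forall>Y\<in>objs C. \<forall>Z\<in>objs C. \<forall>f\<in>arrs C X Y. \<forall>g\<in>arrs C Y Z.
        comp_arr C X Y Z g f \<in> arrs C X Z) \<and>
     (\<forall>X\<in>objs C. \<forall>Y\<in>objs C. \<forall>f\<in>arrs C X Y.
        comp_arr C X X Y f (id_arr C X) = f \<and> comp_arr C X Y Y (id_arr C Y) f = f) \<and>
     (\<forall>W\<in>objs C. \<forall>X\<in>objs C. \<forall>Y\<in>objs C. \<forall>Z\<in>objs C.
        \<forall>f\<in>arrs C W X. \<forall>g\<in>arrs C X Y. \<forall>h\<in>arrs C Y Z.
        comp_arr C W X Z (comp_arr C X Y Z h g) f = comp_arr C W Y Z h (comp_arr C W X Y g f))"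

definition is_functor ::
    "('o, 'm) precategory \<Rightarrow> ('p, 'n) precategory \<Rightarrow> ('o \<Rightarrow> 'p) \<Rightarrow> ('o \<Rightarrow> 'o \<Rightarrow> 'm \<Rightarrow> 'n) \<Rightarrow> bool"
  where
  "is_functor C D F F' \<longleftrightarrow>
     is_category C \<and> is_category D \<and>
     (\<forall>X\<in>objs C. F X \<in> objs D) \<and>
     (\<forall>X\<in>objs C. \<forall>Y\<in>objs C. \<forall>f\<in>arrs C X Y. F' X Y f \<in> arrs D (F X) (F Y)) \<and>
     (\<forall>X\<in>objs C. F' X X (id_arr C X) = id_arr D (F X)) \<and>
     (\<forall>X\<in>objs C. \<forall>Y\<in>objs C. \<forall>Z\<in>objs C. \<forall>f\<in>arrs C X Y. \<forall>g\<in>arrs C Y Z.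
        F' X Z (comp_arr C X Y Z g f) = comp_arr D (F X) (F Y) (F Z) (F' Y Z g) (F' X Y f))"

definition is_mono :: "('o, 'm) precategory \<Rightarrow> 'o \<Rightarrow> 'o \<Rightarrow> 'm \<Rightarrow> bool" where
  "is_mono C X Y m \<longleftrightarrow>
     m \<in> arrs C X Y \<and>
     (\<forall>W\<in>objs C. \<forall>f\<in>arrs C W X. \<forall>g\<in>arrs C W X.
        comp_arr C W X Y m f = comp_arr C W X Y m g \<longrightarrow> f = g)"

definition is_nat_trans ::
    "('o, 'm) precategory \<Rightarrow> ('p, 'n) precategory \<Rightarrow>
     ('o \<Rightarrow> 'p) \<Rightarrow> ('o \<Rightarrow> 'o \<Rightarrow> 'm \<Rightarrow> 'n) \<Rightarrow> ('o \<Rightarrow> 'p) \<Rightarrow> ('o \<Rightarrow> 'o \<Rightarrow> 'm \<Rightarrow> 'n) \<Rightarrow>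
     ('o \<Rightarrow> 'n) \<Rightarrow> bool" where
  "is_nat_trans C D F F' K K' \<iota> \<longleftrightarrow>
     is_functor C D F F' \<and> is_functor C D K K' \<and>
     (\<forall>X\<in>objs C. \<iota> X \<in> arrs D (F X) (K X)) \<and>
     (\<forall>X\<in>objs C. \<forall>Y\<in>objs C. \<forall>f\<in>arrs C X Y.
        comp_arr D (F X) (F Y) (K Y) (\<iota> Y) (F' X Y f) =
        comp_arr D (F X) (K X) (K Y) (K' X Y f) (\<iota> X))"

definition is_subfunctor_of_identity ::
    "('o, 'm) precategory \<Rightarrow> ('o \<Rightarrow> 'o) \<Rightarrow> ('o \<Rightarrow> 'o \<Rightarrow> 'm \<Rightarrow> 'm) \<Rightarrow> ('o \<Rightarrow> 'm) \<Rightarrow> bool" where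
  "is_subfunctor_of_identity C F F' \<iota> \<longleftrightarrow>
     is_nat_trans C C F F' (\<lambda>X. X) (\<lambda>X Y f. f) \<iota> \<and>
     (\<forall>X\<in>objs C. is_mono C (F X) X (\<iota> X))"

text \<open>The full subcategory, on the objects satisfying \<open>P\<close>, of the category of abelian groups with
  a Polish cover (whose covering group has its elements in \<open>'a\<close>) and Borel-definable
  homomorphisms. Extensionality makes equality of arrows agree with equality of homomorphisms.\<close>

definition cover_category :: "('a cover \<Rightarrow> bool) \<Rightarrow> ('a cover, 'a set \<Rightarrow> 'a set) precategory" where
  "cover_category P =
     \<lparr>objs = {G. abelian_polish_cover G \<and> P G},
      arrs = (\<lambda>G H. {f \<in> extensional (carrier (cover_quot G)). borel_definable_hom G H f}),
      id_arr = (\<lambda>G. restrict (\<lambda>c. c) (carrier (cover_quot G))),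
      comp_arr = (\<lambda>G H K g f. compose (carrier (cover_quot G)) g f)\<rparr>"

definition solecki_map ::
    "countable_ordinal \<Rightarrow> 'a cover \<Rightarrow> 'a cover \<Rightarrow> ('a set \<Rightarrow> 'a set) \<Rightarrow> 'a set \<Rightarrow> 'a set" where
  "solecki_map \<alpha> G H f = restrict f (carrier (cover_quot (solecki \<alpha> G)))"

definition solecki_incl :: "countable_ordinal \<Rightarrow> 'a cover \<Rightarrow> 'a set \<Rightarrow> 'a set" where
  "solecki_incl \<alpha> G = restrict (\<lambda>c. c) (carrier (cover_quot (solecki \<alpha> G)))"

end

theory Submission
  imports Defs
begin

text \<open>A Borel lift \<open>f\<close> of the homomorphism is continuous off a meager set. If \<open>n\<^sub>k \<rightarrow> x\<close> with
  \<open>n\<^sub>k \<in> N\<close>, then for a generic \<open>t\<close> all of \<open>n\<^sub>k t\<close> and \<open>x t\<close> avoid that set, so \<open>f (n\<^sub>k t)\<close>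
  converges to \<open>f (x t)\<close>; as \<open>f (n\<^sub>k t)\<close> and \<open>f t\<close> agree modulo \<open>M\<close>, this gives the case \<open>\<alpha> = 0\<close>. Two
  applications of the Baire category theorem make \<open>f (n\<^sub>k t)\<close> and \<open>f (n\<^sub>0 t)\<close> agree modulo a prescribed
  neighbourhood of the identity of \<open>M\<close>, and the same limit argument gives the case \<open>\<alpha> = 1\<close>. The general
  case is an induction on \<open>\<alpha>\<close>, which requires that the Solecki subgroups are Polishable and that their
  Polish topologies are unique and finer than that of the ambient group. Uniqueness holds because a
  homomorphism with the Baire property is continuous, analytic sets having the Baire property.
  Polishability is obtained from invariant norms (Birkhoff-Kakutani): if \<open>p\<close> is a complete norm on \<open>N\<close>,
  then \<open>q x = inf {r. x \<in> cl {p < r}}\<close> is a complete norm on the first Solecki subgroup.\<close>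

text \<open>The Polish topology of a Polishable subgroup is given by a definite description, so
  \<open>s_1\<close> of \<open>s_\<beta>(G)\<close> cannot be computed before uniqueness is known.
  Uniqueness also frees this topology from the ambient group: the kernel keeps its topology while
  the covering group shrinks along the induction. The obstacle to functoriality is that a lift is
  multiplicative only up to \<open>M\<close>. Continuity at one point cannot be moved to another by
  translation, and the correction factors have no reason to converge in the topology of
  \<open>M\<close>. Hence limits are taken at a generic translate, and for \<open>s_1\<close> the
  factors are first confined to one translate of a small neighbourhood. Only countably many
  translates of a meager set can be avoided at once, hence sequences in place of neighbourhoods. The
  closures of the norm balls of \<open>N\<close> multiply as balls do, which is why the infimum over
  them is again a norm; being closed, they pass to limits, which is where completeness comes
  from.\<close>

no_notation eq_closure_of (\<open>closure'_of\<index>\<close>)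

section \<open>Meager sets and the Baire property\<close>

text \<open>The covering sets are closed with empty interior rather than merely nowhere dense; this
  is the shape in which \<open>Baire_category_alt\<close> takes them.\<close>

definition meager :: "'a topology \<Rightarrow> 'a set \<Rightarrow> bool" where
  "meager T A \<longleftrightarrow>
     (\<exists>\<F>. countable \<F> \<and> (\<forall>C\<in>\<F>. closedin T C \<and> T interior_of C = {}) \<and> A \<subseteq> \<Union>\<F>)"

lemma meager_subset: "meager T B \<Longrightarrow> A \<subseteq> B \<Longrightarrow> meager T A"
  unfolding meager_def by (meson order_trans)

lemma meager_Union:
  assumes "countable \<A>" "\<And>A. A \<in> \<A> \<Longrightarrow> meager T A"
  shows "meager T (\<Union>\<A>)"
proof -
  have "\<forall>A\<in>\<A>. \<exists>\<F>. countable \<F> \<and> (\<forall>C\<in>\<F>. closedin T C \<and> T interior_of C = {}) \<and> A \<subseteq> \<Union>\<F>"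
    using assms(2) by (simp add: meager_def)
  then obtain \<F> where \<F>: "\<forall>A\<in>\<A>. countable (\<F> A) \<and>
      (\<forall>C\<in>\<F> A. closedin T C \<and> T interior_of C = {}) \<and> A \<subseteq> \<Union>(\<F> A)"
    by metis
  show ?thesis
    unfolding meager_def
  proof (intro exI conjI)
    show "countable (\<Union>(\<F> ` \<A>))"
      using \<F> assms(1) by (intro countable_UN) auto
    show "\<forall>C\<in>\<Union>(\<F> ` \<A>). closedin T C \<and> T interior_of C = {}" using \<F> by blast
    show "\<Union>\<A> \<subseteq> \<Union>(\<Union>(\<F> ` \<A>))"
    proof (rule Union_least)
      fix A assume A: "A \<in> \<A>"
      then have "A \<subseteq> \<Union>(\<F> A)" using \<F> by simp
      also have "\<dots> \<subseteq> \<Union>(\<Union>(\<F> ` \<A>))" using A by (intro Union_mono) auto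
      finally show "A \<subseteq> \<Union>(\<Union>(\<F> ` \<A>))" .
    qed
  qed
qed

lemma meager_UN:
  assumes "countable I" "\<And>i. i \<in> I \<Longrightarrow> meager T (A i)"
  shows "meager T (\<Union>i\<in>I. A i)"
  using assms by (intro meager_Union) auto

lemma meager_Un: "meager T A \<Longrightarrow> meager T B \<Longrightarrow> meager T (A \<union> B)"
  using meager_Union[of "{A, B}" T] by auto

lemma meager_empty [simp]: "meager T {}"
  unfolding meager_def by (intro exI[of _ "{}"]) auto

lemma meager_nowhere_dense: "T interior_of (T closure_of A) = {} \<Longrightarrow> A \<subseteq> topspace T \<Longrightarrow> meager T A"
  unfolding meager_def by (intro exI[of _ "{T closure_of A}"]) (auto simp: closure_of_subset)

lemma Baire_open_not_meager:
  assumes "completely_metrizable_space T" "openin T U" "U \<noteq> {}"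
  shows "\<not> meager T U"
proof
  assume "meager T U"
  then obtain \<F> where \<F>: "countable \<F>" "\<And>C. C \<in> \<F> \<Longrightarrow> closedin T C \<and> T interior_of C = {}"
    and U: "U \<subseteq> \<Union>\<F>"
    unfolding meager_def by blast
  have "T interior_of \<Union>\<F> = {}" by (rule Baire_category_alt) (use assms \<F> in auto)
  with interior_of_maximal[OF U assms(2)] assms(3) show False by auto
qed

lemma meager_homeomorphic_image:
  assumes f: "homeomorphic_map T T' f" and A: "meager T A" "A \<subseteq> topspace T"
  shows "meager T' (f ` A)"
proof -
  obtain \<F> where \<F>: "countable \<F>" "\<And>C. C \<in> \<F> \<Longrightarrow> closedin T C \<and> T interior_of C = {}"
    "A \<subseteq> \<Union>\<F>"
    using A unfolding meager_def by blast
  have "closedin T' (f ` C)" "T' interior_of (f ` C) = {}" if "C \<in> \<F>" for C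
  proof -
    have C: "closedin T C" "T interior_of C = {}" using \<F>(2) that by auto
    then show "closedin T' (f ` C)"
      using f by (metis closedin_subset homeomorphic_map_closedness_eq)
    show "T' interior_of (f ` C) = {}"
      using homeomorphic_map_interior_of[OF f, of C] C by (simp add: closedin_subset)
  qed
  then show ?thesis
    unfolding meager_def using \<F>(1,3) by (intro exI[of _ "(`) f ` \<F>"]) (auto simp: image_iff, blast)
qed

text \<open>An open set disjoint from \<open>U\<close> is disjoint from the closure of
  \<open>U\<close>, so the boundary of \<open>U\<close> is closed with empty interior.\<close>

lemma meager_closure_diff_open:
  assumes "openin T U"
  shows "meager T (T closure_of U - U)"
proof -
  have "closedin T (T closure_of U - U)"
    using assms by (simp add: closedin_diff)
  moreover have "T interior_of (T closure_of U - U) = {}"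
  proof -
    let ?I = "T interior_of (T closure_of U - U)"
    have "?I \<inter> U = {}" using interior_of_subset[of T "T closure_of U - U"] by blast
    moreover have "?I \<subseteq> T closure_of U" using interior_of_subset[of T "T closure_of U - U"] by blast
    ultimately show ?thesis
      by (metis inf.absorb_iff1 openin_Int_closure_of_eq_empty openin_interior_of)
  qed
  ultimately show ?thesis
    unfolding meager_def by (intro exI[of _ "{T closure_of U - U}"]) auto
qed

definition baire_property :: "'a topology \<Rightarrow> 'a set \<Rightarrow> bool" where
  "baire_property T A \<longleftrightarrow>
     A \<subseteq> topspace T \<and> (\<exists>U. openin T U \<and> meager T (A - U) \<and> meager T (U - A))"

lemma baire_property_open: "openin T U \<Longrightarrow> baire_property T U"
  unfolding baire_property_def by (metis Diff_cancel meager_empty openin_subset)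

text \<open>The complement of the approximating open set is only closed. The complement of its
  closure is open and differs from it by a boundary, which is meager.\<close>

lemma baire_property_Diff:
  assumes "baire_property T A"
  shows "baire_property T (topspace T - A)"
proof -
  obtain U where U: "openin T U" "meager T (A - U)" "meager T (U - A)"
    using assms by (auto simp: baire_property_def)
  have sub: "U \<subseteq> T closure_of U" by (simp add: U(1) closure_of_subset openin_subset)
  have "meager T ((topspace T - A) - (topspace T - T closure_of U))"
    by (rule meager_subset[OF meager_Un[OF U(3) meager_closure_diff_open[OF U(1)]]])
      (use closure_of_subset_topspace in fastforce)
  moreover have "meager T ((topspace T - T closure_of U) - (topspace T - A))"
    by (rule meager_subset[OF U(2)]) (use sub in auto)
  moreover have "openin T (topspace T - T closure_of U)" by (simp add: openin_diff)
  ultimately show ?thesis unfolding baire_property_def by blast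
qed

lemma baire_property_UN:
  assumes "countable I" "\<And>i. i \<in> I \<Longrightarrow> baire_property T (A i)"
  shows "baire_property T (\<Union>i\<in>I. A i)"
proof -
  have "\<forall>i\<in>I. \<exists>U. openin T U \<and> meager T (A i - U) \<and> meager T (U - A i)"
    using assms(2) by (auto simp: baire_property_def)
  then obtain U where U: "\<forall>i\<in>I. openin T (U i) \<and> meager T (A i - U i) \<and> meager T (U i - A i)"
    by metis
  have "meager T ((\<Union>i\<in>I. A i) - (\<Union>i\<in>I. U i))"
    by (rule meager_subset[OF meager_UN[OF assms(1), of T "\<lambda>i. A i - U i"]]) (use U in auto)
  moreover have "meager T ((\<Union>i\<in>I. U i) - (\<Union>i\<in>I. A i))"
    by (rule meager_subset[OF meager_UN[OF assms(1), of T "\<lambda>i. U i - A i"]]) (use U in auto)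
  moreover have "openin T (\<Union>i\<in>I. U i)" using U by blast
  moreover have "(\<Union>i\<in>I. A i) \<subseteq> topspace T" using assms(2) by (auto simp: baire_property_def)
  ultimately show ?thesis unfolding baire_property_def by blast
qed

lemma baire_property_nonmeager:
  assumes "baire_property T A" "\<not> meager T A"
  obtains U where "openin T U" "U \<noteq> {}" "meager T (U - A)"
proof -
  obtain U where U: "openin T U" "meager T (A - U)" "meager T (U - A)"
    using assms by (auto simp: baire_property_def)
  then have "U \<noteq> {}" using assms(2) by auto
  with U that show ?thesis by blast
qed

section \<open>Borel sets of a topology and continuity off a meager set\<close>

lemma sets_borel_of: "sets (borel_of T) = sigma_sets (topspace T) {U. openin T U}"
  unfolding borel_of_def by (rule sets_measure_of) (auto dest: openin_subset)

lemma space_borel_of [simp]: "space (borel_of T) = topspace T"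
  unfolding borel_of_def by (rule space_measure_of) (auto dest: openin_subset)

lemma openin_borel_of: "openin T U \<Longrightarrow> U \<in> sets (borel_of T)"
  by (simp add: sets_borel_of sigma_sets.Basic)

lemma closedin_borel_of: "closedin T C \<Longrightarrow> C \<in> sets (borel_of T)"
  by (metis closedin_def double_diff openin_borel_of order_refl sets.compl_sets space_borel_of)

lemma measurable_borel_of:
  assumes "f \<in> space M \<rightarrow> topspace T" "\<And>U. openin T U \<Longrightarrow> f -` U \<inter> space M \<in> sets M"
  shows "f \<in> M \<rightarrow>\<^sub>M borel_of T"
  unfolding borel_of_def
  by (rule measurable_measure_of) (use assms in \<open>auto dest: openin_subset\<close>)

lemma continuous_map_measurable:
  assumes "continuous_map T T' f"
  shows "f \<in> borel_of T \<rightarrow>\<^sub>M borel_of T'"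
proof (rule measurable_borel_of)
  show "f \<in> space (borel_of T) \<rightarrow> topspace T'" using assms by (simp add: continuous_map_def)
  fix U assume "openin T' U"
  moreover have "f -` U \<inter> topspace T = {x \<in> topspace T. f x \<in> U}" by auto
  ultimately show "f -` U \<inter> space (borel_of T) \<in> sets (borel_of T)"
    using assms by (auto simp: continuous_map_def intro: openin_borel_of)
qed

lemma borel_baire_property:
  assumes "A \<in> sets (borel_of T)"
  shows "baire_property T A"
  using assms unfolding sets_borel_of
proof induction
  case (Basic a) then show ?case by (simp add: baire_property_open)
next
  case Empty then show ?case by (simp add: baire_property_open)
next
  case (Compl a) then show ?case by (simp add: baire_property_Diff)
next
  case (Union a) then show ?case using baire_property_UN[of UNIV T a] by simp
qed

text \<open>Only a countable base has to be corrected: \<open>E\<close> collects the symmetric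
  differences between the preimages of its members and the open sets approximating these. Any other
  open set is a union of basic ones, so off \<open>E\<close> its preimage is relatively
  open.\<close>

lemma baire_measurable_continuous_off_meager:
  assumes "second_countable T'"
    and bp: "\<And>W. openin T' W \<Longrightarrow> baire_property T {x \<in> topspace T. h x \<in> W}"
  obtains E where "meager T E"
    "\<And>W. openin T' W \<Longrightarrow> \<exists>U. openin T U \<and> (\<forall>x\<in>topspace T - E. h x \<in> W \<longleftrightarrow> x \<in> U)"
proof -
  obtain \<B> where \<B>: "countable \<B>" "\<And>V. V \<in> \<B> \<Longrightarrow> openin T' V"
    "\<And>U x. openin T' U \<Longrightarrow> x \<in> U \<Longrightarrow> \<exists>V\<in>\<B>. x \<in> V \<and> V \<subseteq> U"
    using assms(1) by (auto simp: second_countable_def)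
  define pre where "pre W = {x \<in> topspace T. h x \<in> W}" for W
  have "\<forall>V\<in>\<B>. \<exists>U. openin T U \<and> meager T (pre V - U) \<and> meager T (U - pre V)"
    using bp \<B>(2) unfolding baire_property_def pre_def by blast
  then obtain U where U: "\<forall>V\<in>\<B>. openin T (U V) \<and> meager T (pre V - U V) \<and> meager T (U V - pre V)"
    by metis
  define E where "E = (\<Union>V\<in>\<B>. (pre V - U V) \<union> (U V - pre V))"
  show ?thesis
  proof
    show "meager T E" unfolding E_def by (rule meager_UN) (use \<B> U in \<open>auto intro: meager_Un\<close>)
    fix W assume W: "openin T' W"
    let ?O = "\<Union>V\<in>{V \<in> \<B>. V \<subseteq> W}. U V"
    have "h x \<in> W \<longleftrightarrow> x \<in> ?O" if x: "x \<in> topspace T - E" for x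
    proof -
      have "h x \<in> W \<longleftrightarrow> (\<exists>V\<in>\<B>. h x \<in> V \<and> V \<subseteq> W)" using \<B>(3)[OF W] by blast
      also have "\<dots> \<longleftrightarrow> (\<exists>V\<in>\<B>. x \<in> U V \<and> V \<subseteq> W)" using x unfolding E_def pre_def by blast
      finally show ?thesis by auto
    qed
    moreover have "openin T ?O" using U by blast
    ultimately show "\<exists>U. openin T U \<and> (\<forall>x\<in>topspace T - E. h x \<in> W \<longleftrightarrow> x \<in> U)" by blast
  qed
qed

section \<open>Suslin schemes\<close>

text \<open>The union of the basic open sets in which \<open>A\<close> is meager is the largest open
  set of this kind; a countable base keeps the union countable, so that \<open>A\<close> is still
  meager in it.\<close>

lemma meager_part_open:
  assumes "second_countable T"
  shows "\<exists>M. openin T M \<and> meager T (A \<inter> M) \<and> (\<forall>U. openin T U \<longrightarrow> meager T (A \<inter> U) \<longrightarrow> U \<subseteq> M)"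
proof -
  obtain \<B> where \<B>: "countable \<B>" "\<And>V. V \<in> \<B> \<Longrightarrow> openin T V"
    "\<And>U x. openin T U \<Longrightarrow> x \<in> U \<Longrightarrow> \<exists>V\<in>\<B>. x \<in> V \<and> V \<subseteq> U"
    using assms(1) by (auto simp: second_countable_def)
  define M where "M = \<Union>{V\<in>\<B>. meager T (A \<inter> V)}"
  show ?thesis
  proof (intro exI[of _ M] conjI allI impI)
    show "openin T M" unfolding M_def using \<B>(2) by auto
    have "A \<inter> M = (\<Union>V\<in>{V\<in>\<B>. meager T (A \<inter> V)}. A \<inter> V)" by (auto simp: M_def)
    moreover have "meager T \<dots>"
      by (rule meager_UN) (use countable_subset[OF _ \<B>(1)] in auto)
    ultimately show "meager T (A \<inter> M)" by simp
    fix U assume U: "openin T U" "meager T (A \<inter> U)"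
    show "U \<subseteq> M"
    proof
      fix x assume "x \<in> U"
      then obtain V where V: "V \<in> \<B>" "x \<in> V" "V \<subseteq> U" using \<B>(3)[OF U(1)] by blast
      then have "meager T (A \<inter> V)" by (intro meager_subset[OF U(2)]) auto
      with V show "x \<in> M" unfolding M_def by blast
    qed
  qed
qed

text \<open>Nikodym's theorem: a closed hull \<open>H s\<close> of \<open>A s\<close>, minimal modulo meager sets, loses only a
  meager set at each node of the scheme.\<close>

lemma suslin_scheme_baire_property:
  fixes A :: "nat list \<Rightarrow> 'a set"
  assumes T: "second_countable T" "completely_metrizable_space T"
    and sub: "\<And>s. A s \<subseteq> topspace T"
    and split: "\<And>s. A s \<subseteq> (\<Union>n. A (s @ [n]))"
    and branch: "\<And>x. (\<Inter>n. T closure_of (A (map x [0..<n]))) \<subseteq> A []"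
  shows "baire_property T (A [])"
proof -
  have "\<forall>s. \<exists>M. openin T M \<and> meager T (A s \<inter> M) \<and>
      (\<forall>U. openin T U \<longrightarrow> meager T (A s \<inter> U) \<longrightarrow> U \<subseteq> M)"
    using meager_part_open[OF T(1)] by blast
  from choice[OF this] obtain M where M: "\<And>s. openin T (M s)" "\<And>s. meager T (A s \<inter> M s)"
    "\<And>s U. openin T U \<Longrightarrow> meager T (A s \<inter> U) \<Longrightarrow> U \<subseteq> M s"
    by blast
  define H where "H s = T closure_of (A s) - M s" for s
  have Hcl: "closedin T (H s)" for s unfolding H_def using M(1) by (simp add: closedin_diff)
  have bpH: "baire_property T (H s)" for s by (intro borel_baire_property closedin_borel_of Hcl)
  have AH: "meager T (A s - H s)" for s
    by (rule meager_subset[OF M(2)[of s]]) (use closure_of_subset[OF sub[of s]] in \<open>auto simp: H_def\<close>)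
  \<comment> \<open>A nonmeager loss \<open>?D\<close> would be comeager in some nonempty open
    \<open>U\<close>. The points of \<open>A s\<close> in \<open>?D\<close> lie in no
    \<open>H (s @ [n])\<close> although each lies in some \<open>A (s @ [n])\<close>, so
    \<open>A s\<close> is meager in \<open>U\<close>; maximality of \<open>M s\<close> then makes
    \<open>U\<close> disjoint from \<open>H s\<close>, hence from \<open>?D\<close>.\<close>
  have loss: "meager T (H s - (\<Union>n. H (s @ [n])))" for s
  proof (rule ccontr)
    let ?D = "H s - (\<Union>n. H (s @ [n]))"
    assume nm: "\<not> meager T ?D"
    have "?D \<in> sets (borel_of T)"
      by (intro sets.Diff sets.countable_UN closedin_borel_of Hcl) (auto intro: closedin_borel_of Hcl)
    then obtain U where U: "openin T U" "U \<noteq> {}" "meager T (U - ?D)"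
      using baire_property_nonmeager[OF borel_baire_property nm] by blast
    have "meager T (\<Union>n. A (s @ [n]) - H (s @ [n]))" by (rule meager_UN) (auto simp: AH)
    then have "meager T (A s \<inter> ?D)"
      by (rule meager_subset) (use split[of s] in blast)
    then have "meager T (A s \<inter> U)"
      by (rule meager_subset[OF meager_Un[OF _ U(3)]]) auto
    then have "U \<subseteq> M s" using M(3) U(1) by blast
    then have "U \<subseteq> U - ?D" by (auto simp: H_def)
    then have "meager T U" using U(3) meager_subset by blast
    then show False using Baire_open_not_meager[OF T(2) U(1,2)] by simp
  qed
  \<comment> \<open>A point that escapes every loss can be followed from node to node along an
    infinite branch \<open>b\<close>. It then lies in all the closures along \<open>b\<close>, and
    the hypothesis on branches puts it into \<open>A []\<close>.\<close>
  have "H [] - A [] \<subseteq> (\<Union>s. H s - (\<Union>n. H (s @ [n])))"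
  proof (rule subsetI, rule ccontr)
    fix y
    assume "y \<in> H [] - A []" and *: "y \<notin> (\<Union>s. H s - (\<Union>n. H (s @ [n])))"
    then have y: "y \<in> H []" "y \<notin> A []" by auto
    have "\<exists>n. y \<in> H (s @ [n])" if "y \<in> H s" for s using * that by auto
    then obtain c where c: "\<And>s. y \<in> H s \<Longrightarrow> y \<in> H (s @ [c s])" by metis
    define b where "b = rec_nat [] (\<lambda>_ s. s @ [c s])"
    have b: "b 0 = []" "b (Suc n) = b n @ [c (b n)]" for n by (auto simp: b_def)
    have yb: "y \<in> H (b n)" for n by (induction n) (auto simp: b y c)
    have b_eq: "map (\<lambda>i. c (b i)) [0..<n] = b n" for n by (induction n) (auto simp: b)
    have "y \<in> T closure_of (A (map (\<lambda>i. c (b i)) [0..<n]))" for n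
      unfolding b_eq using yb[of n] by (simp add: H_def)
    then have "y \<in> A []" using branch[of "\<lambda>i. c (b i)"] by blast
    with y show False by simp
  qed
  then have "meager T (H [] - A [])"
    by (rule meager_subset[rotated]) (intro meager_UN loss; simp)
  moreover obtain U where "openin T U" "meager T (H [] - U)" "meager T (U - H [])"
    using bpH[of "[]"] by (auto simp: baire_property_def)
  moreover have "meager T (A [] - U)"
    by (rule meager_subset[OF meager_Un[OF AH[of "[]"] calculation(3)]]) auto
  moreover have "meager T (U - A [])"
    by (rule meager_subset[OF meager_Un[OF calculation(4,1)]]) auto
  ultimately show ?thesis using sub unfolding baire_property_def by blast
qed

text \<open>The Suslin operation on closed sets. Instead of being indexed by finite lists,
  \<open>F x n\<close> takes the whole sequence but may read only its first \<open>n\<close> digits.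
  The sets along a branch are not asked to decrease.\<close>

definition suslin_rep :: "'a topology \<Rightarrow> 'a set \<Rightarrow> ((nat \<Rightarrow> nat) \<Rightarrow> nat \<Rightarrow> 'a set) \<Rightarrow> bool" where
  "suslin_rep T E F \<longleftrightarrow>
     (\<forall>x n. closedin T (F x n)) \<and>
     (\<forall>x y n. (\<forall>i<n. x i = y i) \<longrightarrow> F x n = F y n) \<and>
     (\<forall>z. z \<in> E \<longleftrightarrow> (\<exists>x. \<forall>n. z \<in> F x n))"

definition suslin_set :: "'a topology \<Rightarrow> 'a set \<Rightarrow> bool" where
  "suslin_set T E \<longleftrightarrow> (\<exists>F. suslin_rep T E F)"

lemma suslin_repD:
  assumes "suslin_rep T E F"
  shows "closedin T (F x n)" "(\<And>i. i < n \<Longrightarrow> x i = y i) \<Longrightarrow> F x n = F y n"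
    "z \<in> E \<longleftrightarrow> (\<exists>x. \<forall>n. z \<in> F x n)"
  using assms unfolding suslin_rep_def by auto

lemma suslin_set_closedin: "closedin T E \<Longrightarrow> suslin_set T E"
  unfolding suslin_set_def suslin_rep_def by (intro exI[of _ "\<lambda>_ _. E"]) auto

text \<open>The first digit selects a member of the union, the others a branch in its scheme. Stage
  \<open>0\<close> may read no digit and is therefore the whole space.\<close>

lemma suslin_set_UN:
  assumes "\<And>m::nat. suslin_set T (E m)"
  shows "suslin_set T (\<Union>m. E m)"
proof -
  obtain F where F: "\<And>m. suslin_rep T (E m) (F m)"
    using assms unfolding suslin_set_def by metis
  define F' where
    "F' x k = (case k of 0 \<Rightarrow> topspace T | Suc n \<Rightarrow> F (x 0) (\<lambda>i. x (Suc i)) n)" for x :: "nat \<Rightarrow> nat" and k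
  have "suslin_rep T (\<Union>m. E m) F'"
    unfolding suslin_rep_def
  proof (intro conjI allI impI)
    show "closedin T (F' x k)" for x k by (auto simp: F'_def suslin_repD(1)[OF F] split: nat.split)
    show "F' x k = F' y k" if xy: "\<forall>i<k. x i = y i" for x y k
    proof (cases k)
      case (Suc n)
      then have "F (x 0) (\<lambda>i. x (Suc i)) n = F (x 0) (\<lambda>i. y (Suc i)) n"
        using xy by (intro suslin_repD(2)[OF F]) auto
      then show ?thesis using Suc xy by (auto simp: F'_def)
    qed (simp add: F'_def)
    show "z \<in> (\<Union>m. E m) \<longleftrightarrow> (\<exists>x. \<forall>k. z \<in> F' x k)" for z
    proof
      assume "z \<in> (\<Union>m. E m)"
      then obtain m x where x: "\<And>n. z \<in> F m x n" using suslin_repD(3)[OF F] by auto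
      then have "z \<in> topspace T" using suslin_repD(1)[OF F] closedin_subset by blast
      then have "z \<in> F' (case_nat m x) k" for k using x by (auto simp: F'_def split: nat.split)
      then show "\<exists>x. \<forall>k. z \<in> F' x k" by blast
    next
      assume "\<exists>x. \<forall>k. z \<in> F' x k"
      then obtain x where "\<And>k. z \<in> F' x k" by blast
      from this[of "Suc _"] have "z \<in> F (x 0) (\<lambda>i. x (Suc i)) n" for n by (simp add: F'_def)
      then have "z \<in> E (x 0)" using suslin_repD(3)[OF F] by blast
      then show "z \<in> (\<Union>m. E m)" by blast
    qed
  qed
  then show ?thesis unfolding suslin_set_def by blast
qed

text \<open>One sequence codes a branch for every \<open>m\<close>: digit \<open>i\<close> of branch
  \<open>m\<close> is stored at \<open>prod_encode (m, i)\<close>.\<close>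

lemma suslin_set_INT:
  assumes "\<And>m::nat. suslin_set T (E m)"
  shows "suslin_set T (\<Inter>m. E m)"
proof -
  obtain F where F: "\<And>m. suslin_rep T (E m) (F m)"
    using assms unfolding suslin_set_def by metis
  define F' where "F' x k = (case prod_decode k of (m, n) \<Rightarrow> F m (\<lambda>i. x (prod_encode (m, i))) n)"
    for x :: "nat \<Rightarrow> nat" and k
  have F'enc: "F' x (prod_encode (m, n)) = F m (\<lambda>i. x (prod_encode (m, i))) n" for x m n
    by (simp add: F'_def)
  have "suslin_rep T (\<Inter>m. E m) F'"
    unfolding suslin_rep_def
  proof (intro conjI allI impI)
    show "closedin T (F' x k)" for x k by (auto simp: F'_def suslin_repD(1)[OF F] split: prod.split)
    show "F' x k = F' y k" if xy: "\<forall>i<k. x i = y i" for x y k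
    proof -
      obtain m n where k: "k = prod_encode (m, n)" by (metis prod_decode_inverse surj_pair)
      \<comment> \<open>Stage \<open>k\<close> may read only digits below \<open>k\<close>. Since
        \<open>prod_encode (m, i)\<close> is \<open>triangle (m + i) + m\<close>, it grows strictly
        with \<open>i\<close>.\<close>
      have "prod_encode (m, i) < k" if "i < n" for i
      proof -
        have "triangle (m + i) < triangle (Suc (m + i))" by simp
        also have "\<dots> \<le> triangle (m + n)"
          unfolding triangle_def using that by (intro div_le_mono mult_le_mono) auto
        finally show ?thesis by (simp add: k prod_encode_def)
      qed
      then show ?thesis unfolding k F'enc by (intro suslin_repD(2)[OF F]) (use xy k in auto)
    qed
    show "z \<in> (\<Inter>m. E m) \<longleftrightarrow> (\<exists>x. \<forall>k. z \<in> F' x k)" for z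
    proof
      assume "z \<in> (\<Inter>m. E m)"
      then have "\<forall>m. \<exists>x. \<forall>n. z \<in> F m x n" using suslin_repD(3)[OF F] by blast
      then obtain x where x: "\<And>m n. z \<in> F m (x m) n" by metis
      define x' where "x' k = (case prod_decode k of (m, i) \<Rightarrow> x m i)" for k
      have "z \<in> F' x' k" for k
        using x by (auto simp: F'_def x'_def split: prod.split)
      then show "\<exists>x. \<forall>k. z \<in> F' x k" by blast
    next
      assume "\<exists>x. \<forall>k. z \<in> F' x k"
      then obtain x where "\<And>k. z \<in> F' x k" by blast
      then have "z \<in> F m (\<lambda>i. x (prod_encode (m, i))) n" for m n by (metis F'enc)
      then show "z \<in> (\<Inter>m. E m)" using suslin_repD(3)[OF F] by blast
    qed
  qed
  then show ?thesis unfolding suslin_set_def by blast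
qed

lemma suslin_set_openin:
  assumes "metrizable_space T" "openin T U"
  shows "suslin_set T U"
proof -
  have "fsigma_in T U" by (simp add: assms open_imp_fsigma_in)
  then obtain C :: "nat \<Rightarrow> 'a set" where "\<And>n. closedin T (C n)" "\<Union>(range C) = U"
    unfolding fsigma_in_ascending by blast
  then show ?thesis using suslin_set_UN[of T C] suslin_set_closedin by metis
qed

text \<open>Suslin sets are not closed under complements, so the induction carries a set together
  with its complement.\<close>

lemma borel_suslin_set:
  assumes T: "metrizable_space T" and E: "E \<in> sets (borel_of T)"
  shows "suslin_set T E"
proof -
  from E have "E \<subseteq> topspace T \<and> suslin_set T E \<and> suslin_set T (topspace T - E)"
    unfolding sets_borel_of
  proof induction
    case (Basic a)
    then show ?case using suslin_set_openin[OF T] suslin_set_closedin[of T "topspace T - a"]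
      by (auto dest: openin_subset)
  next
    case Empty then show ?case by (auto intro: suslin_set_closedin)
  next
    case (Compl a) then show ?case by (simp add: double_diff)
  next
    case (Union a)
    have "topspace T - \<Union>(range a) = (\<Inter>i. topspace T - a i)" by auto
    then show ?case using Union suslin_set_UN[of T a] suslin_set_INT[of T "\<lambda>i. topspace T - a i"] by auto
  qed
  then show ?thesis by simp
qed

section \<open>Projections of Suslin sets along a Polish factor\<close>

lemma separable_metrizable_imp_second_countable:
  assumes "metrizable_space T" "separable_space T"
  shows "second_countable T"
proof -
  obtain M d where Md: "Metric_space M d" and T: "T = Metric_space.mtopology M d"
    using assms(1) by (auto simp: metrizable_space_def)
  interpret Metric_space M d by (rule Md)
  obtain D where D: "countable D" "D \<subseteq> M" "mtopology closure_of D = M"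
    using assms(2) unfolding T separable_space_def by auto
  let ?B = "(\<lambda>(x, n). mball x (inverse (Suc n))) ` (D \<times> (UNIV :: nat set))"
  show ?thesis
    unfolding second_countable_def
  proof (intro exI[of _ ?B] conjI ballI allI impI)
    show "countable ?B" using D(1) by auto
    show "openin T V" if "V \<in> ?B" for V using that by (auto simp: T)
    fix U x assume Ux: "openin T U \<and> x \<in> U"
    then obtain r where r: "r > 0" "mball x r \<subseteq> U" "x \<in> M" unfolding T openin_mtopology by blast
    obtain n where n: "inverse (Suc n) < r / 2" using r(1) reals_Archimedean[of "r/2"] by auto
    have "x \<in> mtopology closure_of D" using r D by simp
    then have "\<forall>e>0. \<exists>y\<in>D. y \<in> mball x e" unfolding metric_closure_of by simp
    then obtain y where "y \<in> D" "y \<in> mball x (inverse (Suc n))"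
      by (meson inverse_positive_iff_positive of_nat_0_less_iff zero_less_Suc)
    then have y: "y \<in> D" "d x y < inverse (Suc n)" by auto
    have yM: "y \<in> M" using y D by auto
    have "mball y (inverse (Suc n)) \<subseteq> mball x r"
    proof
      fix z assume "z \<in> mball y (inverse (Suc n))"
      then have z: "z \<in> M" "d y z < inverse (Suc n)" by auto
      have "d x z \<le> d x y + d y z" using triangle r(3) yM z by blast
      then show "z \<in> mball x r" using y(2) z n r(3) by auto
    qed
    then have "mball y (inverse (Suc n)) \<subseteq> U" using r by blast
    moreover have "x \<in> mball y (inverse (Suc n))" using y yM r by (simp add: commute)
    ultimately show "\<exists>V\<in>?B. x \<in> V \<and> V \<subseteq> U" using y by (intro bexI[of _ "mball y (inverse (Suc n))"]) auto
  qed
qed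

lemma metrizable_closure_of_sequence:
  assumes "metrizable_space T" "x \<in> T closure_of A"
  obtains \<sigma> where "range \<sigma> \<subseteq> A" "limitin T \<sigma> x sequentially"
proof -
  obtain M d where Md: "Metric_space M d" and T: "T = Metric_space.mtopology M d"
    using assms(1) by (auto simp: metrizable_space_def)
  interpret Metric_space M d by (rule Md)
  have x: "x \<in> M" "\<And>r. r > 0 \<Longrightarrow> \<exists>y\<in>A. y \<in> mball x r"
    using assms(2) unfolding T metric_closure_of by auto
  then have "\<forall>n. \<exists>y\<in>A. y \<in> mball x (inverse (Suc n))" by (simp del: of_nat_Suc in_mball)
  then obtain \<sigma> where \<sigma>: "\<And>n. \<sigma> n \<in> A" "\<And>n. \<sigma> n \<in> mball x (inverse (Suc n))" by metis
  have "limitin mtopology \<sigma> x sequentially"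
    unfolding limit_metric_sequentially
  proof (intro conjI x allI impI)
    fix e :: real assume "e > 0"
    then obtain N where N: "inverse (Suc N) < e" using reals_Archimedean by blast
    have "\<sigma> n \<in> M \<and> d (\<sigma> n) x < e" if "n \<ge> N" for n
    proof -
      have "inverse (real (Suc n)) \<le> inverse (Suc N)" using that by (intro le_imp_inverse_le) auto
      moreover have "\<sigma> n \<in> M" "d x (\<sigma> n) < inverse (Suc n)" using \<sigma>(2)[of n] by auto
      ultimately show ?thesis using N by (metis commute less_le_trans less_trans x(1))
    qed
    then show "\<exists>N. \<forall>n\<ge>N. \<sigma> n \<in> M \<and> d (\<sigma> n) x < e" by blast
  qed
  then show ?thesis using that \<sigma>(1) T by blast
qed

text \<open>Each entry of a node codes a digit of the Suslin branch together with the index of a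
  point of a dense sequence within \<open>1/(i+1)\<close> of the first coordinate;
  \<open>A s\<close> keeps the points that have a witness obeying \<open>s\<close>. Along an
  infinite branch these dense points form a Cauchy sequence, whose limit is a first coordinate for
  every point lying in all the closures.\<close>

lemma suslin_set_projection_baire_property:
  assumes Y: "completely_metrizable_space Y" "separable_space Y"
    and X: "completely_metrizable_space X" "second_countable X"
    and E: "suslin_set (prod_topology Y X) E"
  shows "baire_property X (snd ` E)"
\<comment> \<open>The dense set has to be nonempty to be enumerated by \<open>nat\<close>.\<close>
proof (cases "E = {}")
  case True
  then show ?thesis by (simp add: baire_property_open)
next
  case False
  obtain M d where Md: "Metric_space M d" "Metric_space.mcomplete M d" and Yeq: "Y = Metric_space.mtopology M d"
    using Y(1) by (auto simp: completely_metrizable_space_def)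
  interpret Metric_space M d by (rule Md)
  obtain F where F: "suslin_rep (prod_topology Y X) E F" using E by (auto simp: suslin_set_def)
  have Fsub: "F x n \<subseteq> M \<times> topspace X" for x n
    using closedin_subset[OF suslin_repD(1)[OF F]] by (auto simp: Yeq)
  have "M \<noteq> {}" using False suslin_repD(3)[OF F] Fsub by fastforce
  obtain D where D: "countable D" "D \<subseteq> M" "mtopology closure_of D = M"
    using Y(2) unfolding Yeq separable_space_def by auto
  have "D \<noteq> {}" using D(3) \<open>M \<noteq> {}\<close> by auto
  then obtain e :: "nat \<Rightarrow> 'a" where e: "range e = D" using D(1) by (metis uncountable_def)
  have eM: "e i \<in> M" for i using e D(2) by auto
  have dense: "\<exists>i. d g (e i) < r" if "g \<in> M" "r > 0" for g r
  proof -
    have "g \<in> mtopology closure_of D" using that D by simp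
    then show ?thesis using that(2) unfolding metric_closure_of e[symmetric] by auto
  qed
  define node where "node x g m i \<longleftrightarrow> x i = fst (prod_decode m) \<and>
      d g (e (snd (prod_decode m))) < inverse (Suc i)" for x :: "nat \<Rightarrow> nat" and g m i
  define A where "A s = {a. \<exists>g x. (\<forall>n. (g, a) \<in> F x n) \<and> (\<forall>i<length s. node x g (s ! i) i)}" for s
  have A0: "A [] = snd ` E"
    unfolding A_def using suslin_repD(3)[OF F] by (force simp: image_iff)
  have "baire_property X (A [])"
  proof (rule suslin_scheme_baire_property[OF X(2,1)])
    show "A s \<subseteq> topspace X" for s unfolding A_def using Fsub by fastforce
    show "A s \<subseteq> (\<Union>n. A (s @ [n]))" for s
    proof
      fix a assume "a \<in> A s"
      then obtain g x where g: "\<And>n. (g, a) \<in> F x n" "\<And>i. i < length s \<Longrightarrow> node x g (s ! i) i"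
        unfolding A_def by blast
      have "g \<in> M" using g(1) Fsub by fastforce
      then obtain c where c: "d g (e c) < inverse (Suc (length s))"
        using dense[of g "inverse (Suc (length s))"] by auto
      let ?m = "prod_encode (x (length s), c)"
      have "node x g ((s @ [?m]) ! i) i" if "i < length (s @ [?m])" for i
      proof (cases "i < length s")
        case True then show ?thesis by (simp add: nth_append g(2))
      next
        case False
        then have "i = length s" using that by simp
        then show ?thesis using c by (simp add: node_def)
      qed
      then have "a \<in> A (s @ [?m])" unfolding A_def using g(1) by blast
      then show "a \<in> (\<Union>n. A (s @ [n]))" by blast
    qed
    show "(\<Inter>n. X closure_of A (map x [0..<n])) \<subseteq> A []" for x
    proof
      fix y assume "y \<in> (\<Inter>n. X closure_of A (map x [0..<n]))"
      then have y: "y \<in> X closure_of A (map x [0..<n])" for n by blast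
      define u where "u i = fst (prod_decode (x i))" for i
      define c where "c i = e (snd (prod_decode (x i)))" for i
      \<comment> \<open>The branch of a witness for a point of \<open>A\<close> near
        \<open>y\<close> agrees with \<open>u\<close> on the first \<open>n\<close> digits, so the
        pair lies in \<open>F u k\<close> for all \<open>k \<le> n\<close>. The witness depends on
        \<open>n\<close> and on the neighbourhood.\<close>
      have near: "\<exists>g a. a \<in> W \<and> g \<in> M \<and> (\<forall>k\<le>n. (g, a) \<in> F u k) \<and> (\<forall>i<n. d g (c i) < inverse (Suc i))"
        if W: "openin X W" "y \<in> W" for W n
      proof -
        obtain a where a: "a \<in> A (map x [0..<n])" "a \<in> W" using y[of n] W unfolding in_closure_of by blast
        then obtain g x' where g: "\<And>k. (g, a) \<in> F x' k" "\<And>i. i < n \<Longrightarrow> node x' g (x i) i"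
          unfolding A_def by auto
        have "F x' k = F u k" if "k \<le> n" for k
          by (rule suslin_repD(2)[OF F]) (use g(2) that in \<open>auto simp: node_def u_def\<close>)
        then have "(g, a) \<in> F u k" if "k \<le> n" for k using g(1)[of k] that by simp
        moreover have "g \<in> M" using g(1) Fsub by fastforce
        moreover have "d g (c i) < inverse (Suc i)" if "i < n" for i
          using g(2)[OF that] by (simp add: node_def c_def)
        ultimately show ?thesis using a(2) by blast
      qed
      have ytop: "y \<in> topspace X" using y[of 0] closure_of_subset_topspace by fastforce
      have cM: "c i \<in> M" for i by (simp add: c_def eM)
      \<comment> \<open>One witness is close to \<open>c i\<close> and \<open>c j\<close> at the
        same time.\<close>
      have dc: "d (c i) (c j) < inverse (Suc i) + inverse (Suc j)" for i j
      proof -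
        obtain g where g: "g \<in> M" "\<forall>k<Suc (max i j). d g (c k) < inverse (Suc k)"
          using near[OF openin_topspace ytop] by blast
        have "d (c i) (c j) \<le> d g (c i) + d g (c j)" using triangle'' cM g by blast
        moreover have "d g (c i) < inverse (Suc i)" "d g (c j) < inverse (Suc j)"
          using g(2)[rule_format, of i] g(2)[rule_format, of j] by auto
        ultimately show ?thesis by linarith
      qed
      have "MCauchy c"
        unfolding MCauchy_def
      proof (intro conjI allI impI)
        show "range c \<subseteq> M" using cM by auto
        fix r :: real assume "r > 0"
        then obtain N where N: "inverse (Suc N) < r / 2" using reals_Archimedean[of "r/2"] by auto
        have "d (c i) (c j) < r" if "N \<le> i" "N \<le> j" for i j
        proof -
          have "inverse (real (Suc i)) \<le> inverse (Suc N)" "inverse (real (Suc j)) \<le> inverse (Suc N)"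
            using that by (auto intro!: le_imp_inverse_le)
          then show ?thesis using dc[of i j] N by linarith
        qed
        then show "\<exists>N. \<forall>n n'. N \<le> n \<longrightarrow> N \<le> n' \<longrightarrow> d (c n) (c n') < r" by blast
      qed
      then obtain g where g: "limitin mtopology c g sequentially" using Md(2) mcomplete_def by blast
      have gM: "g \<in> M" using g limitin_mspace by blast
      have "(g, y) \<in> F u k" for k
      proof -
        \<comment> \<open>The first coordinates of late witnesses follow the \<open>c i\<close>,
          which converge to \<open>g\<close>; so every neighbourhood of \<open>(g, y)\<close> meets
          \<open>F u k\<close>, and \<open>F u k\<close> is closed.\<close>
        have "(g, y) \<in> prod_topology Y X closure_of F u k"
          unfolding in_closure_of
        proof (intro conjI allI impI)
          show "(g, y) \<in> topspace (prod_topology Y X)" using gM ytop by (simp add: Yeq)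
          fix W assume W: "(g, y) \<in> W \<and> openin (prod_topology Y X) W"
          then obtain V1 V2 where V: "openin Y V1" "openin X V2" "g \<in> V1" "y \<in> V2" "V1 \<times> V2 \<subseteq> W"
            unfolding openin_prod_topology_alt by blast
          then obtain r where r: "r > 0" "mball g r \<subseteq> V1" by (auto simp: Yeq openin_mtopology)
          obtain N1 where N1: "inverse (Suc N1) < r / 2" using r reals_Archimedean[of "r/2"] by auto
          obtain N2 where N2: "\<And>n. n \<ge> N2 \<Longrightarrow> d (c n) g < r / 2"
            using g r(1) unfolding limit_metric_sequentially by (metis half_gt_zero)
          define i where "i = max N1 N2"
          obtain g' a where ga: "a \<in> V2" "g' \<in> M" "\<forall>j\<le>max k (Suc i). (g', a) \<in> F u j"
              "\<forall>j<max k (Suc i). d g' (c j) < inverse (Suc j)"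
            using near[OF V(2,4)] by blast
          have "inverse (real (Suc i)) \<le> inverse (Suc N1)" by (intro le_imp_inverse_le) (auto simp: i_def)
          moreover have "d g' (c i) < inverse (Suc i)" using ga(4) by auto
          moreover have "d (c i) g < r / 2" using N2 by (simp add: i_def)
          moreover have "d g g' \<le> d (c i) g + d g' (c i)" using triangle[OF gM cM ga(2), of i] by (simp add: commute)
          ultimately have "d g g' < r" using N1 by linarith
          then have "g' \<in> V1" using r gM ga(2) by auto
          then have "(g', a) \<in> F u k \<and> (g', a) \<in> W" using ga V by auto
          then show "\<exists>z. z \<in> F u k \<and> z \<in> W" by blast
        qed
        then show ?thesis using suslin_repD(1)[OF F] closure_of_closedin by blast
      qed
      then show "y \<in> A []" unfolding A_def by auto
    qed
  qed
  then show ?thesis using A0 by simp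
qed

section \<open>Abelian Polish groups\<close>

lemma (in group) inv_mult_cancel [simp]:
  assumes "a \<in> carrier G" "x \<in> carrier G"
  shows "inv a \<otimes> (a \<otimes> x) = x" "a \<otimes> (inv a \<otimes> x) = x"
  using assms by (simp_all add: m_assoc[symmetric])

locale abelian_polish = comm_group G for G (structure) +
  fixes T :: "'a topology"
  assumes abelian_polish_group: "abelian_polish_group G T"
begin

lemma topspace_eq [simp]: "topspace T = carrier G"
  using abelian_polish_group by (simp add: abelian_polish_group_def)

lemma completely_metrizable: "completely_metrizable_space T"
  using abelian_polish_group by (simp add: abelian_polish_group_def polish_space_top_def)

lemma metrizable: "metrizable_space T"
  by (simp add: completely_metrizable completely_metrizable_imp_metrizable_space)

lemma separable: "separable_space T"
  using abelian_polish_group by (simp add: abelian_polish_group_def polish_space_top_def)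

lemma second_countable: "second_countable T"
  by (simp add: metrizable separable separable_metrizable_imp_second_countable)

lemma continuous_map_mult:
  assumes "continuous_map X T f" "continuous_map X T g"
  shows "continuous_map X T (\<lambda>x. f x \<otimes> g x)"
proof -
  have "continuous_map X T ((\<lambda>(x, y). x \<otimes> y) \<circ> (\<lambda>x. (f x, g x)))"
    using abelian_polish_group assms
    by (intro continuous_map_compose[of _ "prod_topology T T"])
      (auto simp: abelian_polish_group_def continuous_map_pairedI)
  then show ?thesis by (simp add: o_def)
qed

lemma continuous_map_m_inv:
  assumes "continuous_map X T f"
  shows "continuous_map X T (\<lambda>x. inv (f x))"
proof -
  have "continuous_map X T ((\<lambda>x. inv x) \<circ> f)"
    using abelian_polish_group assms
    by (intro continuous_map_compose[of _ T]) (auto simp: abelian_polish_group_def)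
  then show ?thesis by (simp add: o_def)
qed

lemma continuous_map_translate: "a \<in> carrier G \<Longrightarrow> continuous_map T T (\<lambda>x. a \<otimes> x)"
  by (intro continuous_map_mult continuous_map_id[unfolded id_def]) simp

lemma continuous_map_rtranslate: "a \<in> carrier G \<Longrightarrow> continuous_map T T (\<lambda>x. x \<otimes> a)"
  by (intro continuous_map_mult continuous_map_id[unfolded id_def]) simp

lemma homeomorphic_translate:
  assumes "a \<in> carrier G"
  shows "homeomorphic_map T T (\<lambda>x. a \<otimes> x)"
proof -
  have "homeomorphic_maps T T (\<lambda>x. a \<otimes> x) (\<lambda>x. inv a \<otimes> x)"
    unfolding homeomorphic_maps_def using assms
    by (auto intro!: continuous_map_translate simp: m_assoc[symmetric])
  then show ?thesis using homeomorphic_maps_map by blast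
qed

lemma openin_translate: "a \<in> carrier G \<Longrightarrow> openin T U \<Longrightarrow> openin T ((\<lambda>x. a \<otimes> x) ` U)"
  using homeomorphic_translate homeomorphic_imp_open_map open_map_def by blast

lemma closure_translate:
  "a \<in> carrier G \<Longrightarrow> S \<subseteq> carrier G \<Longrightarrow> T closure_of ((\<lambda>x. a \<otimes> x) ` S) = (\<lambda>x. a \<otimes> x) ` (T closure_of S)"
  using homeomorphic_map_closure_of[OF homeomorphic_translate, of a S] by simp

text \<open>For fixed \<open>a\<close> the bad \<open>t\<close> form the translate of
  \<open>E\<close> by \<open>inv a\<close>, which is meager because translation is a homeomorphism.
  \<open>E'\<close> is a further meager set to be avoided by \<open>t\<close> itself.\<close>

lemma generic_translates:
  assumes "meager T E" "meager T E'" "openin T U" "U \<noteq> {}" "countable A" "A \<subseteq> carrier G"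
  obtains t where "t \<in> U" "t \<notin> E'" "\<And>a. a \<in> A \<Longrightarrow> a \<otimes> t \<notin> E"
proof -
  let ?B = "E' \<union> (\<Union>a\<in>A. (\<lambda>x. inv a \<otimes> x) ` (E \<inter> carrier G))"
  have "meager T (\<Union>a\<in>A. (\<lambda>x. inv a \<otimes> x) ` (E \<inter> carrier G))"
    using assms by (intro meager_UN meager_homeomorphic_image[OF homeomorphic_translate])
      (auto intro: meager_subset)
  then have "meager T ?B" using assms(2) by (rule meager_Un[rotated])
  then have "\<not> U \<subseteq> ?B"
    using Baire_open_not_meager[OF completely_metrizable assms(3,4)] meager_subset by blast
  then obtain t where t: "t \<in> U" "t \<notin> ?B" by blast
  have tG: "t \<in> carrier G" using t(1) openin_subset[OF assms(3)] by auto
  have "a \<otimes> t \<notin> E" if a: "a \<in> A" for a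
  proof
    assume "a \<otimes> t \<in> E"
    moreover have aG: "a \<in> carrier G" using a assms(6) by auto
    ultimately have "inv a \<otimes> (a \<otimes> t) \<in> (\<lambda>x. inv a \<otimes> x) ` (E \<inter> carrier G)"
      using tG by (intro imageI) simp
    moreover have "inv a \<otimes> (a \<otimes> t) = t" using aG tG by (simp add: m_assoc[symmetric])
    ultimately show False using t(2) a by auto
  qed
  with t that show ?thesis by auto
qed

end

section \<open>Automatic continuity and uniqueness of the Polish topology\<close>

lemma abelian_polishI: "abelian_polish_group G T \<Longrightarrow> abelian_polish G T"
  by (simp add: abelian_polish_def abelian_polish_axioms_def abelian_polish_group_def)

text \<open>Off a meager set \<open>h\<close> is continuous, and some \<open>t\<close> moves a
  convergent sequence together with its limit off that set. There the values of \<open>h\<close>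
  converge, and multiplicativity cancels \<open>h t\<close>.\<close>

lemma baire_measurable_hom_continuous:
  assumes G: "abelian_polish_group G T" and H: "abelian_polish_group H T'"
    and h: "h \<in> hom G H"
    and bp: "\<And>W. openin T' W \<Longrightarrow> baire_property T {x \<in> carrier G. h x \<in> W}"
  shows "continuous_map T T' h"
proof -
  interpret G: abelian_polish G T by (rule abelian_polishI[OF G])
  interpret H: abelian_polish H T' by (rule abelian_polishI[OF H])
  have hc: "h x \<in> carrier H" if "x \<in> carrier G" for x using h that by (auto simp: hom_def)
  obtain E where E: "meager T E"
    "\<And>W. openin T' W \<Longrightarrow> \<exists>U. openin T U \<and> (\<forall>x\<in>topspace T - E. h x \<in> W \<longleftrightarrow> x \<in> U)"
    using baire_measurable_continuous_off_meager[OF H.second_countable, of T h] bp by auto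
  have "h ` (T closure_of A) \<subseteq> T' closure_of (h ` A)" for A
  proof clarify
    fix x assume "x \<in> T closure_of A"
    then have x: "x \<in> T closure_of (topspace T \<inter> A)" by (simp only: closure_of_restrict[symmetric])
    then have xG: "x \<in> carrier G" using closure_of_subset_topspace by fastforce
    obtain \<sigma> where \<sigma>: "range \<sigma> \<subseteq> topspace T \<inter> A" "limitin T \<sigma> x sequentially"
      using metrizable_closure_of_sequence[OF G.metrizable x] .
    obtain t where t: "t \<in> carrier G" "\<And>a. a \<in> insert x (range \<sigma>) \<Longrightarrow> a \<otimes>\<^bsub>G\<^esub> t \<notin> E"
    proof (rule G.generic_translates[OF E(1) meager_empty, of "topspace T" "insert x (range \<sigma>)"])
      show "insert x (range \<sigma>) \<subseteq> carrier G" using \<sigma>(1) xG by auto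
      show "openin T (topspace T)" by (rule openin_topspace)
    qed (use G.one_closed in auto)
    show "h x \<in> T' closure_of (h ` A)"
      unfolding in_closure_of
    proof (intro conjI allI impI)
      show "h x \<in> topspace T'" using hc xG by simp
      fix W assume W: "h x \<in> W \<and> openin T' W"
      let ?W = "(\<lambda>y. h t \<otimes>\<^bsub>H\<^esub> y) ` W"
      have "openin T' ?W" by (rule H.openin_translate[OF hc[OF t(1)] conjunct2[OF W]])
      then obtain U where U: "openin T U" "\<And>y. y \<in> topspace T - E \<Longrightarrow> h y \<in> ?W \<longleftrightarrow> y \<in> U"
        using E(2)[of ?W] by fast
      have hxt: "h (a \<otimes>\<^bsub>G\<^esub> t) = h t \<otimes>\<^bsub>H\<^esub> h a" if "a \<in> carrier G" for a
        using h that t(1) hc by (simp add: hom_mult H.m_comm)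
      have "h (x \<otimes>\<^bsub>G\<^esub> t) \<in> ?W" using hxt[OF xG] W by auto
      then have "x \<otimes>\<^bsub>G\<^esub> t \<in> U" using U(2)[of "x \<otimes>\<^bsub>G\<^esub> t"] t(1) t(2)[of x] xG by simp
      moreover have "limitin T (\<lambda>k. \<sigma> k \<otimes>\<^bsub>G\<^esub> t) (x \<otimes>\<^bsub>G\<^esub> t) sequentially"
        using continuous_map_limit[OF G.continuous_map_rtranslate[OF t(1)] \<sigma>(2)] by (simp add: o_def)
      ultimately have "\<forall>\<^sub>F k in sequentially. \<sigma> k \<otimes>\<^bsub>G\<^esub> t \<in> U" using U(1) by (simp add: limitin_def)
      then obtain k where k: "\<sigma> k \<otimes>\<^bsub>G\<^esub> t \<in> U" by (auto simp: eventually_sequentially)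
      have sG: "\<sigma> k \<in> carrier G" "\<sigma> k \<in> A" using \<sigma>(1) by auto
      have "h (\<sigma> k \<otimes>\<^bsub>G\<^esub> t) \<in> ?W"
        using U(2)[of "\<sigma> k \<otimes>\<^bsub>G\<^esub> t"] k t(1) t(2)[of "\<sigma> k"] sG by simp
      then obtain w where w: "w \<in> W" "h t \<otimes>\<^bsub>H\<^esub> h (\<sigma> k) = h t \<otimes>\<^bsub>H\<^esub> w" using hxt[OF sG(1)] by auto
      have "w \<in> carrier H" using w(1) W openin_subset by fastforce
      then have "h (\<sigma> k) = w" using w(2) hc t(1) sG by (metis H.inv_mult_cancel(1))
      then show "\<exists>y. y \<in> h ` A \<and> y \<in> W" using w(1) sG by blast
    qed
  qed
  then show ?thesis unfolding continuous_map_eq_image_closure_subset by blast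
qed

lemma polishing_topologyD:
  assumes "polishing_topology G T S T'"
  shows "abelian_polish_group (G\<lparr>carrier := S\<rparr>) T'" "openin T' U \<Longrightarrow> U \<in> sets (borel_of T)"
    "topspace T' = S"
  using assms by (auto simp: polishing_topology_def abelian_polish_group_def)

text \<open>The graph of the inclusion is Borel in the product of the two topologies, so a relatively
  open subset of \<open>S\<close> is a projection of a Borel set and has the Baire property for \<open>T'\<close>.\<close>

lemma polishing_inclusion_continuous:
  assumes G: "abelian_polish_group G T" and S: "S \<in> sets (borel_of T)"
    and T': "polishing_topology G T S T'"
  shows "continuous_map T' T (\<lambda>x. x)"
proof (rule baire_measurable_hom_continuous[OF polishing_topologyD(1)[OF T'] G])
  interpret G: abelian_polish G T by (rule abelian_polishI[OF G])
  interpret S: abelian_polish "G\<lparr>carrier := S\<rparr>" T' by (rule abelian_polishI[OF polishing_topologyD(1)[OF T']])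
  have SG: "S \<subseteq> carrier G" using sets.sets_into_space[OF S] by simp
  show "(\<lambda>x. x) \<in> hom (G\<lparr>carrier := S\<rparr>) G" using SG by (auto simp: hom_def)
  fix W assume W: "openin T W"
  let ?P = "prod_topology T T'"
  obtain \<B> where \<B>: "countable \<B>" "\<And>V. V \<in> \<B> \<Longrightarrow> openin T' V"
    "\<And>U x. openin T' U \<Longrightarrow> x \<in> U \<Longrightarrow> \<exists>V\<in>\<B>. x \<in> V \<and> V \<subseteq> U"
    using S.second_countable by (auto simp: second_countable_def)
  \<comment> \<open>This is the diagonal over \<open>W \<inter> S\<close>: points of
    \<open>S\<close> in the same members of \<open>\<B>\<close> are equal. In this form it is
    visibly Borel in the product, because each \<open>V\<close> in \<open>\<B>\<close> is open in
    \<open>T'\<close> and Borel in \<open>T\<close>.\<close>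
  let ?E = "{z \<in> space (borel_of ?P). fst z \<in> W \<inter> S \<and> (\<forall>V\<in>\<B>. fst z \<in> V \<longleftrightarrow> snd z \<in> V)}"
  have fst: "fst \<in> borel_of ?P \<rightarrow>\<^sub>M borel_of T" and snd: "snd \<in> borel_of ?P \<rightarrow>\<^sub>M borel_of T'"
    by (intro continuous_map_measurable continuous_map_fst continuous_map_snd)+
  have fstB: "{z \<in> space (borel_of ?P). fst z \<in> B} \<in> sets (borel_of ?P)" if "B \<in> sets (borel_of T)" for B
    using measurable_sets[OF fst that] by (simp add: vimage_def Int_def conj_commute)
  have sndB: "{z \<in> space (borel_of ?P). snd z \<in> B} \<in> sets (borel_of ?P)" if "B \<in> sets (borel_of T')" for B
    using measurable_sets[OF snd that] by (simp add: vimage_def Int_def conj_commute)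
  have "{z \<in> space (borel_of ?P). (fst z \<in> V) = (snd z \<in> V)} \<in> sets (borel_of ?P)" if "V \<in> \<B>" for V
  proof -
    have V: "openin T' V" using \<B> that by simp
    show ?thesis
      unfolding iff_conv_conj_imp
      by (intro sets.sets_Collect_conj sets.sets_Collect_imp fstB sndB openin_borel_of V
          polishing_topologyD(2)[OF T' V])
  qed
  then have "{z \<in> space (borel_of ?P). \<forall>V\<in>\<B>. (fst z \<in> V) = (snd z \<in> V)} \<in> sets (borel_of ?P)"
    by (rule sets.sets_Collect_countable_All'[OF _ \<B>(1)])
  moreover have "W \<inter> S \<in> sets (borel_of T)" using W S openin_borel_of by blast
  ultimately have "?E \<in> sets (borel_of ?P)"
    by (intro sets.sets_Collect_conj fstB)
  moreover have "completely_metrizable_space ?P"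
    by (simp add: completely_metrizable_space_prod_topology G.completely_metrizable S.completely_metrizable)
  ultimately have "suslin_set ?P ?E"
    by (intro borel_suslin_set completely_metrizable_imp_metrizable_space)
  then have "baire_property T' (snd ` ?E)"
    by (intro suslin_set_projection_baire_property[OF G.completely_metrizable G.separable]
        S.completely_metrizable S.second_countable)
  moreover have "snd ` ?E = {x \<in> carrier (G\<lparr>carrier := S\<rparr>). x \<in> W}"
  proof -
    have "x = y" if xy: "x \<in> S" "y \<in> S" "\<And>V. V \<in> \<B> \<Longrightarrow> x \<in> V \<longleftrightarrow> y \<in> V" for x y
    proof (rule ccontr)
      assume "x \<noteq> y"
      then obtain U where "openin T' U" "x \<in> U" "y \<notin> U"
        using metrizable_imp_t1_space[OF S.metrizable] xy(1,2) unfolding t1_space_def by auto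
      then show False using \<B>(3) xy(3) by blast
    qed
    then have "?E = {(x, y). x = y \<and> x \<in> S \<inter> W}" using SG by (auto simp: topspace_prod_topology)
    then show ?thesis by (force simp: image_iff)
  qed
  ultimately show "baire_property T' {x \<in> carrier (G\<lparr>carrier := S\<rparr>). x \<in> W}" by simp
qed

lemma polishing_borel:
  assumes "abelian_polish_group G T" "S \<in> sets (borel_of T)" "polishing_topology G T S T'"
    "A \<in> sets (borel_of T)"
  shows "A \<inter> S \<in> sets (borel_of T')"
  using measurable_sets[OF continuous_map_measurable[OF polishing_inclusion_continuous[OF assms(1-3)]] assms(4)]
    polishing_topologyD(3)[OF assms(3)] by simp

text \<open>A set open in \<open>T1\<close> is Borel in \<open>T\<close>, hence Borel in
  \<open>T2\<close> because the inclusion of \<open>T2\<close> into \<open>T\<close> is continuous.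
  So the identity from \<open>T2\<close> to \<open>T1\<close> falls under automatic continuity; by
  symmetry the two topologies agree.\<close>

lemma polishing_topology_finer:
  assumes G: "abelian_polish_group G T" and S: "S \<in> sets (borel_of T)"
    and T1: "polishing_topology G T S T1" and T2: "polishing_topology G T S T2" and U: "openin T1 U"
  shows "openin T2 U"
proof -
  have "continuous_map T2 T1 (\<lambda>x. x)"
  proof (rule baire_measurable_hom_continuous[OF polishing_topologyD(1)[OF T2] polishing_topologyD(1)[OF T1]])
    show "(\<lambda>x. x) \<in> hom (G\<lparr>carrier := S\<rparr>) (G\<lparr>carrier := S\<rparr>)" by (auto simp: hom_def)
    fix W assume "openin T1 W"
    then have "W \<inter> S \<in> sets (borel_of T2)"
      by (intro polishing_borel[OF G S T2] polishing_topologyD(2)[OF T1])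
    moreover have "{x \<in> carrier (G\<lparr>carrier := S\<rparr>). x \<in> W} = W \<inter> S" by auto
    ultimately show "baire_property T2 {x \<in> carrier (G\<lparr>carrier := S\<rparr>). x \<in> W}"
      by (simp add: borel_baire_property)
  qed
  then have "openin T2 {x \<in> topspace T2. x \<in> U}" using U by (rule openin_continuous_map_preimage)
  moreover have "{x \<in> topspace T2. x \<in> U} = U"
    using openin_subset[OF U] polishing_topologyD(3)[OF T1] polishing_topologyD(3)[OF T2] by auto
  ultimately show ?thesis by simp
qed

lemma polish_top_of_eq:
  assumes "abelian_polish_group G T" "S \<in> sets (borel_of T)" "polishing_topology G T S T'"
  shows "polish_top_of G T S = T'"
  unfolding polish_top_of_def
proof (rule the_equality)
  show "polishing_topology G T S T'" by (rule assms(3))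
  fix T'' assume "polishing_topology G T S T''"
  then show "T'' = T'"
    unfolding topology_eq using polishing_topology_finer[OF assms(1,2)] assms(3) by blast
qed

lemma polish_top_of_polishing:
  assumes "abelian_polish_group G T" "polishable_subgroup G T S"
  shows "polishing_topology G T S (polish_top_of G T S)"
  using assms polish_top_of_eq unfolding polishable_subgroup_def by metis

section \<open>Invariant norms\<close>

definition group_norm :: "('a, 'm) monoid_scheme \<Rightarrow> ('a \<Rightarrow> real) \<Rightarrow> bool" where
  "group_norm G p \<longleftrightarrow>
     (\<forall>x\<in>carrier G. 0 \<le> p x \<and> p (inv\<^bsub>G\<^esub> x) = p x \<and> (p x = 0 \<longleftrightarrow> x = \<one>\<^bsub>G\<^esub>)) \<and>
     (\<forall>x\<in>carrier G. \<forall>y\<in>carrier G. p (x \<otimes>\<^bsub>G\<^esub> y) \<le> p x + p y)"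

text \<open>The value \<open>0\<close> off the carrier makes nonnegativity and symmetry hold for all
  elements of the type, as \<open>Metric_space\<close> demands.\<close>

definition norm_dist :: "('a, 'm) monoid_scheme \<Rightarrow> ('a \<Rightarrow> real) \<Rightarrow> 'a \<Rightarrow> 'a \<Rightarrow> real" where
  "norm_dist G p x y = (if x \<in> carrier G \<and> y \<in> carrier G then p (inv\<^bsub>G\<^esub> x \<otimes>\<^bsub>G\<^esub> y) else 0)"

definition norm_top :: "('a, 'm) monoid_scheme \<Rightarrow> ('a \<Rightarrow> real) \<Rightarrow> 'a topology" where
  "norm_top G p = Metric_space.mtopology (carrier G) (norm_dist G p)"

text \<open>Cauchy sequences, limits and density are spelled out by group operations rather than by
  the metric, so that for a subgroup they unfold to statements inside the ambient group.\<close>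

definition norm_Cauchy :: "('a, 'm) monoid_scheme \<Rightarrow> ('a \<Rightarrow> real) \<Rightarrow> (nat \<Rightarrow> 'a) \<Rightarrow> bool" where
  "norm_Cauchy G p \<sigma> \<longleftrightarrow>
     range \<sigma> \<subseteq> carrier G \<and> (\<forall>r>0. \<exists>N. \<forall>m\<ge>N. \<forall>n\<ge>N. p (inv\<^bsub>G\<^esub> (\<sigma> m) \<otimes>\<^bsub>G\<^esub> \<sigma> n) < r)"

definition norm_lim :: "('a, 'm) monoid_scheme \<Rightarrow> ('a \<Rightarrow> real) \<Rightarrow> (nat \<Rightarrow> 'a) \<Rightarrow> 'a \<Rightarrow> bool" where
  "norm_lim G p \<sigma> x \<longleftrightarrow> (\<forall>r>0. \<exists>N. \<forall>n\<ge>N. p (inv\<^bsub>G\<^esub> x \<otimes>\<^bsub>G\<^esub> \<sigma> n) < r)"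

definition polish_norm :: "('a, 'm) monoid_scheme \<Rightarrow> ('a \<Rightarrow> real) \<Rightarrow> bool" where
  "polish_norm G p \<longleftrightarrow> group_norm G p \<and>
     (\<forall>\<sigma>. norm_Cauchy G p \<sigma> \<longrightarrow> (\<exists>x\<in>carrier G. norm_lim G p \<sigma> x)) \<and>
     (\<exists>D\<subseteq>carrier G. countable D \<and> (\<forall>x\<in>carrier G. \<forall>r>0. \<exists>y\<in>D. p (inv\<^bsub>G\<^esub> x \<otimes>\<^bsub>G\<^esub> y) < r))"

locale normed_comm_group = comm_group G for G (structure) +
  fixes p :: "'a \<Rightarrow> real"
  assumes group_norm: "group_norm G p"
begin

lemma norm_nonneg: "x \<in> carrier G \<Longrightarrow> 0 \<le> p x"
  and norm_inv [simp]: "x \<in> carrier G \<Longrightarrow> p (inv x) = p x"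
  and norm_eq_0_iff: "x \<in> carrier G \<Longrightarrow> p x = 0 \<longleftrightarrow> x = \<one>"
  and norm_mult: "x \<in> carrier G \<Longrightarrow> y \<in> carrier G \<Longrightarrow> p (x \<otimes> y) \<le> p x + p y"
  using group_norm by (auto simp: group_norm_def)

lemma norm_one [simp]: "p \<one> = 0"
  by (simp add: norm_eq_0_iff)

lemma norm_diff_commute: "x \<in> carrier G \<Longrightarrow> y \<in> carrier G \<Longrightarrow> p (inv x \<otimes> y) = p (inv y \<otimes> x)"
  using norm_inv[of "inv x \<otimes> y"] by (simp add: inv_mult m_comm)

lemma norm_diff_triangle:
  assumes "x \<in> carrier G" "y \<in> carrier G" "z \<in> carrier G"
  shows "p (inv x \<otimes> z) \<le> p (inv x \<otimes> y) + p (inv y \<otimes> z)"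
proof -
  have "inv x \<otimes> z = (inv x \<otimes> y) \<otimes> (inv y \<otimes> z)"
    using assms by (simp add: m_assoc)
  then show ?thesis using norm_mult[of "inv x \<otimes> y" "inv y \<otimes> z"] assms by simp
qed

lemma Metric_space_norm_dist: "Metric_space (carrier G) (norm_dist G p)"
proof
  show "0 \<le> norm_dist G p x y" for x y by (simp add: norm_dist_def norm_nonneg)
  show "norm_dist G p x y = norm_dist G p y x" for x y by (auto simp: norm_dist_def norm_diff_commute)
  show "norm_dist G p x y = 0 \<longleftrightarrow> x = y" if "x \<in> carrier G" "y \<in> carrier G" for x y
    using that norm_eq_0_iff[of "inv x \<otimes> y"] by (auto simp: norm_dist_def inv_solve_left')
  show "norm_dist G p x z \<le> norm_dist G p x y + norm_dist G p y z"
    if "x \<in> carrier G" "y \<in> carrier G" "z \<in> carrier G" for x y z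
    using that by (simp add: norm_dist_def norm_diff_triangle)
qed

sublocale metric: Metric_space "carrier G" "norm_dist G p"
  rewrites "metric.mtopology = norm_top G p"
  by (rule Metric_space_norm_dist) (simp add: norm_top_def)

lemma topspace_norm_top [simp]: "topspace (norm_top G p) = carrier G"
  by (rule metric.topspace_mtopology)

lemma openin_norm_top:
  "openin (norm_top G p) U \<longleftrightarrow>
     U \<subseteq> carrier G \<and> (\<forall>x\<in>U. \<exists>r>0. \<forall>y\<in>carrier G. p (inv x \<otimes> y) < r \<longrightarrow> y \<in> U)"
proof -
  have *: "metric.mball x r \<subseteq> U \<longleftrightarrow> (\<forall>y\<in>carrier G. p (inv x \<otimes> y) < r \<longrightarrow> y \<in> U)" if "x \<in> carrier G" for x r
    using that by (auto simp: norm_dist_def subset_iff)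
  show ?thesis
    unfolding metric.openin_mtopology
  proof (rule conj_cong[OF refl])
    assume U: "U \<subseteq> carrier G"
    have "(\<exists>r>0. metric.mball x r \<subseteq> U) \<longleftrightarrow> (\<exists>r>0. \<forall>y\<in>carrier G. p (inv x \<otimes> y) < r \<longrightarrow> y \<in> U)"
      if "x \<in> U" for x
      by (subst *) (use U that in auto)
    then show "(\<forall>x. x \<in> U \<longrightarrow> (\<exists>r>0. metric.mball x r \<subseteq> U)) \<longleftrightarrow>
        (\<forall>x\<in>U. \<exists>r>0. \<forall>y\<in>carrier G. p (inv x \<otimes> y) < r \<longrightarrow> y \<in> U)"
      by (simp only: Ball_def cong: imp_cong)
  qed
qed

lemma openin_norm_ball:
  assumes "x \<in> carrier G"
  shows "openin (norm_top G p) {y \<in> carrier G. p (inv x \<otimes> y) < r}"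
proof -
  have "{y \<in> carrier G. p (inv x \<otimes> y) < r} = metric.mball x r"
    using assms by (auto simp: norm_dist_def)
  then show ?thesis using metric.openin_mball by simp
qed

lemma norm_ball_one: "openin (norm_top G p) {y \<in> carrier G. p y < r}"
proof -
  have "{y \<in> carrier G. p y < r} = {y \<in> carrier G. p (inv \<one> \<otimes> y) < r}" by auto
  then show ?thesis using openin_norm_ball[OF one_closed] by simp
qed

lemma closedin_norm_ball: "closedin (norm_top G p) {y \<in> carrier G. p y \<le> r}"
proof -
  have "{y \<in> carrier G. p y \<le> r} = metric.mcball \<one> r" by (auto simp: norm_dist_def)
  then show ?thesis using metric.closedin_mcball by simp
qed

lemma openin_norm_top_one:
  assumes "openin (norm_top G p) U" "\<one> \<in> U"
  obtains r where "r > 0" "\<And>y. y \<in> carrier G \<Longrightarrow> p y < r \<Longrightarrow> y \<in> U"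
  using assms openin_norm_top[of U] l_one by (metis inv_one)

lemma limitin_norm_top:
  assumes "range \<sigma> \<subseteq> carrier G"
  shows "limitin (norm_top G p) \<sigma> x sequentially \<longleftrightarrow> x \<in> carrier G \<and> norm_lim G p \<sigma> x"
proof -
  have "\<sigma> n \<in> carrier G" for n using assms by auto
  then show ?thesis
    unfolding metric.limit_metric_sequentially norm_lim_def
    by (auto simp: norm_dist_def norm_diff_commute)
qed

lemma MCauchy_norm: "metric.MCauchy \<sigma> \<longleftrightarrow> norm_Cauchy G p \<sigma>"
proof -
  have "(\<forall>r>0. \<exists>N. \<forall>n n'. N \<le> n \<longrightarrow> N \<le> n' \<longrightarrow> norm_dist G p (\<sigma> n) (\<sigma> n') < r) \<longleftrightarrow>
      (\<forall>r>0. \<exists>N. \<forall>m\<ge>N. \<forall>n\<ge>N. p (inv (\<sigma> m) \<otimes> \<sigma> n) < r)" if "range \<sigma> \<subseteq> carrier G"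
  proof -
    have "\<sigma> n \<in> carrier G" for n using that by auto
    then show ?thesis unfolding norm_dist_def by auto
  qed
  then show ?thesis unfolding metric.MCauchy_def norm_Cauchy_def by auto
qed

lemma continuous_map_norm_top_mult:
  "continuous_map (prod_topology (norm_top G p) (norm_top G p)) (norm_top G p) (\<lambda>(x, y). x \<otimes> y)"
  unfolding continuous_map_def
proof (intro conjI allI impI)
  show "(\<lambda>(x, y). x \<otimes> y) \<in> topspace (prod_topology (norm_top G p) (norm_top G p)) \<rightarrow> topspace (norm_top G p)"
    by auto
  fix U assume U: "openin (norm_top G p) U"
  show "openin (prod_topology (norm_top G p) (norm_top G p))
      {z \<in> topspace (prod_topology (norm_top G p) (norm_top G p)). (case z of (x, y) \<Rightarrow> x \<otimes> y) \<in> U}"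
    unfolding openin_prod_topology_alt
  proof (intro allI impI)
    fix x y
    assume "(x, y) \<in> {z \<in> topspace (prod_topology (norm_top G p) (norm_top G p)). (case z of (x, y) \<Rightarrow> x \<otimes> y) \<in> U}"
    then have xy: "x \<in> carrier G" "y \<in> carrier G" "x \<otimes> y \<in> U" by auto
    then obtain r where r: "r > 0" "\<And>z. z \<in> carrier G \<Longrightarrow> p (inv (x \<otimes> y) \<otimes> z) < r \<Longrightarrow> z \<in> U"
      using U unfolding openin_norm_top by metis
    let ?B = "\<lambda>x. {z \<in> carrier G. p (inv x \<otimes> z) < r / 2}"
    have "a \<otimes> b \<in> U" if ab: "a \<in> ?B x" "b \<in> ?B y" for a b
    proof (rule r(2))
      have "inv (x \<otimes> y) \<otimes> (a \<otimes> b) = (inv x \<otimes> a) \<otimes> (inv y \<otimes> b)"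
        using xy ab by (simp add: inv_mult m_ac)
      then show "p (inv (x \<otimes> y) \<otimes> (a \<otimes> b)) < r"
        using norm_mult[of "inv x \<otimes> a" "inv y \<otimes> b"] xy ab by auto
    qed (use ab in auto)
    then have "?B x \<times> ?B y \<subseteq> {z \<in> topspace (prod_topology (norm_top G p) (norm_top G p)). (case z of (x, y) \<Rightarrow> x \<otimes> y) \<in> U}"
      by auto
    moreover have "x \<in> ?B x" "y \<in> ?B y" using xy r(1) by auto
    moreover have "openin (norm_top G p) (?B x)" by (rule openin_norm_ball[OF xy(1)])
    moreover have "openin (norm_top G p) (?B y)" by (rule openin_norm_ball[OF xy(2)])
    ultimately show "\<exists>V W. openin (norm_top G p) V \<and> openin (norm_top G p) W \<and> x \<in> V \<and> y \<in> W \<and>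
        V \<times> W \<subseteq> {z \<in> topspace (prod_topology (norm_top G p) (norm_top G p)). (case z of (x, y) \<Rightarrow> x \<otimes> y) \<in> U}"
      by (intro exI conjI)
  qed
qed

lemma continuous_map_norm_top_inv: "continuous_map (norm_top G p) (norm_top G p) (\<lambda>x. inv x)"
  unfolding continuous_map_def
proof (intro conjI allI impI)
  fix U assume U: "openin (norm_top G p) U"
  show "openin (norm_top G p) {x \<in> topspace (norm_top G p). inv x \<in> U}"
    unfolding openin_norm_top
  proof (intro conjI ballI)
    fix x assume "x \<in> {x \<in> topspace (norm_top G p). inv x \<in> U}"
    then have x: "x \<in> carrier G" "inv x \<in> U" by auto
    then obtain r where r: "r > 0" "\<And>z. z \<in> carrier G \<Longrightarrow> p (inv (inv x) \<otimes> z) < r \<Longrightarrow> z \<in> U"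
      using U unfolding openin_norm_top by metis
    have "inv y \<in> U" if y: "y \<in> carrier G" "p (inv x \<otimes> y) < r" for y
    proof (rule r(2))
      have "inv (inv x) \<otimes> inv y = inv (inv x \<otimes> y)" using x y by (simp add: inv_mult)
      then show "p (inv (inv x) \<otimes> inv y) < r" using x y norm_inv[of "inv x \<otimes> y"] by simp
    qed (use y in simp)
    then show "\<exists>r>0. \<forall>y\<in>carrier G. p (inv x \<otimes> y) < r \<longrightarrow> y \<in> {x \<in> topspace (norm_top G p). inv x \<in> U}"
      using r(1) by auto
  qed auto
qed auto

lemma polish_norm_imp_abelian_polish_group:
  assumes "polish_norm G p"
  shows "abelian_polish_group G (norm_top G p)"
proof -
  have "metric.mcomplete"
    unfolding metric.mcomplete_def MCauchy_norm
  proof (intro allI impI)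
    fix \<sigma> assume \<sigma>: "norm_Cauchy G p \<sigma>"
    then obtain x where "x \<in> carrier G" "norm_lim G p \<sigma> x" using assms by (auto simp: polish_norm_def)
    then show "\<exists>x. limitin (norm_top G p) \<sigma> x sequentially"
      using limitin_norm_top \<sigma> by (auto simp: norm_Cauchy_def)
  qed
  then have "completely_metrizable_space (norm_top G p)" by (rule metric.completely_metrizable_space_mtopology)
  moreover have "separable_space (norm_top G p)"
  proof -
    obtain D where D: "D \<subseteq> carrier G" "countable D"
      "\<And>x r. x \<in> carrier G \<Longrightarrow> r > 0 \<Longrightarrow> \<exists>y\<in>D. p (inv x \<otimes> y) < r"
      using assms unfolding polish_norm_def by auto
    have "x \<in> norm_top G p closure_of D" if "x \<in> carrier G" for x
      unfolding metric.metric_closure_of using D(3)[OF that] that D(1) by (auto simp: norm_dist_def)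
    then have "norm_top G p closure_of D = topspace (norm_top G p)"
      using closure_of_subset_topspace by fastforce
    then show ?thesis unfolding separable_space_def using D(1,2) by auto
  qed
  ultimately show ?thesis
    unfolding abelian_polish_group_def polish_space_top_def
    using continuous_map_norm_top_mult continuous_map_norm_top_inv comm_group_axioms by simp
qed

text \<open>Klee's theorem: an invariant metric is complete as soon as its topology is completely
  metrizable. For a complete metric \<open>d\<close> the sequence itself may fail to be Cauchy, but
  a generic translate of it is: the points near which the late \<open>\<sigma> n \<otimes> u\<close>
  stay \<open>d\<close>-close to one point form an open dense set \<open>Q k\<close>. The limit of
  the translate is then translated back.\<close>

lemma norm_Cauchy_convergent:
  assumes cm: "completely_metrizable_space (norm_top G p)" and \<sigma>: "norm_Cauchy G p \<sigma>"
  shows "\<exists>x\<in>carrier G. norm_lim G p \<sigma> x"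
proof -
  obtain M d where Md: "Metric_space M d" "Metric_space.mcomplete M d" and T: "norm_top G p = Metric_space.mtopology M d"
    using cm by (auto simp: completely_metrizable_space_def)
  interpret d: Metric_space M d by (rule Md)
  have M: "M = carrier G" using T topspace_norm_top d.topspace_mtopology by metis
  have sG: "\<sigma> n \<in> carrier G" for n using \<sigma> by (auto simp: norm_Cauchy_def)
  have Cau: "\<exists>N. \<forall>m\<ge>N. \<forall>n\<ge>N. p (inv (\<sigma> m) \<otimes> \<sigma> n) < r" if "r > 0" for r
    using \<sigma> that by (auto simp: norm_Cauchy_def)
  define good where "good k U \<longleftrightarrow>
      (\<exists>N. \<exists>q\<in>M. \<forall>n\<ge>N. \<forall>u\<in>U. d q (\<sigma> n \<otimes> u) < inverse (Suc k))" for k :: nat and U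
  define Q where "Q k = \<Union>{U. openin (norm_top G p) U \<and> good k U}" for k
  have op: "openin (norm_top G p) (Q k)" for k unfolding Q_def by auto
  have dense: "norm_top G p closure_of Q k = topspace (norm_top G p)" for k
  proof -
    have "Q k \<inter> W \<noteq> {}" if W: "openin (norm_top G p) W" "W \<noteq> {}" for W
    proof -
      obtain c where c: "c \<in> W" using W by blast
      then have cG: "c \<in> carrier G" using W(1) openin_norm_top by blast
      obtain r where r: "r > 0" "\<And>y. y \<in> carrier G \<Longrightarrow> p (inv c \<otimes> y) < r \<Longrightarrow> y \<in> W"
        using W(1) c unfolding openin_norm_top by metis
      obtain N0 where N0: "\<And>m n. m \<ge> N0 \<Longrightarrow> n \<ge> N0 \<Longrightarrow> p (inv (\<sigma> m) \<otimes> \<sigma> n) < r" using Cau[OF r(1)] by blast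
      define q where "q = \<sigma> N0 \<otimes> c"
      have qG: "q \<in> carrier G" using sG cG by (simp add: q_def)
      have "openin (norm_top G p) (d.mball q (inverse (Suc k)))" "q \<in> d.mball q (inverse (Suc k))"
        using qG unfolding T M[symmetric] by auto
      then obtain s where s: "s > 0" "\<And>y. y \<in> carrier G \<Longrightarrow> p (inv q \<otimes> y) < s \<Longrightarrow> y \<in> d.mball q (inverse (Suc k))"
        unfolding openin_norm_top by metis
      obtain N1 where N1: "\<And>m n. m \<ge> N1 \<Longrightarrow> n \<ge> N1 \<Longrightarrow> p (inv (\<sigma> m) \<otimes> \<sigma> n) < s / 2"
        using Cau[of "s/2"] s(1) by auto
      \<comment> \<open>The choice of \<open>a\<close> gives
        \<open>\<sigma> m \<otimes> a = q\<close>. Since \<open>q = \<sigma> N0 \<otimes> c\<close>,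
        the bound from \<open>N0\<close> keeps \<open>a\<close> within \<open>r\<close> of
        \<open>c\<close>, hence in \<open>W\<close>; the bound from \<open>N1\<close> keeps the
        later \<open>\<sigma> n\<close> within \<open>s / 2\<close> of
        \<open>\<sigma> m\<close>.\<close>
      define m where "m = max N0 N1"
      define a where "a = inv (\<sigma> m) \<otimes> q"
      have aG: "a \<in> carrier G" using sG qG by (simp add: a_def)
      have "inv c \<otimes> a = inv (\<sigma> m) \<otimes> \<sigma> N0"
      proof -
        have "a = c \<otimes> (inv (\<sigma> m) \<otimes> \<sigma> N0)"
          unfolding a_def q_def using sG cG by (simp add: m_ac)
        then show ?thesis using sG cG by simp
      qed
      then have "p (inv c \<otimes> a) < r" using N0[of m N0] by (simp add: m_def)
      then have aW: "a \<in> W" using r aG by blast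
      let ?U = "{u \<in> carrier G. p (inv a \<otimes> u) < s / 2}"
      have "good k ?U"
        unfolding good_def
      proof (intro exI[of _ m] bexI[of _ q] allI impI ballI)
        show "q \<in> M" using qG M by simp
        fix n u assume n: "m \<le> n" and u: "u \<in> ?U"
        have "(inv a \<otimes> u) \<otimes> (inv (\<sigma> m) \<otimes> \<sigma> n) = inv q \<otimes> (\<sigma> n \<otimes> u)"
        proof -
          have "inv a \<otimes> inv (\<sigma> m) = inv q"
            using sG qG by (simp add: a_def inv_mult m_comm)
          then have "inv q \<otimes> (\<sigma> n \<otimes> u) = (inv a \<otimes> inv (\<sigma> m)) \<otimes> (\<sigma> n \<otimes> u)" by simp
          also have "\<dots> = (inv a \<otimes> u) \<otimes> (inv (\<sigma> m) \<otimes> \<sigma> n)" using sG aG u by (simp add: m_ac)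
          finally show ?thesis by simp
        qed
        moreover have "p ((inv a \<otimes> u) \<otimes> (inv (\<sigma> m) \<otimes> \<sigma> n)) < s"
          using norm_mult[of "inv a \<otimes> u" "inv (\<sigma> m) \<otimes> \<sigma> n"] N1[of m n] n u aG sG by (auto simp: m_def)
        ultimately have "\<sigma> n \<otimes> u \<in> d.mball q (inverse (Suc k))" using s(2)[of "\<sigma> n \<otimes> u"] sG u by auto
        then show "d q (\<sigma> n \<otimes> u) < inverse (Suc k)" by simp
      qed
      then have "?U \<subseteq> Q k" unfolding Q_def using openin_norm_ball[OF aG] by blast
      moreover have "a \<in> ?U" using aG s(1) by simp
      ultimately show ?thesis using aW by blast
    qed
    then show ?thesis by (metis dense_intersects_open)
  qed
  have "norm_top G p closure_of (\<Inter>(range Q)) = topspace (norm_top G p)"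
    by (rule Baire_category) (use cm op dense in auto)
  then have "\<Inter>(range Q) \<noteq> {}" using one_closed by force
  then obtain a where a: "\<And>k. a \<in> Q k" by blast
  have aG: "a \<in> carrier G" using a[of 0] openin_subset[OF op[of 0]] by auto
  have "d.MCauchy (\<lambda>n. \<sigma> n \<otimes> a)"
    unfolding d.MCauchy_def
  proof (intro conjI allI impI)
    show "range (\<lambda>n. \<sigma> n \<otimes> a) \<subseteq> M" using sG aG M by auto
    fix r :: real assume "r > 0"
    then obtain k where k: "inverse (Suc k) < r / 2" using reals_Archimedean[of "r/2"] by auto
    obtain U where "a \<in> U" "good k U" using a[of k] unfolding Q_def by blast
    then obtain N q where q: "q \<in> M" "\<And>n. n \<ge> N \<Longrightarrow> d q (\<sigma> n \<otimes> a) < inverse (Suc k)"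
      unfolding good_def by blast
    have "d (\<sigma> m \<otimes> a) (\<sigma> n \<otimes> a) < r" if "m \<ge> N" "n \<ge> N" for m n
      using d.triangle''[of "\<sigma> m \<otimes> a" q "\<sigma> n \<otimes> a"] q(1) q(2)[OF that(1)] q(2)[OF that(2)] k sG aG M by auto
    then show "\<exists>N. \<forall>n n'. N \<le> n \<longrightarrow> N \<le> n' \<longrightarrow> d (\<sigma> n \<otimes> a) (\<sigma> n' \<otimes> a) < r" by blast
  qed
  then obtain b where "limitin (norm_top G p) (\<lambda>n. \<sigma> n \<otimes> a) b sequentially"
    using Md(2) unfolding d.mcomplete_def T by blast
  then have b: "b \<in> carrier G" "norm_lim G p (\<lambda>n. \<sigma> n \<otimes> a) b"
    using limitin_norm_top[of "\<lambda>n. \<sigma> n \<otimes> a" b] sG aG by auto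
  have "inv (b \<otimes> inv a) \<otimes> \<sigma> n = inv b \<otimes> (\<sigma> n \<otimes> a)" for n
    using b aG sG by (simp add: inv_mult m_ac)
  then have "norm_lim G p \<sigma> (b \<otimes> inv a)" using b(2) unfolding norm_lim_def by simp
  then show ?thesis using b aG by blast
qed

end

lemma normed_comm_groupI: "comm_group G \<Longrightarrow> group_norm G p \<Longrightarrow> normed_comm_group G p"
  by (simp add: normed_comm_group_def normed_comm_group_axioms_def)

section \<open>Compatible complete norms on abelian Polish groups\<close>

context abelian_polish
begin

lemma one_nhd_mult:
  assumes "openin T W" "\<one> \<in> W"
  obtains V where "openin T V" "\<one> \<in> V" "\<And>x y. x \<in> V \<Longrightarrow> y \<in> V \<Longrightarrow> x \<otimes> y \<in> W"
proof -
  let ?P = "{z \<in> topspace (prod_topology T T). (case z of (x, y) \<Rightarrow> x \<otimes> y) \<in> W}"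
  have "continuous_map (prod_topology T T) T (\<lambda>(x, y). x \<otimes> y)"
    using abelian_polish_group by (simp add: abelian_polish_group_def)
  from openin_continuous_map_preimage[OF this assms(1)] have "openin (prod_topology T T) ?P" .
  moreover have "(\<one>, \<one>) \<in> ?P" using assms(2) by simp
  ultimately have "\<exists>A B. openin T A \<and> openin T B \<and> \<one> \<in> A \<and> \<one> \<in> B \<and> A \<times> B \<subseteq> ?P"
    unfolding openin_prod_topology_alt by (elim allE impE)
  then obtain A B where AB: "openin T A" "openin T B" "\<one> \<in> A" "\<one> \<in> B" "A \<times> B \<subseteq> ?P" by blast
  have "x \<otimes> y \<in> W" if "x \<in> A \<inter> B" "y \<in> A \<inter> B" for x y
  proof -
    have "(x, y) \<in> ?P" using AB(5) that by blast
    then show ?thesis by simp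
  qed
  with AB that[of "A \<inter> B"] show ?thesis by blast
qed

text \<open>Three factors, because splitting a chain at one entry leaves the part before it, the
  entry and the part after it.\<close>

lemma one_nhd_cube:
  assumes "openin T W" "\<one> \<in> W"
  shows "\<exists>V. openin T V \<and> \<one> \<in> V \<and> (\<forall>x\<in>V. inv x \<in> V) \<and> (\<forall>x\<in>V. \<forall>y\<in>V. \<forall>z\<in>V. x \<otimes> (y \<otimes> z) \<in> W)"
proof -
  obtain V1 where V1: "openin T V1" "\<one> \<in> V1" "\<And>x y. x \<in> V1 \<Longrightarrow> y \<in> V1 \<Longrightarrow> x \<otimes> y \<in> W"
    using one_nhd_mult[OF assms] by blast
  obtain V2 where V2: "openin T V2" "\<one> \<in> V2" "\<And>x y. x \<in> V2 \<Longrightarrow> y \<in> V2 \<Longrightarrow> x \<otimes> y \<in> V1"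
    using one_nhd_mult[OF V1(1,2)] by blast
  have sub: "V2 \<subseteq> carrier G" using openin_subset[OF V2(1)] by simp
  have V21: "x \<in> V1" if "x \<in> V2" for x using V2(3)[OF that V2(2)] that sub by auto
  let ?V = "V2 \<inter> {x \<in> topspace T. inv x \<in> V2}"
  have "openin T {x \<in> topspace T. inv x \<in> V2}"
    by (rule openin_continuous_map_preimage[OF continuous_map_m_inv[OF continuous_map_id[unfolded id_def]] V2(1)])
  then have "openin T ?V" using V2(1) by blast
  then show ?thesis
    by (intro exI[of _ ?V] conjI) (use V2 V1(3) V21 sub in auto)
qed

text \<open>A chain records with each factor the index of a neighbourhood meant to contain it; the
  product forgets the index, which enters only the cost.\<close>

fun chain_prod :: "('a \<times> nat) list \<Rightarrow> 'a" where
  "chain_prod [] = \<one>" |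
  "chain_prod ((x, n) # cs) = x \<otimes> chain_prod cs"

text \<open>Birkhoff-Kakutani: the norm of \<open>x\<close> is the infimum of \<open>\<Sum>i. 2^(-n\<^sub>i)\<close> over all factorisations of
  \<open>x\<close> into elements of the neighbourhoods \<open>V n\<^sub>i\<close>.\<close>

lemma birkhoff_kakutani: "\<exists>p. group_norm G p \<and> T = norm_top G p"
proof -
  obtain M d where Md: "Metric_space M d" and T: "T = Metric_space.mtopology M d"
    using metrizable by (auto simp: metrizable_space_def)
  interpret d: Metric_space M d by (rule Md)
  have M: "M = carrier G" using T topspace_eq d.topspace_mtopology by metis
  define P where "P (V :: 'a set) \<longleftrightarrow> openin T V \<and> \<one> \<in> V \<and> (\<forall>x\<in>V. inv x \<in> V)" for V
  \<comment> \<open>The ball of radius \<open>1/(n+1)\<close> forces the \<open>V n\<close> to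
    shrink to the identity. Below, \<open>V 0\<close> is the whole group, so that every element has
    a chain of length one and the infimum is over a nonempty set.\<close>
  define R where "R n V V' \<longleftrightarrow> (\<forall>x\<in>V'. \<forall>y\<in>V'. \<forall>z\<in>V'. x \<otimes> (y \<otimes> z) \<in> V \<inter> d.mball \<one> (inverse (Suc n)))" for n :: nat and V V'
  have "\<exists>V. \<forall>n. (P (V n) \<and> (n = 0 \<longrightarrow> V n = carrier G)) \<and> R n (V n) (V (Suc n))"
  proof (rule dependent_nat_choice)
    show "\<exists>V. P V \<and> (0 = (0::nat) \<longrightarrow> V = carrier G)"
      using openin_topspace[of T] by (intro exI[of _ "carrier G"]) (auto simp: P_def)
    fix V and n :: nat assume V: "P V \<and> (n = 0 \<longrightarrow> V = carrier G)"
    have "openin T (V \<inter> d.mball \<one> (inverse (Suc n)))" "\<one> \<in> V \<inter> d.mball \<one> (inverse (Suc n))"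
      using V one_closed unfolding P_def T M[symmetric] by auto
    from one_nhd_cube[OF this] show "\<exists>V'. (P V' \<and> (Suc n = 0 \<longrightarrow> V' = carrier G)) \<and> R n V V'"
      unfolding P_def R_def by simp
  qed
  then obtain V where V: "\<And>n. P (V n)" "V 0 = carrier G" "\<And>n. R n (V n) (V (Suc n))" by blast
  have Vop: "openin T (V n)" and V1: "\<one> \<in> V n" and Vinv: "x \<in> V n \<Longrightarrow> inv x \<in> V n" for n x
    using V(1) by (auto simp: P_def)
  have VG: "x \<in> carrier G" if "x \<in> V n" for x n using openin_subset[OF Vop[of n]] that by auto
  have V3: "x \<otimes> (y \<otimes> z) \<in> V n" if "x \<in> V (Suc n)" "y \<in> V (Suc n)" "z \<in> V (Suc n)" for x y z n
    using V(3) that unfolding R_def by blast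
  have VSuc: "x \<in> V n" "d \<one> x < inverse (Suc n)" if "x \<in> V (Suc n)" for x n
  proof -
    have "x \<otimes> (\<one> \<otimes> \<one>) \<in> V n \<inter> d.mball \<one> (inverse (Suc n))"
      using V(3)[of n] that V1[of "Suc n"] unfolding R_def by blast
    then show "x \<in> V n" "d \<one> x < inverse (Suc n)" using VG[OF that] by auto
  qed
  have Vmono: "V n \<subseteq> V m" if "m \<le> n" for m n
    using that by (induction rule: dec_induct) (use VSuc in auto)
  define cost :: "('a \<times> nat) list \<Rightarrow> real" where "cost cs = (\<Sum>(x, n)\<leftarrow>cs. (1/2) ^ n)" for cs
  define ok where "ok cs \<longleftrightarrow> (\<forall>(x, n)\<in>set cs. x \<in> V n)" for cs
  have cost_nonneg: "0 \<le> cost cs" for cs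
    unfolding cost_def by (intro sum_list_nonneg) auto
  have cost_append: "cost (cs @ ds) = cost cs + cost ds" for cs ds by (simp add: cost_def)
  have ok_append: "ok (cs @ ds) \<longleftrightarrow> ok cs \<and> ok ds" for cs ds by (auto simp: ok_def)
  have cpG: "chain_prod cs \<in> carrier G" if "ok cs" for cs
    using that by (induction cs rule: chain_prod.induct) (auto simp: ok_def VG)
  have cp_append: "chain_prod (cs @ ds) = chain_prod cs \<otimes> chain_prod ds" if "ok cs" "ok ds" for cs ds
    using that(1)
  proof (induction cs rule: chain_prod.induct)
    case (2 x n cs)
    then have "ok cs" "x \<in> carrier G" by (auto simp: ok_def VG)
    then show ?case using 2 that(2) cpG by (simp add: m_assoc)
  qed (simp add: cpG that)
  \<comment> \<open>The chain is split at an entry with less than half of \<open>(1/2) ^ n\<close>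
    on either side, so that both sides have their products in \<open>V (Suc n)\<close> by induction.
    The entry itself costs less than \<open>(1/2) ^ n\<close>, so its index is at least
    \<open>Suc n\<close>, and the three factors multiply into \<open>V n\<close>.\<close>
  have key: "chain_prod cs \<in> V n" if "ok cs" "cost cs < (1/2) ^ n" for cs n
    using that
  proof (induction "length cs" arbitrary: cs n rule: less_induct)
    case less
    show ?case
    proof (cases "cs = []")
      case True then show ?thesis by (simp add: V1)
    next
      case False
      have "\<exists>k<length cs. cost (take k cs) < (1/2) ^ Suc n \<and> cost (drop (Suc k) cs) < (1/2) ^ Suc n"
      proof (cases "cost cs < (1/2) ^ Suc n")
        case True
        let ?k = "length cs - 1"
        have "cost (take ?k cs) \<le> cost cs"
          using cost_append[of "take ?k cs" "drop ?k cs"] cost_nonneg[of "drop ?k cs"] by simp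
        moreover have "cost (drop (Suc ?k) cs) = 0" using False by (simp add: cost_def)
        ultimately show ?thesis using True False by (intro exI[of _ ?k]) auto
      next
        case ge: False
        \<comment> \<open>The first entry at which the partial cost reaches half of
          \<open>(1/2) ^ n\<close>: what precedes it is below half by minimality, what follows
          because the total is below \<open>(1/2) ^ n\<close>.\<close>
        define k where "k = (LEAST k. (1/2) ^ Suc n \<le> cost (take (Suc k) cs))"
        have ex: "(1/2) ^ Suc n \<le> cost (take (Suc (length cs - 1)) cs)" using ge False by simp
        have k: "(1/2) ^ Suc n \<le> cost (take (Suc k) cs)" "k \<le> length cs - 1"
          unfolding k_def by (rule LeastI, rule ex) (rule Least_le, rule ex)
        have "cost (take k cs) < (1/2) ^ Suc n"
        proof (cases k)
          case 0 then show ?thesis by (simp add: cost_def)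
        next
          case (Suc j)
          then have "\<not> (1/2) ^ Suc n \<le> cost (take (Suc j) cs)"
            using not_less_Least[of j "\<lambda>k. (1/2) ^ Suc n \<le> cost (take (Suc k) cs)"] by (simp add: k_def)
          then show ?thesis using Suc by simp
        qed
        moreover have "cost (drop (Suc k) cs) < (1/2) ^ Suc n"
          using cost_append[of "take (Suc k) cs" "drop (Suc k) cs"] k(1) less.prems(2) by simp
        moreover have "k < length cs" using k(2) False by (cases cs) auto
        ultimately show ?thesis by blast
      qed
      then obtain k where k: "k < length cs" "cost (take k cs) < (1/2) ^ Suc n"
          "cost (drop (Suc k) cs) < (1/2) ^ Suc n" by blast
      obtain x m where xm: "cs ! k = (x, m)" by fastforce
      have cs: "cs = take k cs @ (x, m) # drop (Suc k) cs" using id_take_nth_drop[OF k(1)] xm by simp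
      have okt: "ok (take k cs)" "ok (drop (Suc k) cs)" "ok ((x, m) # drop (Suc k) cs)" "x \<in> V m"
        using less.prems(1) ok_append[of "take k cs" "(x, m) # drop (Suc k) cs"]
        unfolding cs[symmetric] by (auto simp: ok_def)
      have "cost cs = cost (take k cs) + ((1/2) ^ m + cost (drop (Suc k) cs))"
        using arg_cong[OF cs, of cost] cost_append[of "take k cs" "(x, m) # drop (Suc k) cs"]
        by (simp add: cost_def)
      then have "(1/2::real) ^ m < (1/2) ^ n"
        using less.prems(2) cost_nonneg[of "take k cs"] cost_nonneg[of "drop (Suc k) cs"] by linarith
      then have "Suc n \<le> m" by (simp add: power_strict_decreasing_iff Suc_le_eq)
      then have x: "x \<in> V (Suc n)" using Vmono okt(4) by blast
      have "chain_prod (take k cs) \<in> V (Suc n)" by (rule less.hyps) (use k okt in auto)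
      moreover have "chain_prod (drop (Suc k) cs) \<in> V (Suc n)" by (rule less.hyps) (use k okt in auto)
      moreover have "chain_prod cs = chain_prod (take k cs) \<otimes> (x \<otimes> chain_prod (drop (Suc k) cs))"
        using arg_cong[OF cs, of chain_prod] cp_append[OF okt(1,3)] by simp
      ultimately show ?thesis using V3 x by simp
    qed
  qed
  define C where "C x = {cost cs | cs. ok cs \<and> chain_prod cs = x}" for x
  define p where "p x = Inf (C x)" for x
  have bdd: "bdd_below (C x)" for x unfolding C_def by (rule bdd_belowI[of _ 0]) (auto simp: cost_nonneg)
  have ne: "C x \<noteq> {}" if "x \<in> carrier G" for x
  proof -
    have "cost [(x, 0)] \<in> C x" unfolding C_def using that by (auto simp: ok_def V(2) intro!: exI[of _ "[(x, 0)]"])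
    then show ?thesis by blast
  qed
  have p_le: "p x \<le> cost cs" if "ok cs" "chain_prod cs = x" for x cs
    unfolding p_def by (rule cInf_lower[OF _ bdd]) (use that in \<open>auto simp: C_def\<close>)
  have p_less: "\<exists>cs. ok cs \<and> chain_prod cs = x \<and> cost cs < r" if "x \<in> carrier G" "p x < r" for x r
    using cInf_lessD[OF ne[OF that(1)]] that(2) unfolding p_def C_def by blast
  have p_nonneg: "0 \<le> p x" if "x \<in> carrier G" for x
    unfolding p_def by (rule cInf_greatest[OF ne[OF that]]) (auto simp: C_def cost_nonneg)
  have pV: "x \<in> V n" if "x \<in> carrier G" "p x < (1/2) ^ n" for x n
    using p_less[OF that] key by blast
  have Vp: "p x \<le> (1/2) ^ n" if "x \<in> V n" for x n
  proof -
    have "p x \<le> cost [(x, n)]" by (rule p_le) (use that VG in \<open>auto simp: ok_def\<close>)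
    then show ?thesis by (simp add: cost_def)
  qed
  have p_one: "p \<one> = 0"
  proof -
    have "p \<one> \<le> cost []" by (rule p_le) (auto simp: ok_def)
    then show ?thesis using p_nonneg[OF one_closed] by (simp add: cost_def)
  qed
  have p_mult: "p (x \<otimes> y) \<le> p x + p y" if xy: "x \<in> carrier G" "y \<in> carrier G" for x y
  proof (rule field_le_epsilon)
    fix e :: real assume "e > 0"
    then obtain cs ds where cs: "ok cs" "chain_prod cs = x" "cost cs < p x + e / 2"
        and ds: "ok ds" "chain_prod ds = y" "cost ds < p y + e / 2"
      using p_less[OF xy(1), of "p x + e/2"] p_less[OF xy(2), of "p y + e/2"] by auto
    have "p (x \<otimes> y) \<le> cost (cs @ ds)" by (rule p_le) (use cs ds cp_append in \<open>auto simp: ok_append\<close>)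
    then show "p (x \<otimes> y) \<le> p x + p y + e" using cs(3) ds(3) by (simp add: cost_append)
  qed
  have p_inv_le: "p (inv x) \<le> p x" if x: "x \<in> carrier G" for x
  proof (rule field_le_epsilon)
    fix e :: real assume "e > 0"
    then obtain cs where cs: "ok cs" "chain_prod cs = x" "cost cs < p x + e"
      using p_less[OF x, of "p x + e"] by auto
    define ds where "ds = map (\<lambda>(x, n). (inv x, n)) cs"
    have "ok ds" using cs(1) Vinv by (auto simp: ok_def ds_def)
    moreover have "chain_prod ds = inv x"
      using cs(1) unfolding cs(2)[symmetric] ds_def
    proof (induction cs rule: chain_prod.induct)
      case (2 x n cs)
      then have "ok cs" "x \<in> carrier G" by (auto simp: ok_def VG)
      then show ?case using 2 cpG by (simp add: inv_mult)
    qed simp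
    moreover have "cost ds = cost cs" by (auto simp: cost_def ds_def o_def case_prod_unfold)
    ultimately show "p (inv x) \<le> p x + e" using p_le[of ds "inv x"] cs(3) by simp
  qed
  have small: "\<exists>n. (1/2) ^ n < r" if "r > 0" for r :: real using real_arch_pow_inv[OF that] by auto
  have p_zero: "x = \<one>" if x: "x \<in> carrier G" "p x = 0" for x
  proof (rule ccontr)
    assume "x \<noteq> \<one>"
    then have "d \<one> x > 0" using d.mdist_pos_less[of \<one> x] x M by auto
    then obtain n where "inverse (Suc n) < d \<one> x" using reals_Archimedean by blast
    moreover have "x \<in> V (Suc n)" using pV[OF x(1)] x(2) by simp
    ultimately show False using VSuc(2)[of x n] by simp
  qed
  have gn: "group_norm G p"
    unfolding group_norm_def
  proof (intro conjI ballI)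
    fix x assume x: "x \<in> carrier G"
    show "0 \<le> p x" using p_nonneg x by simp
    show "p (inv x) = p x" using p_inv_le[OF x] p_inv_le[of "inv x"] x by simp
    show "p x = 0 \<longleftrightarrow> x = \<one>" using p_zero[OF x] p_one by auto
  qed (rule p_mult)
  interpret n: normed_comm_group G p by (rule normed_comm_groupI[OF comm_group_axioms gn])
  have "openin T U \<longleftrightarrow> openin (norm_top G p) U" for U
  proof
    assume U: "openin T U"
    show "openin (norm_top G p) U"
      unfolding n.openin_norm_top
    proof (intro conjI ballI)
      show UG: "U \<subseteq> carrier G" using openin_subset[OF U] by simp
      fix x assume x: "x \<in> U"
      then have xG: "x \<in> carrier G" using UG by auto
      have "openin T {y \<in> topspace T. x \<otimes> y \<in> U}"
        by (rule openin_continuous_map_preimage[OF continuous_map_translate[OF xG] U])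
      moreover have "\<one> \<in> {y \<in> topspace T. x \<otimes> y \<in> U}" using x xG by simp
      ultimately obtain r where r: "r > 0" "d.mball \<one> r \<subseteq> {y \<in> topspace T. x \<otimes> y \<in> U}"
        unfolding T d.openin_mtopology by blast
      then obtain n where n: "inverse (Suc n) < r" using reals_Archimedean by blast
      have "y \<in> U" if y: "y \<in> carrier G" "p (inv x \<otimes> y) < (1/2) ^ Suc n" for y
      proof -
        have "inv x \<otimes> y \<in> V (Suc n)" using pV y xG by simp
        then have "d \<one> (inv x \<otimes> y) < r" using VSuc(2) n by fastforce
        moreover have "\<one> \<in> M" "inv x \<otimes> y \<in> M" using y(1) xG by (simp_all add: M)
        ultimately have "inv x \<otimes> y \<in> d.mball \<one> r" by simp
        then have "x \<otimes> (inv x \<otimes> y) \<in> U" using r by blast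
        then show ?thesis using xG y by simp
      qed
      then show "\<exists>r>0. \<forall>y\<in>carrier G. p (inv x \<otimes> y) < r \<longrightarrow> y \<in> U"
        by (intro exI[of _ "(1/2) ^ Suc n"]) auto
    qed
  next
    assume U: "openin (norm_top G p) U"
    have UG: "U \<subseteq> carrier G" using U n.openin_norm_top by simp
    show "openin T U"
    proof (subst openin_subopen, intro ballI)
      fix x assume x: "x \<in> U"
      then have xG: "x \<in> carrier G" using UG by auto
      obtain r where r: "r > 0" "\<And>y. y \<in> carrier G \<Longrightarrow> p (inv x \<otimes> y) < r \<Longrightarrow> y \<in> U"
        using U x unfolding n.openin_norm_top by metis
      obtain n where n: "(1/2) ^ n < r" using small r by blast
      have "openin T ((\<lambda>y. x \<otimes> y) ` V n)" by (rule openin_translate[OF xG Vop])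
      moreover have "x \<in> (\<lambda>y. x \<otimes> y) ` V n" using V1[of n] xG by (force simp: image_iff)
      moreover have "(\<lambda>y. x \<otimes> y) ` V n \<subseteq> U"
      proof clarify
        fix y assume y: "y \<in> V n"
        have "p (inv x \<otimes> (x \<otimes> y)) < r" using Vp[OF y] n VG[OF y] xG by simp
        then show "x \<otimes> y \<in> U" using r(2) VG[OF y] xG by simp
      qed
      ultimately show "\<exists>W. openin T W \<and> x \<in> W \<and> W \<subseteq> U" by blast
    qed
  qed
  then have "T = norm_top G p" by (simp add: topology_eq)
  with gn show ?thesis by blast
qed

text \<open>Birkhoff-Kakutani gives a compatible norm only; its completeness is Klee's
  theorem.\<close>

lemma ex_polish_norm: "\<exists>p. polish_norm G p \<and> T = norm_top G p"
proof -
  obtain p where p: "group_norm G p" and T: "T = norm_top G p" using birkhoff_kakutani by blast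
  interpret n: normed_comm_group G p by (rule normed_comm_groupI[OF comm_group_axioms p])
  obtain D where D: "countable D" "D \<subseteq> carrier G" "norm_top G p closure_of D = carrier G"
    using separable unfolding separable_space_def T by auto
  have "\<exists>y\<in>D. p (inv x \<otimes> y) < r" if xr: "x \<in> carrier G" "r > 0" for x r
  proof -
    have "x \<in> norm_top G p closure_of D" using D xr by simp
    then obtain y where "y \<in> D" "norm_dist G p x y < r"
      using xr(2) unfolding n.metric.metric_closure_of by auto
    moreover have "y \<in> carrier G" using D(2) calculation(1) by blast
    ultimately show ?thesis using xr(1) by (auto simp: norm_dist_def)
  qed
  moreover have "completely_metrizable_space (norm_top G p)" using completely_metrizable T by simp
  ultimately have "polish_norm G p"
    unfolding polish_norm_def using p D(1,2) n.norm_Cauchy_convergent by blast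
  with T show ?thesis by blast
qed

end

section \<open>Polishable subgroups from norms\<close>

lemma (in comm_group) subgroup_comm_group:
  assumes "subgroup S G"
  shows "comm_group (G\<lparr>carrier := S\<rparr>)"
  using subgroup.mem_carrier[OF assms]
  by (intro group.group_comm_groupI subgroup_imp_group[OF assms]) (auto simp: m_comm)

lemma (in comm_group) group_norm_sub_iff:
  assumes "subgroup S G"
  shows "group_norm (G\<lparr>carrier := S\<rparr>) q \<longleftrightarrow>
     (\<forall>x\<in>S. 0 \<le> q x \<and> q (inv x) = q x \<and> (q x = 0 \<longleftrightarrow> x = \<one>)) \<and> (\<forall>x\<in>S. \<forall>y\<in>S. q (x \<otimes> y) \<le> q x + q y)"
  unfolding group_norm_def using assms by simp

text \<open>Trades the operations of the restricted group for those of \<open>G\<close>, so that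
  norms on different subgroups can be compared at common elements.\<close>

lemma (in comm_group) polish_norm_sub_iff:
  assumes "subgroup S G"
  shows "polish_norm (G\<lparr>carrier := S\<rparr>) q \<longleftrightarrow>
     (\<forall>x\<in>S. 0 \<le> q x \<and> q (inv x) = q x \<and> (q x = 0 \<longleftrightarrow> x = \<one>)) \<and> (\<forall>x\<in>S. \<forall>y\<in>S. q (x \<otimes> y) \<le> q x + q y) \<and>
     (\<forall>\<sigma>::nat \<Rightarrow> 'a. range \<sigma> \<subseteq> S \<and> (\<forall>r>0. \<exists>N. \<forall>m\<ge>N. \<forall>n\<ge>N. q (inv (\<sigma> m) \<otimes> \<sigma> n) < r) \<longrightarrow>
        (\<exists>x\<in>S. \<forall>r>0. \<exists>N. \<forall>n\<ge>N. q (inv x \<otimes> \<sigma> n) < r)) \<and>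
     (\<exists>D\<subseteq>S. countable D \<and> (\<forall>x\<in>S. \<forall>r>0. \<exists>y\<in>D. q (inv x \<otimes> y) < r))"
proof -
  have "norm_Cauchy (G\<lparr>carrier := S\<rparr>) q \<sigma> \<longleftrightarrow>
      range \<sigma> \<subseteq> S \<and> (\<forall>r>0. \<exists>N. \<forall>m\<ge>N. \<forall>n\<ge>N. q (inv (\<sigma> m) \<otimes> \<sigma> n) < r)" for \<sigma>
  proof (cases "range \<sigma> \<subseteq> S")
    case True
    then have "inv\<^bsub>G\<lparr>carrier := S\<rparr>\<^esub> (\<sigma> n) = inv (\<sigma> n)" for n using assms by (simp add: range_subsetD)
    then show ?thesis by (simp add: norm_Cauchy_def)
  qed (simp add: norm_Cauchy_def)
  moreover have "norm_lim (G\<lparr>carrier := S\<rparr>) q \<sigma> x \<longleftrightarrow> (\<forall>r>0. \<exists>N. \<forall>n\<ge>N. q (inv x \<otimes> \<sigma> n) < r)" if "x \<in> S" for x \<sigma>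
    unfolding norm_lim_def using assms that by simp
  ultimately show ?thesis
    unfolding polish_norm_def group_norm_sub_iff[OF assms] using assms by simp
qed

lemma (in comm_group) polish_norm_sub_complete:
  fixes \<sigma> :: "nat \<Rightarrow> 'a"
  assumes S: "subgroup S G" and q: "polish_norm (G\<lparr>carrier := S\<rparr>) q" and "range \<sigma> \<subseteq> S"
    and "\<And>r. r > 0 \<Longrightarrow> \<exists>N. \<forall>m\<ge>N. \<forall>n\<ge>N. q (inv (\<sigma> m) \<otimes> \<sigma> n) < r"
  shows "\<exists>x\<in>S. \<forall>r>0. \<exists>N. \<forall>n\<ge>N. q (inv x \<otimes> \<sigma> n) < r"
proof -
  from q have "\<forall>\<sigma>::nat \<Rightarrow> 'a. range \<sigma> \<subseteq> S \<and> (\<forall>r>0. \<exists>N. \<forall>m\<ge>N. \<forall>n\<ge>N. q (inv (\<sigma> m) \<otimes> \<sigma> n) < r) \<longrightarrow>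
        (\<exists>x\<in>S. \<forall>r>0. \<exists>N. \<forall>n\<ge>N. q (inv x \<otimes> \<sigma> n) < r)"
    unfolding polish_norm_sub_iff[OF S] by (elim conjE)
  from this[rule_format, of \<sigma>] show ?thesis using assms(3,4) by simp
qed

lemma (in comm_group) openin_norm_top_sub:
  assumes S: "subgroup S G" and q: "group_norm (G\<lparr>carrier := S\<rparr>) q"
  shows "openin (norm_top (G\<lparr>carrier := S\<rparr>) q) U \<longleftrightarrow>
     U \<subseteq> S \<and> (\<forall>x\<in>U. \<exists>r>0. \<forall>y\<in>S. q (inv x \<otimes> y) < r \<longrightarrow> y \<in> U)"
proof -
  interpret n: normed_comm_group "G\<lparr>carrier := S\<rparr>" q
    by (rule normed_comm_groupI[OF subgroup_comm_group[OF S] q])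
  show ?thesis
    unfolding n.openin_norm_top
    by (rule conj_cong) (use S in \<open>auto simp: subset_iff\<close>)
qed

text \<open>A subgroup containing a ball is open, because it contains the translates of that ball
  around its points. So it suffices to squeeze a subgroup between two balls.\<close>

lemma (in comm_group) non_archimedean_norm_topI:
  assumes S: "subgroup S G" and q: "group_norm (G\<lparr>carrier := S\<rparr>) q"
    and V: "\<And>r. r > 0 \<Longrightarrow> \<exists>V. subgroup V G \<and> V \<subseteq> {x \<in> S. q x < r} \<and> (\<exists>s>0. {x \<in> S. q x < s} \<subseteq> V)"
  shows "non_archimedean (G\<lparr>carrier := S\<rparr>) (norm_top (G\<lparr>carrier := S\<rparr>) q)"
  unfolding non_archimedean_def
proof (intro allI impI)
  interpret n: normed_comm_group "G\<lparr>carrier := S\<rparr>" q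
    by (rule normed_comm_groupI[OF subgroup_comm_group[OF S] q])
  fix U assume "openin (norm_top (G\<lparr>carrier := S\<rparr>) q) U \<and> \<one>\<^bsub>G\<lparr>carrier := S\<rparr>\<^esub> \<in> U"
  then obtain r where r: "r > 0" "\<And>y. y \<in> S \<Longrightarrow> q y < r \<Longrightarrow> y \<in> U"
    using n.openin_norm_top_one[of U] by auto
  obtain V s where Vs: "subgroup V G" "V \<subseteq> {x \<in> S. q x < r}" "s > 0" "{x \<in> S. q x < s} \<subseteq> V"
    using V[OF r(1)] by blast
  have "openin (norm_top (G\<lparr>carrier := S\<rparr>) q) V"
    unfolding openin_norm_top_sub[OF S q]
  proof (intro conjI ballI)
    show "V \<subseteq> S" using Vs(2) by auto
    fix x assume x: "x \<in> V"
    have "y \<in> V" if y: "y \<in> S" "q (inv x \<otimes> y) < s" for y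
    proof -
      have xS: "x \<in> S" using x Vs(2) by auto
      then have "inv x \<otimes> y \<in> V"
        using Vs(4) y S by (auto simp: subgroup.m_closed subgroup.m_inv_closed)
      then have "x \<otimes> (inv x \<otimes> y) \<in> V" using x Vs(1) subgroup.m_closed by metis
      then show ?thesis using xS y subgroup.mem_carrier[OF S] by simp
    qed
    then show "\<exists>r>0. \<forall>y\<in>S. q (inv x \<otimes> y) < r \<longrightarrow> y \<in> V" using Vs(3) by blast
  qed
  moreover have "subgroup V (G\<lparr>carrier := S\<rparr>)"
    using Vs(1,2) S by (intro subgroup_incl) auto
  moreover have "V \<subseteq> U" using Vs(2) r(2) by auto
  ultimately show "\<exists>V. openin (norm_top (G\<lparr>carrier := S\<rparr>) q) V \<and> subgroup V (G\<lparr>carrier := S\<rparr>) \<and> V \<subseteq> U"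
    by blast
qed

context abelian_polish
begin

text \<open>Separability writes an open set as a countable union of balls centred in a dense set.
  Such a ball is a translate of an open ball at the identity, and this is a countable union of
  closed balls, which are Borel by assumption.\<close>

lemma polishing_norm_top:
  assumes S: "subgroup S G" "S \<in> sets (borel_of T)" and q: "polish_norm (G\<lparr>carrier := S\<rparr>) q"
    and ball: "\<And>r. {x \<in> S. q x \<le> r} \<in> sets (borel_of T)"
  shows "polishing_topology G T S (norm_top (G\<lparr>carrier := S\<rparr>) q)"
  unfolding polishing_topology_def
proof (intro conjI allI impI)
  have gn: "group_norm (G\<lparr>carrier := S\<rparr>) q" using q by (simp add: polish_norm_def)
  interpret n: normed_comm_group "G\<lparr>carrier := S\<rparr>" q
    by (rule normed_comm_groupI[OF subgroup_comm_group[OF S(1)] gn])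
  show "abelian_polish_group (G\<lparr>carrier := S\<rparr>) (norm_top (G\<lparr>carrier := S\<rparr>) q)"
    by (rule n.polish_norm_imp_abelian_polish_group[OF q])
  fix U assume U: "openin (norm_top (G\<lparr>carrier := S\<rparr>) q) U"
  obtain D where D: "D \<subseteq> S" "countable D" "\<And>x r. x \<in> S \<Longrightarrow> r > 0 \<Longrightarrow> \<exists>y\<in>D. q (inv x \<otimes> y) < r"
    using q unfolding polish_norm_sub_iff[OF S(1)] by blast
  have SG: "x \<in> carrier G" if "x \<in> S" for x using subgroup.mem_carrier[OF S(1) that] .
  have US: "U \<subseteq> S" using U openin_norm_top_sub[OF S(1) gn] by blast
  define B where "B x n = {y \<in> S. q (inv x \<otimes> y) < inverse (Suc n)}" for x and n :: nat
  have diff: "inv x \<otimes> y \<in> S" if "x \<in> S" "y \<in> S" for x y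
    using S(1) that by (simp add: subgroup.m_closed subgroup.m_inv_closed)
  have Bset: "B x n \<in> sets (borel_of T)" if x: "x \<in> S" for x n
  proof -
    let ?A = "{y \<in> S. q y < inverse (Suc n)}"
    have A_eq: "?A = (\<Union>m. {y \<in> S. q y \<le> inverse (Suc n) - inverse (Suc m)})"
    proof (intro equalityI subsetI)
      fix y assume y: "y \<in> ?A"
      then obtain m where "inverse (Suc m) < inverse (Suc n) - q y"
        using reals_Archimedean[of "inverse (Suc n) - q y"] by auto
      then show "y \<in> (\<Union>m. {y \<in> S. q y \<le> inverse (Suc n) - inverse (Suc m)})"
        using y by (intro UN_I[of m]) auto
    next
      fix y assume "y \<in> (\<Union>m. {y \<in> S. q y \<le> inverse (Suc n) - inverse (Suc m)})"
      then obtain m where m: "y \<in> S" "q y \<le> inverse (Suc n) - inverse (Suc m)" by auto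
      moreover have "inverse (real (Suc m)) > 0" by simp
      ultimately have "q y < inverse (Suc n)" by linarith
      with m(1) show "y \<in> ?A" by simp
    qed
    have A: "?A \<in> sets (borel_of T)"
      unfolding A_eq by (rule sets.countable_UN) (use ball in auto)
    have "(\<lambda>y. inv x \<otimes> y) -` ?A \<inter> space (borel_of T) \<in> sets (borel_of T)"
      by (rule measurable_sets[OF continuous_map_measurable[OF continuous_map_translate] A]) (simp add: SG[OF x])
    then have "((\<lambda>y. inv x \<otimes> y) -` ?A \<inter> space (borel_of T)) \<inter> S \<in> sets (borel_of T)" using S(2) by blast
    moreover have "((\<lambda>y. inv x \<otimes> y) -` ?A \<inter> space (borel_of T)) \<inter> S = B x n"
      unfolding B_def using SG diff[OF x] by auto
    ultimately show ?thesis by simp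
  qed
  let ?I = "{(x, n). x \<in> D \<and> B x n \<subseteq> U}"
  have "U = (\<Union>(x, n)\<in>?I. B x n)"
  proof (intro equalityI subsetI)
    fix x assume x: "x \<in> U"
    then have xS: "x \<in> S" using US by auto
    obtain r where r: "r > 0" "\<And>y. y \<in> S \<Longrightarrow> q (inv x \<otimes> y) < r \<Longrightarrow> y \<in> U"
      using U x unfolding openin_norm_top_sub[OF S(1) gn] by blast
    obtain n where n: "inverse (Suc n) < r / 2" using r(1) reals_Archimedean[of "r/2"] by auto
    have "inverse (real (Suc n)) > 0" by simp
    then obtain y where y: "y \<in> D" "q (inv x \<otimes> y) < inverse (Suc n)" using D(3)[OF xS] by blast
    have yS: "y \<in> S" using y D by auto
    have sym: "q (inv y \<otimes> x) = q (inv x \<otimes> y)"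
      using n.norm_diff_commute[of x y] xS yS S(1) by simp
    have "B y n \<subseteq> U"
    proof
      fix z assume z: "z \<in> B y n"
      then have zS: "z \<in> S" by (simp add: B_def)
      have "q (inv x \<otimes> z) \<le> q (inv x \<otimes> y) + q (inv y \<otimes> z)"
        using n.norm_diff_triangle[of x y z] xS yS zS S(1) by simp
      moreover have "q (inv y \<otimes> z) < inverse (Suc n)" using z by (simp add: B_def)
      ultimately show "z \<in> U" using r(2)[OF zS] y(2) n by linarith
    qed
    moreover have "x \<in> B y n" using xS y(2) sym by (simp add: B_def)
    ultimately show "x \<in> (\<Union>(x, n)\<in>?I. B x n)" using y(1) by blast
  qed auto
  moreover have "countable ?I"
    by (rule countable_subset[of _ "D \<times> UNIV"]) (use D(2) in auto)
  then have "(\<Union>(x, n)\<in>?I. B x n) \<in> sets (borel_of T)"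
    by (rule sets.countable_UN') (use Bset D(1) in auto)
  ultimately show "U \<in> sets (borel_of T)" by simp
qed

lemma polishing_ex_norm:
  assumes T': "polishing_topology G T S T'"
  shows "\<exists>p. polish_norm (G\<lparr>carrier := S\<rparr>) p \<and> T' = norm_top (G\<lparr>carrier := S\<rparr>) p"
proof -
  interpret S: abelian_polish "G\<lparr>carrier := S\<rparr>" T' by (rule abelian_polishI[OF polishing_topologyD(1)[OF T']])
  show ?thesis by (rule S.ex_polish_norm)
qed

section \<open>Closed subgroups and countable intersections\<close>

lemma subgroup_closure_of:
  assumes N: "subgroup N G"
  shows "subgroup (T closure_of N) G"
proof
  have NG: "N \<subseteq> carrier G" using N by (rule subgroup.subset)
  show "T closure_of N \<subseteq> carrier G" using closure_of_subset_topspace[of T N] by simp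
  show "\<one> \<in> T closure_of N" using closure_of_subset[of N T] NG subgroup.one_closed[OF N] by auto
  show "x \<otimes> y \<in> T closure_of N" if "x \<in> T closure_of N" "y \<in> T closure_of N" for x y
  proof -
    have c: "continuous_map (prod_topology T T) T (\<lambda>(x, y). x \<otimes> y)"
      using abelian_polish_group by (simp add: abelian_polish_group_def)
    have "(\<lambda>(x, y). x \<otimes> y) ` ((T closure_of N) \<times> (T closure_of N)) \<subseteq> T closure_of ((\<lambda>(x, y). x \<otimes> y) ` (N \<times> N))"
      using continuous_map_image_closure_subset[OF c, of "N \<times> N"] by (simp add: closure_of_Times)
    also have "\<dots> \<subseteq> T closure_of N" by (rule closure_of_mono) (use subgroup.m_closed[OF N] in auto)
    finally show ?thesis using that by auto
  qed
  show "inv x \<in> T closure_of N" if "x \<in> T closure_of N" for x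
  proof -
    have c: "continuous_map T T (\<lambda>x. inv x)" using abelian_polish_group by (simp add: abelian_polish_group_def)
    have "(\<lambda>x. inv x) ` (T closure_of N) \<subseteq> T closure_of ((\<lambda>x. inv x) ` N)"
      by (rule continuous_map_image_closure_subset[OF c])
    also have "\<dots> \<subseteq> T closure_of N" by (rule closure_of_mono) (use subgroup.m_inv_closed[OF N] in auto)
    finally show ?thesis using that by auto
  qed
qed

lemma polishing_closed_subgroup:
  assumes S: "subgroup S G" "closedin T S"
  shows "polishing_topology G T S (subtopology T S)"
  unfolding polishing_topology_def abelian_polish_group_def polish_space_top_def
proof (intro conjI allI impI)
  have SG: "S \<subseteq> carrier G" using S(1) by (rule subgroup.subset)
  show "comm_group (G\<lparr>carrier := S\<rparr>)" by (rule subgroup_comm_group[OF S(1)])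
  show "topspace (subtopology T S) = carrier (G\<lparr>carrier := S\<rparr>)" using SG by auto
  show "completely_metrizable_space (subtopology T S)"
    by (rule completely_metrizable_space_closedin[OF completely_metrizable S(2)])
  show "separable_space (subtopology T S)"
    by (intro second_countable_imp_separable_space second_countable_subtopology second_countable)
  have c: "continuous_map (prod_topology T T) T (\<lambda>(x, y). x \<otimes> y)"
    using abelian_polish_group by (simp add: abelian_polish_group_def)
  show "continuous_map (prod_topology (subtopology T S) (subtopology T S)) (subtopology T S)
     (\<lambda>(x, y). x \<otimes>\<^bsub>G\<lparr>carrier := S\<rparr>\<^esub> y)"
    unfolding subtopology_Times[symmetric] continuous_map_in_subtopology
    using continuous_map_from_subtopology[OF c] subgroup.m_closed[OF S(1)] by auto
  have c: "continuous_map T T (\<lambda>x. inv x)" using abelian_polish_group by (simp add: abelian_polish_group_def)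
  have "continuous_map (subtopology T S) (subtopology T S) (\<lambda>x. inv x)"
    unfolding continuous_map_in_subtopology
    using continuous_map_from_subtopology[OF c] subgroup.m_inv_closed[OF S(1)] by auto
  then show "continuous_map (subtopology T S) (subtopology T S) (\<lambda>x. inv\<^bsub>G\<lparr>carrier := S\<rparr>\<^esub> x)"
    by (rule continuous_map_eq) (use S(1) in auto)
  show "U \<in> sets (borel_of T)" if "openin (subtopology T S) U" for U
    using that closedin_borel_of[OF S(2)] openin_borel_of unfolding openin_subtopology by blast
qed

lemma non_archimedean_subtopology:
  assumes S: "subgroup S G" and na: "non_archimedean G T"
  shows "non_archimedean (G\<lparr>carrier := S\<rparr>) (subtopology T S)"
  unfolding non_archimedean_def
proof (intro allI impI)
  fix U assume "openin (subtopology T S) U \<and> \<one>\<^bsub>G\<lparr>carrier := S\<rparr>\<^esub> \<in> U"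
  then obtain W where W: "openin T W" "U = W \<inter> S" "\<one> \<in> W" unfolding openin_subtopology by auto
  then obtain V where V: "openin T V" "subgroup V G" "V \<subseteq> W" using na unfolding non_archimedean_def by blast
  have "subgroup (V \<inter> S) (G\<lparr>carrier := S\<rparr>)"
    using V(2) S by (intro subgroup_incl subgroups_Inter_pair) auto
  moreover have "openin (subtopology T S) (V \<inter> S)" using V(1) openin_subtopology by blast
  ultimately show "\<exists>V. openin (subtopology T S) V \<and> subgroup V (G\<lparr>carrier := S\<rparr>) \<and> V \<subseteq> U"
    using V(3) W(2) by (intro exI[of _ "V \<inter> S"]) auto
qed

text \<open>The norm on a countable intersection is \<open>sup\<^sub>k min (p\<^sub>k, 2^(-k))\<close>.\<close>

lemma polishing_Inter:
  fixes S :: "nat \<Rightarrow> 'a set"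
  assumes S: "\<And>k. subgroup (S k) G" "\<And>k. S k \<in> sets (borel_of T)"
    and Tk: "\<And>k. polishing_topology G T (S k) (T' k)"
  shows "\<exists>T''. polishing_topology G T (\<Inter>k. S k) T'' \<and>
    ((\<forall>k. non_archimedean (G\<lparr>carrier := S k\<rparr>) (T' k)) \<longrightarrow> non_archimedean (G\<lparr>carrier := \<Inter>k. S k\<rparr>) T'')"
proof -
  have "\<forall>k. \<exists>p. polish_norm (G\<lparr>carrier := S k\<rparr>) p \<and> T' k = norm_top (G\<lparr>carrier := S k\<rparr>) p"
    using polishing_ex_norm[OF Tk] by blast
  then obtain p where p: "\<And>k. polish_norm (G\<lparr>carrier := S k\<rparr>) (p k)"
    and T'p: "\<And>k. T' k = norm_top (G\<lparr>carrier := S k\<rparr>) (p k)" by metis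
  have gn: "group_norm (G\<lparr>carrier := S k\<rparr>) (p k)" for k using p[of k] by (simp add: polish_norm_def)
  have ng: "normed_comm_group (G\<lparr>carrier := S k\<rparr>) (p k)" for k
    by (rule normed_comm_groupI[OF subgroup_comm_group[OF S(1)] gn])
  note pn = gn[unfolded group_norm_sub_iff[OF S(1)]]
  define J where "J = (\<Inter>k. S k)"
  have J: "subgroup J G" unfolding J_def using S(1) by (intro subgroups_Inter) auto
  have JS: "x \<in> S k" if "x \<in> J" for x k using that by (auto simp: J_def)
  have JG: "x \<in> carrier G" if "x \<in> J" for x using subgroup.mem_carrier[OF J that] .
  have Jdiff: "inv x \<otimes> y \<in> J" if "x \<in> J" "y \<in> J" for x y
    using J that by (simp add: subgroup.m_closed subgroup.m_inv_closed)
  have JB: "J \<in> sets (borel_of T)" unfolding J_def by (rule sets.countable_INT) (use S(2) in auto)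
  define q where "q x = (SUP k. min (p k x) ((1/2) ^ k))" for x
  have bdd: "bdd_above (range (\<lambda>k. min (p k x) ((1/2) ^ k)))" for x
  proof (rule bdd_aboveI[of _ 1])
    fix y assume "y \<in> range (\<lambda>k. min (p k x) ((1/2) ^ k))"
    then obtain k where k: "y = min (p k x) ((1/2) ^ k)" by auto
    then have "y \<le> (1/2) ^ k" by simp
    also have "(1/2::real) ^ k \<le> 1" by (rule power_le_one) auto
    finally show "y \<le> 1" .
  qed
  have q_le: "q x \<le> r \<longleftrightarrow> (\<forall>k. min (p k x) ((1/2) ^ k) \<le> r)" for x r
    unfolding q_def by (subst cSUP_le_iff[OF _ bdd]) auto
  have q_ge: "min (p k x) ((1/2) ^ k) \<le> q x" for x k using q_le[of x "q x"] by simp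
  \<comment> \<open>Below \<open>(1/2) ^ k\<close> the truncation is inactive, so a small
    \<open>q\<close> controls \<open>p k\<close>. Conversely the indices from \<open>K\<close> on
    contribute at most \<open>(1/2) ^ K\<close>, so only finitely many \<open>p k\<close> have to be
    made small.\<close>
  have q_less: "p k x < r" if "q x < r" "q x < (1/2) ^ k" for x k r using q_ge[of k x] that by (simp add: min_def split: if_splits)
  have q_leI: "q x \<le> r" if "\<And>k. k < K \<Longrightarrow> p k x \<le> r" "(1/2) ^ K \<le> r" for x r K
  proof -
    have "min (p k x) ((1/2) ^ k) \<le> r" for k
    proof (cases "k < K")
      case True then show ?thesis using that(1)[of k] by linarith
    next
      case False
      then have "(1/2::real) ^ k \<le> (1/2) ^ K" by (intro power_decreasing) auto
      then show ?thesis using that(2) by linarith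
    qed
    then show ?thesis by (simp add: q_le)
  qed
  have pnn: "0 \<le> p k x" if "x \<in> J" for k x using pn[of k] JS[OF that, of k] by blast
  have small: "\<exists>K. (1/2) ^ K < r" if "r > 0" for r :: real using real_arch_pow_inv[OF that] by auto
  have qgn: "group_norm (G\<lparr>carrier := J\<rparr>) q"
    unfolding group_norm_sub_iff[OF J]
  proof (intro conjI ballI)
    fix x assume x: "x \<in> J"
    show "0 \<le> q x" using q_ge[of 0 x] pnn[OF x, of 0] by (simp add: min_def split: if_splits)
    have "p k (inv x) = p k x" for k using pn[of k] JS[OF x, of k] by blast
    then show "q (inv x) = q x" by (simp add: q_def)
    have p0: "p k x = 0 \<longleftrightarrow> x = \<one>" for k using pn[of k] JS[OF x, of k] by blast
    show "q x = 0 \<longleftrightarrow> x = \<one>"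
    proof
      assume "q x = 0"
      then have "p 0 x \<le> 0" using q_ge[of 0 x] by (simp add: min_def split: if_splits)
      then show "x = \<one>" using p0[of 0] pnn[OF x, of 0] by simp
    next
      assume "x = \<one>"
      then have "p k x = 0" for k using p0 by simp
      then show "q x = 0" by (simp add: q_def)
    qed
  next
    fix x y assume xy: "x \<in> J" "y \<in> J"
    show "q (x \<otimes> y) \<le> q x + q y"
      unfolding q_le
    proof
      fix k
      have "p k (x \<otimes> y) \<le> p k x + p k y" using pn[of k] JS[OF xy(1), of k] JS[OF xy(2), of k] by blast
      then have "min (p k (x \<otimes> y)) ((1/2) ^ k) \<le> min (p k x) ((1/2) ^ k) + min (p k y) ((1/2) ^ k)"
        using pnn[OF xy(1), of k] pnn[OF xy(2), of k] zero_le_power[of "1/2::real" k]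
        by (simp add: min_def split: if_splits; linarith?)
      then show "min (p k (x \<otimes> y)) ((1/2) ^ k) \<le> q x + q y" using q_ge[of k x] q_ge[of k y] by linarith
    qed
  qed
  have polish: "polish_norm (G\<lparr>carrier := J\<rparr>) q"
    unfolding polish_norm_sub_iff[OF J]
  proof (intro conjI allI impI)
    show "\<forall>x\<in>J. 0 \<le> q x \<and> q (inv x) = q x \<and> (q x = 0) = (x = \<one>)" "\<forall>x\<in>J. \<forall>y\<in>J. q (x \<otimes> y) \<le> q x + q y"
      using qgn[unfolded group_norm_sub_iff[OF J]] by (rule conjunct1, rule conjunct2)
  next
    fix \<sigma> :: "nat \<Rightarrow> 'a"
    assume \<sigma>: "range \<sigma> \<subseteq> J \<and> (\<forall>r>0. \<exists>N. \<forall>m\<ge>N. \<forall>n\<ge>N. q (inv (\<sigma> m) \<otimes> \<sigma> n) < r)"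
    have sJ: "\<sigma> n \<in> J" for n using \<sigma> by auto
    have Cau: "\<exists>N. \<forall>m\<ge>N. \<forall>n\<ge>N. p k (inv (\<sigma> m) \<otimes> \<sigma> n) < r" if "r > 0" for r k
    proof -
      have "min r ((1/2) ^ k) > 0" using that by simp
      then obtain N where N: "\<forall>m\<ge>N. \<forall>n\<ge>N. q (inv (\<sigma> m) \<otimes> \<sigma> n) < min r ((1/2) ^ k)" using \<sigma> by blast
      show ?thesis
      proof (intro exI[of _ N] allI impI)
        fix m n assume "N \<le> m" "N \<le> n"
        then have "q (inv (\<sigma> m) \<otimes> \<sigma> n) < min r ((1/2) ^ k)" using N by blast
        then show "p k (inv (\<sigma> m) \<otimes> \<sigma> n) < r" by (intro q_less) auto
      qed
    qed
    have "\<exists>x\<in>S k. \<forall>r>0. \<exists>N. \<forall>n\<ge>N. p k (inv x \<otimes> \<sigma> n) < r" for k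
    proof -
      have "range \<sigma> \<subseteq> S k" using sJ JS[of _ k] by blast
      show ?thesis by (rule polish_norm_sub_complete[OF S(1) p \<open>range \<sigma> \<subseteq> S k\<close>]) (rule Cau)
    qed
    then obtain x where x: "\<And>k. x k \<in> S k" "\<And>k. \<forall>r>0. \<exists>N. \<forall>n\<ge>N. p k (inv (x k) \<otimes> \<sigma> n) < r" by metis
    \<comment> \<open>The points \<open>x k\<close> are limits in different topologies. All of these
      map continuously into \<open>T\<close>, where limits are unique, so the \<open>x k\<close>
      coincide.\<close>
    have lim: "limitin T \<sigma> (x k) sequentially" for k
    proof -
      have "norm_lim (G\<lparr>carrier := S k\<rparr>) (p k) \<sigma> (x k)"
        unfolding norm_lim_def using x(2)[of k] x(1)[of k] S(1)[of k] by simp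
      then have "limitin (T' k) \<sigma> (x k) sequentially"
        unfolding T'p using normed_comm_group.limitin_norm_top[OF ng[of k], of \<sigma> "x k"] x(1)[of k] sJ JS by auto
      then show ?thesis
        using continuous_map_limit[OF polishing_inclusion_continuous[OF abelian_polish_group S(2) Tk]]
        by (fastforce simp: o_def)
    qed
    have xeq: "x k = x 0" for k
      by (rule limitin_Hausdorff_unique[OF lim lim]) (auto intro: metrizable_imp_Hausdorff_space metrizable)
    have xS: "x 0 \<in> S k" for k using x(1)[of k] xeq[of k] by simp
    then have xJ: "x 0 \<in> J" by (auto simp: J_def)
    have xlim: "\<exists>N. \<forall>n\<ge>N. p k (inv (x 0) \<otimes> \<sigma> n) < r" if "r > 0" for k r
      using x(2)[of k] that unfolding xeq[of k] by blast
    show "\<exists>x\<in>J. \<forall>r>0. \<exists>N. \<forall>n\<ge>N. q (inv x \<otimes> \<sigma> n) < r"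
    proof (intro bexI[OF _ xJ] allI impI)
      fix r :: real assume "r > 0"
      then have r2: "r / 2 > 0" by simp
      obtain K where K: "(1/2) ^ K < r / 2" using small[OF r2] by blast
      have "\<forall>k. \<exists>N. \<forall>n\<ge>N. p k (inv (x 0) \<otimes> \<sigma> n) < r / 2" using xlim[OF r2] by blast
      then obtain N where N: "\<And>k n. n \<ge> N k \<Longrightarrow> p k (inv (x 0) \<otimes> \<sigma> n) < r / 2" by metis
      define N' where "N' = Max (N ` {..K})"
      have "q (inv (x 0) \<otimes> \<sigma> n) < r" if n: "n \<ge> N'" for n
      proof -
        have "q (inv (x 0) \<otimes> \<sigma> n) \<le> r / 2"
        proof (rule q_leI[of K])
          fix k assume "k < K"
          then have "N k \<le> N'" unfolding N'_def by (intro Max_ge) auto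
          then show "p k (inv (x 0) \<otimes> \<sigma> n) \<le> r / 2" using N[of k n] n by simp
        qed (use K in simp)
        then show ?thesis using r2 by simp
      qed
      then show "\<exists>N. \<forall>n\<ge>N. q (inv (x 0) \<otimes> \<sigma> n) < r" by blast
    qed
  next
    have "\<forall>k. \<exists>D. D \<subseteq> S k \<and> countable D \<and> (\<forall>x\<in>S k. \<forall>r>0. \<exists>y\<in>D. p k (inv x \<otimes> y) < r)"
      using p unfolding polish_norm_sub_iff[OF S(1)] by blast
    then obtain D where D: "\<And>k. D k \<subseteq> S k" "\<And>k. countable (D k)"
      "\<And>k x r. x \<in> S k \<Longrightarrow> r > 0 \<Longrightarrow> \<exists>y\<in>D k. p k (inv x \<otimes> y) < r" by metis
    \<comment> \<open>The points of the dense sets \<open>D k\<close> need not lie in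
      \<open>J\<close>. For every \<open>K\<close> and every choice of \<open>f k\<close> in
      \<open>D k\<close> for \<open>k < K\<close>, one element of \<open>J\<close> within
      \<open>(1/2) ^ K\<close> of all of them is picked whenever there is one.\<close>
    define ok where "ok K f s \<longleftrightarrow> s \<in> J \<and> (\<forall>k<K. p k (inv (f k) \<otimes> s) < (1/2) ^ K)" for K :: nat and f s
    define F where "F K = {f \<in> Pi\<^sub>E {..<K} D. \<exists>s. ok K f s}" for K
    define E where "E = (\<lambda>(K, f). SOME s. ok K f s) ` (SIGMA K:UNIV. F K)"
    have someok: "ok K f (SOME s. ok K f s)" if "f \<in> F K" for K f
      using that unfolding F_def by (auto intro: someI_ex)
    have "countable (F K)" for K
      unfolding F_def by (rule countable_subset[OF _ countable_PiE[of "{..<K}" D]]) (use D(2) in auto)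
    then have "countable E" unfolding E_def by (intro countable_image countable_SIGMA) auto
    moreover have "E \<subseteq> J"
    proof -
      have "(SOME s. ok K f s) \<in> J" if "f \<in> F K" for K f using someok[OF that] unfolding ok_def[of K f "SOME s. ok K f s"] by simp
      then show ?thesis unfolding E_def by auto
    qed
    moreover have "\<exists>y\<in>E. q (inv x \<otimes> y) < r" if x: "x \<in> J" and r: "r > 0" for x r
    proof -
      \<comment> \<open>The triangle inequality through \<open>f0 k\<close> costs two errors of
        \<open>(1/2) ^ K\<close>, and a third of \<open>r\<close> keeps their sum strictly below
        \<open>r\<close>.\<close>
      obtain K where K: "(1/2) ^ K < r / 3" using small[of "r/3"] r by auto
      have "\<forall>k. \<exists>y\<in>D k. p k (inv x \<otimes> y) < (1/2) ^ K" using D(3)[OF JS[OF x]] by simp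
      then obtain f0 where f0: "\<And>k. f0 k \<in> D k" "\<And>k. p k (inv x \<otimes> f0 k) < (1/2) ^ K" by metis
      define f where "f = restrict f0 {..<K}"
      have fS: "f0 k \<in> S k" for k using f0(1) D(1) by blast
      have sym: "p k (inv (f0 k) \<otimes> x) = p k (inv x \<otimes> f0 k)" for k
        using normed_comm_group.norm_diff_commute[OF ng[of k], of "f0 k" x] fS[of k] JS[OF x, of k] S(1)[of k] by simp
      have "ok K f x" unfolding ok_def f_def using x sym f0(2) by simp
      then have fF: "f \<in> F K" unfolding F_def f_def using f0(1) by auto
      define y where "y = (SOME s. ok K f s)"
      have oky: "ok K f y" unfolding y_def by (rule someok[OF fF])
      have yE: "y \<in> E" unfolding E_def y_def using fF by (intro image_eqI[of _ _ "(K, f)"]) auto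
      have yJ: "y \<in> J" using oky by (simp add: ok_def)
      have "q (inv x \<otimes> y) \<le> 2 * (1/2) ^ K"
      proof (rule q_leI[of K])
        fix k assume k: "k < K"
        have "p k (inv x \<otimes> y) \<le> p k (inv x \<otimes> f0 k) + p k (inv (f0 k) \<otimes> y)"
          using normed_comm_group.norm_diff_triangle[OF ng[of k], of x "f0 k" y] fS[of k] JS[OF x, of k] JS[OF yJ, of k] S(1)[of k] by simp
        moreover have "p k (inv (f0 k) \<otimes> y) < (1/2) ^ K" using oky k by (simp add: ok_def f_def)
        ultimately show "p k (inv x \<otimes> y) \<le> 2 * (1/2) ^ K" using f0(2)[of k] by linarith
      qed simp
      then show ?thesis using yE K r by (intro bexI[of _ y]) auto
    qed
    ultimately show "\<exists>D\<subseteq>J. countable D \<and> (\<forall>x\<in>J. \<forall>r>0. \<exists>y\<in>D. q (inv x \<otimes> y) < r)" by blast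
  qed
  have ball: "{x \<in> J. q x \<le> r} \<in> sets (borel_of T)" for r
  proof -
    \<comment> \<open>The condition is void when \<open>(1/2) ^ k \<le> r\<close>. Otherwise it says
      \<open>p k x \<le> r\<close>, which is closed in \<open>T' k\<close>, and its open complement
      is Borel in \<open>T\<close>.\<close>
    have "{x \<in> J. min (p k x) ((1/2) ^ k) \<le> r} \<in> sets (borel_of T)" for k
    proof (cases "(1/2) ^ k \<le> r")
      case True
      then have "{x \<in> J. min (p k x) ((1/2) ^ k) \<le> r} = J" by auto
      then show ?thesis using JB by simp
    next
      case False
      have "closedin (T' k) {x \<in> S k. p k x \<le> r}"
        unfolding T'p using normed_comm_group.closedin_norm_ball[OF ng[of k]] by simp
      then have o: "openin (T' k) (S k - {x \<in> S k. p k x \<le> r})"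
        using polishing_topologyD(3)[OF Tk[of k]] by (metis openin_closedin_eq closedin_def)
      then have "J - (S k - {x \<in> S k. p k x \<le> r}) \<in> sets (borel_of T)"
        using polishing_topologyD(2)[OF Tk o] JB by blast
      moreover have "J - (S k - {x \<in> S k. p k x \<le> r}) = {x \<in> J. min (p k x) ((1/2) ^ k) \<le> r}"
        using False JS[of _ k] by (auto simp: min_def)
      ultimately show ?thesis by simp
    qed
    then have "(\<Inter>k. {x \<in> J. min (p k x) ((1/2) ^ k) \<le> r}) \<in> sets (borel_of T)"
      by (intro sets.countable_INT) auto
    moreover have "(\<Inter>k. {x \<in> J. min (p k x) ((1/2) ^ k) \<le> r}) = {x \<in> J. q x \<le> r}"
      unfolding q_le by auto
    ultimately show ?thesis by simp
  qed
  have "non_archimedean (G\<lparr>carrier := J\<rparr>) (norm_top (G\<lparr>carrier := J\<rparr>) q)"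
    if na: "\<forall>k. non_archimedean (G\<lparr>carrier := S k\<rparr>) (T' k)"
  proof (rule non_archimedean_norm_topI[OF J qgn])
    fix r :: real assume r: "r > 0"
    then have r2: "r / 2 > 0" by simp
    obtain K where K: "(1/2) ^ K < r / 2" using small[OF r2] by blast
    have "\<exists>V s. subgroup V G \<and> V \<subseteq> {x \<in> S k. p k x < r / 2} \<and> s > 0 \<and> {x \<in> S k. p k x < s} \<subseteq> V" for k
    proof -
      have "openin (T' k) {x \<in> S k. p k x < r / 2}" "\<one> \<in> {x \<in> S k. p k x < r / 2}"
        unfolding T'p using normed_comm_group.norm_ball_one[OF ng[of k], of "r/2"]
          normed_comm_group.norm_one[OF ng[of k]] subgroup.one_closed[OF S(1)[of k]] r2 by auto
      then have "\<exists>V. openin (T' k) V \<and> subgroup V (G\<lparr>carrier := S k\<rparr>) \<and> V \<subseteq> {x \<in> S k. p k x < r / 2}"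
        using na[rule_format, of k, unfolded non_archimedean_def, rule_format, of "{x \<in> S k. p k x < r / 2}"]
        by simp
      then obtain V where V: "openin (T' k) V" "subgroup V (G\<lparr>carrier := S k\<rparr>)" "V \<subseteq> {x \<in> S k. p k x < r / 2}"
        by (elim exE conjE)
      have V1: "\<one> \<in> V" using subgroup.one_closed[OF V(2)] by simp
      obtain s where s: "s > 0" "\<And>y. y \<in> S k \<Longrightarrow> p k y < s \<Longrightarrow> y \<in> V"
        using normed_comm_group.openin_norm_top_one[OF ng[of k], of V] V(1) V1 unfolding T'p by auto
      have "subgroup V G" using incl_subgroup[OF S(1) V(2)] .
      then show ?thesis using V(3) s by blast
    qed
    then have "\<forall>k. \<exists>z. subgroup (fst z) G \<and> fst z \<subseteq> {x \<in> S k. p k x < r / 2} \<and>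
        snd z > 0 \<and> {x \<in> S k. p k x < snd z} \<subseteq> fst z" by simp
    from choice[OF this] obtain z where z: "\<forall>k. subgroup (fst (z k)) G \<and> fst (z k) \<subseteq> {x \<in> S k. p k x < r / 2} \<and>
        snd (z k) > 0 \<and> {x \<in> S k. p k x < snd (z k)} \<subseteq> fst (z k)" by (elim exE)
    define V where "V k = fst (z k)" for k
    define s where "s k = snd (z k)" for k
    have V: "\<And>k. subgroup (V k) G" "\<And>k. V k \<subseteq> {x \<in> S k. p k x < r / 2}" "\<And>k. s k > (0::real)"
      "\<And>k. {x \<in> S k. p k x < s k} \<subseteq> V k" unfolding V_def s_def using z by simp_all
    \<comment> \<open>Only the indices up to \<open>K\<close> need a subgroup; the later ones
      contribute less than \<open>r / 2\<close> to \<open>q\<close>. Working with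
      \<open>r / 2\<close> turns the resulting weak bound on \<open>q x\<close> into
      \<open>q x < r\<close>.\<close>
    let ?V = "J \<inter> (\<Inter>k\<in>{..K}. V k)"
    have "subgroup ?V G"
      using V(1) J by (intro subgroups_Inter_pair subgroups_Inter) auto
    moreover have "?V \<subseteq> {x \<in> J. q x < r}"
    proof clarify
      fix x assume x: "x \<in> J" "x \<in> (\<Inter>k\<in>{..K}. V k)"
      have "q x \<le> r / 2"
        by (rule q_leI[of K]) (use x V(2) K in \<open>auto intro: less_imp_le\<close>)
      then show "q x < r" using r by simp
    qed
    moreover have "{x \<in> J. q x < Min ((\<lambda>k. min (s k) ((1/2) ^ k)) ` {..K})} \<subseteq> ?V"
    proof (rule subsetI)
      fix x assume "x \<in> {x \<in> J. q x < Min ((\<lambda>k. min (s k) ((1/2) ^ k)) ` {..K})}"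
      then have x: "x \<in> J" "q x < Min ((\<lambda>k. min (s k) ((1/2) ^ k)) ` {..K})" by (simp_all only: mem_Collect_eq)
      have "x \<in> V k" if "k \<le> K" for k
      proof -
        have "q x < min (s k) ((1/2) ^ k)"
          by (rule less_le_trans[OF x(2)], rule Min_le) (use that in auto)
        then have "p k x < s k" by (intro q_less) auto
        then show ?thesis using V(4) JS[OF x(1)] by blast
      qed
      then show "x \<in> J \<inter> (\<Inter>k\<in>{..K}. V k)" using x(1) by auto
    qed
    moreover have "Min ((\<lambda>k. min (s k) ((1/2) ^ k)) ` {..K}) > 0" using V(3) by (subst Min_gr_iff) auto
    ultimately show "\<exists>V. subgroup V G \<and> V \<subseteq> {x \<in> J. q x < r} \<and> (\<exists>s>0. {x \<in> J. q x < s} \<subseteq> V)" by blast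
  qed
  with polishing_norm_top[OF J JB polish ball] show ?thesis unfolding J_def by blast
qed

end

section \<open>The first Solecki subgroup\<close>

locale polishable_pair = abelian_polish G T for G (structure) and T +
  fixes N :: "'a set" and TN :: "'a topology"
  assumes N: "subgroup N G" "N \<in> sets (borel_of T)" and TN: "polishing_topology G T N TN"
begin

definition solecki_closure :: "'a set" where
  "solecki_closure = (\<Inter>V\<in>{V. openin TN V \<and> \<one> \<in> V}. \<Union>z\<in>N. T closure_of (z <# V))"

lemma NG: "x \<in> N \<Longrightarrow> x \<in> carrier G"
  using subgroup.mem_carrier[OF N(1)] .

lemma TN_inclusion: "continuous_map TN T (\<lambda>x. x)"
  by (rule polishing_inclusion_continuous[OF abelian_polish_group N(2) TN])

lemma l_coset_image: "z <# V = (\<lambda>x. z \<otimes> x) ` V"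
  by (auto simp: l_coset_def)

end

locale normed_polishable_pair = polishable_pair G T N TN for G (structure) and T N TN +
  fixes p :: "'a \<Rightarrow> real"
  assumes p: "polish_norm (G\<lparr>carrier := N\<rparr>) p" and TNp: "TN = norm_top (G\<lparr>carrier := N\<rparr>) p"
begin

definition B :: "real \<Rightarrow> 'a set" where "B r = {z \<in> N. p z < r}"

definition K :: "real \<Rightarrow> 'a set" where "K r = T closure_of B r"

text \<open>On the first Solecki subgroup, \<open>q\<close> is the lower semicontinuous regularisation of \<open>p\<close>.\<close>

definition q :: "'a \<Rightarrow> real" where "q x = Inf {r. r > 0 \<and> x \<in> K r}"

text \<open>Solecki's formula with the norm balls, which are cofinal among the neighbourhoods of the
  identity of \<open>N\<close>, and with the translation by \<open>z\<close> moved to the side of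
  \<open>x\<close>.\<close>

definition S1 :: "'a set" where "S1 = {x \<in> carrier G. \<forall>r>0. \<exists>z\<in>N. inv z \<otimes> x \<in> K r}"

lemma pgn: "group_norm (G\<lparr>carrier := N\<rparr>) p"
  using p by (simp add: polish_norm_def)

sublocale n: normed_comm_group "G\<lparr>carrier := N\<rparr>" p
  by (rule normed_comm_groupI[OF subgroup_comm_group[OF N(1)] pgn])

lemma p_facts:
  assumes "x \<in> N"
  shows "0 \<le> p x" "p (inv x) = p x" "y \<in> N \<Longrightarrow> p (x \<otimes> y) \<le> p x + p y"
  using pgn assms unfolding group_norm_sub_iff[OF N(1)] by blast+

lemma p_one: "p \<one> = 0"
  using n.norm_one by simp

lemma one_B: "r > 0 \<Longrightarrow> \<one> \<in> B r"
  by (simp add: B_def p_one subgroup.one_closed[OF N(1)])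

lemma BG: "B r \<subseteq> carrier G"
  using NG by (auto simp: B_def)

lemma B_K: "B r \<subseteq> K r"
  unfolding K_def using closure_of_subset[of "B r" T] BG by simp

lemma KG: "x \<in> K r \<Longrightarrow> x \<in> carrier G"
  using closure_of_subset_topspace[of T "B r"] by (auto simp: K_def)

lemma one_K: "r > 0 \<Longrightarrow> \<one> \<in> K r"
  using one_B B_K by blast

lemma K_mono: "r \<le> s \<Longrightarrow> K r \<subseteq> K s"
  unfolding K_def by (rule closure_of_mono) (auto simp: B_def)

lemma closedin_K: "closedin T (K r)"
  by (simp add: K_def)

text \<open>Continuity of multiplication carries the inclusion of \<open>B r\<close> times
  \<open>B s\<close> in \<open>B (r + s)\<close> to the closures; this becomes the triangle
  inequality of \<open>q\<close>.\<close>

lemma K_mult: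
  assumes "x \<in> K r" "y \<in> K s"
  shows "x \<otimes> y \<in> K (r + s)"
proof -
  have c: "continuous_map (prod_topology T T) T (\<lambda>(x, y). x \<otimes> y)"
    using abelian_polish_group by (simp add: abelian_polish_group_def)
  have "(\<lambda>(x, y). x \<otimes> y) ` (K r \<times> K s) \<subseteq> T closure_of ((\<lambda>(x, y). x \<otimes> y) ` (B r \<times> B s))"
    using continuous_map_image_closure_subset[OF c, of "B r \<times> B s"] by (simp add: closure_of_Times K_def)
  also have "\<dots> \<subseteq> K (r + s)"
    unfolding K_def
  proof (rule closure_of_mono, clarify)
    fix x y assume "x \<in> B r" "y \<in> B s"
    then have xy: "x \<in> N" "y \<in> N" "p x < r" "p y < s" by (auto simp: B_def)
    then show "x \<otimes> y \<in> B (r + s)"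
      using p_facts(3)[OF xy(1,2)] subgroup.m_closed[OF N(1) xy(1,2)] by (simp add: B_def)
  qed
  finally show ?thesis using assms by auto
qed

lemma K_inv:
  assumes "x \<in> K r"
  shows "inv x \<in> K r"
proof -
  have c: "continuous_map T T (\<lambda>x. inv x)" using abelian_polish_group by (simp add: abelian_polish_group_def)
  have "(\<lambda>x. inv x) ` K r \<subseteq> T closure_of ((\<lambda>x. inv x) ` B r)"
    unfolding K_def by (rule continuous_map_image_closure_subset[OF c])
  also have "\<dots> \<subseteq> K r"
    unfolding K_def
    by (rule closure_of_mono) (use p_facts(2) subgroup.m_inv_closed[OF N(1)] in \<open>auto simp: B_def\<close>)
  finally show ?thesis using assms by auto
qed

lemma openin_TN_B:
  assumes "openin TN V" "\<one> \<in> V"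
  obtains r where "r > 0" "B r \<subseteq> V"
proof -
  obtain r where "r > 0" "\<And>y. y \<in> N \<Longrightarrow> p y < r \<Longrightarrow> y \<in> V"
    using n.openin_norm_top_one[of V] assms unfolding TNp by auto
  then show ?thesis using that[of r] by (auto simp: B_def)
qed

lemma openin_B: "openin TN (B r)"
  unfolding TNp B_def using n.norm_ball_one[of r] by simp

text \<open>Regularity puts a closed set between \<open>W\<close> and a neighbourhood of the
  identity, and the topology of \<open>N\<close> is fine enough for a ball to fit into the latter.
  This is what makes \<open>q\<close> separate points and makes \<open>q\<close>-Cauchy sequences
  Cauchy in \<open>T\<close>.\<close>

lemma K_small:
  assumes W: "openin T W" "\<one> \<in> W"
  obtains r where "r > 0" "K r \<subseteq> W"
proof -
  have "neighbourhood_base_of (closedin T) T"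
    using metrizable_imp_regular_space[OF metrizable] neighbourhood_base_of_closedin by blast
  from this[unfolded neighbourhood_base_of, rule_format, of W \<one>] W
  obtain U C where UC: "openin T U" "closedin T C" "\<one> \<in> U" "U \<subseteq> C" "C \<subseteq> W"
    by blast
  have "openin TN {x \<in> topspace TN. x \<in> U}"
    by (rule openin_continuous_map_preimage[OF TN_inclusion UC(1)])
  moreover have "\<one> \<in> {x \<in> topspace TN. x \<in> U}"
    using UC(3) subgroup.one_closed[OF N(1)] polishing_topologyD(3)[OF TN] by simp
  ultimately obtain r where r: "r > 0" "B r \<subseteq> {x \<in> topspace TN. x \<in> U}" by (rule openin_TN_B)
  have "K r \<subseteq> C" unfolding K_def by (rule closure_of_minimal[OF _ UC(2)]) (use r UC(4) in auto)
  then show ?thesis using that r(1) UC(5) by blast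
qed

lemma solecki_closure_eq: "solecki_closure = S1"
proof (intro equalityI subsetI)
  fix x assume x: "x \<in> solecki_closure"
  have *: "\<exists>z\<in>N. inv z \<otimes> x \<in> K r \<and> x \<in> carrier G" if r: "r > 0" for r
  proof -
    have "B r \<in> {V. openin TN V \<and> \<one> \<in> V}" using openin_B one_B[OF r] by simp
    then obtain z where z: "z \<in> N" "x \<in> T closure_of (z <# B r)" using x unfolding solecki_closure_def by blast
    then obtain y where y: "y \<in> K r" "x = z \<otimes> y"
      unfolding l_coset_image closure_translate[OF NG[OF z(1)] BG] K_def[symmetric] by blast
    then show ?thesis using z(1) NG[OF z(1)] KG[OF y(1)] by (intro bexI[of _ z]) auto
  qed
  then have "x \<in> carrier G" using zero_less_one by blast
  then show "x \<in> S1" unfolding S1_def using * by blast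
next
  fix x assume x: "x \<in> S1"
  show "x \<in> solecki_closure"
    unfolding solecki_closure_def
  proof (rule INT_I)
    fix V assume "V \<in> {V. openin TN V \<and> \<one> \<in> V}"
    then have V: "openin TN V" "\<one> \<in> V" by auto
    then obtain r where r: "r > 0" "B r \<subseteq> V" by (rule openin_TN_B)
    have VG: "V \<subseteq> carrier G" using openin_subset[OF V(1)] polishing_topologyD(3)[OF TN] NG by auto
    obtain z where z: "z \<in> N" "inv z \<otimes> x \<in> K r" and xG: "x \<in> carrier G" using x r(1) unfolding S1_def by blast
    have "inv z \<otimes> x \<in> T closure_of V" using z(2) closure_of_mono[OF r(2), of T] unfolding K_def by blast
    then have "z \<otimes> (inv z \<otimes> x) \<in> (\<lambda>x. z \<otimes> x) ` (T closure_of V)" by (rule imageI)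
    then have "x \<in> T closure_of (z <# V)"
      unfolding l_coset_image closure_translate[OF NG[OF z(1)] VG] using NG[OF z(1)] xG by simp
    then show "x \<in> (\<Union>z\<in>N. T closure_of (z <# V))" using z(1) by blast
  qed
qed

lemma S1G: "x \<in> S1 \<Longrightarrow> x \<in> carrier G"
  by (simp add: S1_def)

lemma S1_ex: "x \<in> S1 \<Longrightarrow> r > 0 \<Longrightarrow> \<exists>z\<in>N. inv z \<otimes> x \<in> K r"
  by (simp add: S1_def)

lemma N_S1: "N \<subseteq> S1"
proof
  fix x assume x: "x \<in> N"
  have "inv x \<otimes> x = \<one>" using NG[OF x] by simp
  then show "x \<in> S1" unfolding S1_def using NG[OF x] one_K x by (auto intro!: bexI[of _ x])
qed

lemma S1_subgroup: "subgroup S1 G"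
proof
  show "S1 \<subseteq> carrier G" using S1G by auto
  show "\<one> \<in> S1" using N_S1 subgroup.one_closed[OF N(1)] by blast
  show "x \<otimes> y \<in> S1" if xy: "x \<in> S1" "y \<in> S1" for x y
    unfolding S1_def
  proof (intro CollectI conjI allI impI)
    show "x \<otimes> y \<in> carrier G" using xy S1G by simp
    fix r :: real assume "r > 0"
    then have r2: "r / 2 > 0" by simp
    obtain z w where z: "z \<in> N" "inv z \<otimes> x \<in> K (r/2)" and w: "w \<in> N" "inv w \<otimes> y \<in> K (r/2)"
      using S1_ex[OF xy(1) r2] S1_ex[OF xy(2) r2] by blast
    have "(inv z \<otimes> x) \<otimes> (inv w \<otimes> y) \<in> K r" using K_mult[OF z(2) w(2)] by simp
    moreover have "(inv z \<otimes> x) \<otimes> (inv w \<otimes> y) = inv (z \<otimes> w) \<otimes> (x \<otimes> y)"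
      using NG[OF z(1)] NG[OF w(1)] S1G[OF xy(1)] S1G[OF xy(2)] by (simp add: inv_mult m_ac)
    ultimately show "\<exists>z\<in>N. inv z \<otimes> (x \<otimes> y) \<in> K r"
      using subgroup.m_closed[OF N(1) z(1) w(1)] by (intro bexI[of _ "z \<otimes> w"]) auto
  qed
  show "inv x \<in> S1" if x: "x \<in> S1" for x
    unfolding S1_def
  proof (intro CollectI conjI allI impI)
    show "inv x \<in> carrier G" using x S1G by simp
    fix r :: real assume "r > 0"
    then obtain z where z: "z \<in> N" "inv z \<otimes> x \<in> K r" using S1_ex[OF x] by blast
    have "inv (inv z \<otimes> x) = inv (inv z) \<otimes> inv x" using NG[OF z(1)] S1G[OF x] by (simp add: inv_mult)
    then show "\<exists>z\<in>N. inv z \<otimes> inv x \<in> K r"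
      using K_inv[OF z(2)] subgroup.m_inv_closed[OF N(1) z(1)] by (intro bexI[of _ "inv z"]) auto
  qed
qed

lemma S1_diff: "x \<in> S1 \<Longrightarrow> y \<in> S1 \<Longrightarrow> inv x \<otimes> y \<in> S1"
  by (intro subgroup.m_closed[OF S1_subgroup] subgroup.m_inv_closed[OF S1_subgroup])

text \<open>Finiteness of \<open>q\<close> on \<open>S1\<close>: with \<open>z\<close> in
  \<open>N\<close> and \<open>inv z \<otimes> x\<close> in \<open>K 1\<close>, the factor
  \<open>z\<close> lies in the ball of radius \<open>p z + 1\<close>.\<close>

lemma S1_K: 
  assumes "x \<in> S1"
  obtains r where "r > 0" "x \<in> K r"
proof -
  obtain z where z: "z \<in> N" "inv z \<otimes> x \<in> K 1" using S1_ex[OF assms, of 1] by auto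
  have "z \<in> B (p z + 1)" using z(1) by (simp add: B_def)
  then have "z \<otimes> (inv z \<otimes> x) \<in> K (p z + 1 + 1)" using K_mult[OF _ z(2)] B_K by blast
  then show ?thesis using that[of "p z + 1 + 1"] p_facts(1)[OF z(1)] NG[OF z(1)] S1G[OF assms] by simp
qed

lemma q_le: "x \<in> K r \<Longrightarrow> r > 0 \<Longrightarrow> q x \<le> r"
  unfolding q_def by (rule cInf_lower) (auto intro: bdd_belowI[of _ 0])

lemma q_less:
  assumes "x \<in> S1" "q x < r"
  shows "x \<in> K r"
proof -
  have "{r. r > 0 \<and> x \<in> K r} \<noteq> {}" using S1_K[OF assms(1)] by blast
  then obtain s where "s > 0" "x \<in> K s" "s < r"
    using cInf_lessD[of "{r. r > 0 \<and> x \<in> K r}" r] assms(2) unfolding q_def by auto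
  then show ?thesis using K_mono[of s r] by auto
qed

lemma q_nonneg: "x \<in> S1 \<Longrightarrow> 0 \<le> q x"
  unfolding q_def by (rule cInf_greatest) (auto elim: S1_K)

lemma q_norm: "group_norm (G\<lparr>carrier := S1\<rparr>) q"
  unfolding group_norm_sub_iff[OF S1_subgroup]
proof (intro conjI ballI)
  fix x assume x: "x \<in> S1"
  show "0 \<le> q x" by (rule q_nonneg[OF x])
  have "inv x \<in> K r \<longleftrightarrow> x \<in> K r" for r using K_inv[of x r] K_inv[of "inv x" r] S1G[OF x] by auto
  then show "q (inv x) = q x" by (simp add: q_def)
  show "q x = 0 \<longleftrightarrow> x = \<one>"
  proof
    assume q0: "q x = 0"
    show "x = \<one>"
    proof (rule ccontr)
      assume "x \<noteq> \<one>"
      then have 1: "\<one> \<in> topspace T - {x}" by simp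
      have "openin T (topspace T - {x})"
        using metrizable_imp_t1_space[OF metrizable] S1G[OF x] openin_topspace[of T]
        unfolding t1_space_closedin_singleton by (intro openin_diff) simp_all
      from this 1 obtain r where "r > 0" "K r \<subseteq> topspace T - {x}" by (rule K_small)
      then show False using q_less[OF x, of r] q0 by auto
    qed
  next
    assume x1: "x = \<one>"
    have "q x \<le> r" if "r > 0" for r unfolding x1 by (rule q_le[OF one_K[OF that] that])
    then have "q x \<le> 0" by (rule field_le_epsilon[of "q x" 0, simplified])
    then show "q x = 0" using q_nonneg[OF x] by simp
  qed
next
  fix x y assume xy: "x \<in> S1" "y \<in> S1"
  show "q (x \<otimes> y) \<le> q x + q y"
  proof (rule field_le_epsilon)
    fix e :: real assume e: "e > 0"
    have "x \<in> K (q x + e/2)" by (rule q_less[OF xy(1)]) (use e in simp)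
    moreover have "y \<in> K (q y + e/2)" by (rule q_less[OF xy(2)]) (use e in simp)
    ultimately have "x \<otimes> y \<in> K (q x + e/2 + (q y + e/2))" by (rule K_mult)
    moreover have "q x + e/2 + (q y + e/2) > 0" using q_nonneg[OF xy(1)] q_nonneg[OF xy(2)] e by linarith
    ultimately have "q (x \<otimes> y) \<le> q x + e/2 + (q y + e/2)" by (rule q_le)
    then show "q (x \<otimes> y) \<le> q x + q y + e" by simp
  qed
qed

text \<open>A \<open>q\<close>-Cauchy sequence is Cauchy in \<open>T\<close> and has a limit
  \<open>x\<close> there. Because \<open>K r\<close> is closed in \<open>T\<close>, the relation
  \<open>inv (\<sigma> m) \<otimes> \<sigma> n \<in> K r\<close> survives the limit in
  \<open>n\<close>; this yields both that \<open>x\<close> lies in \<open>S1\<close> and that the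
  convergence is in \<open>q\<close>.\<close>

lemma q_complete:
  fixes \<sigma> :: "nat \<Rightarrow> 'a"
  assumes \<sigma>: "range \<sigma> \<subseteq> S1" and Cau: "\<And>r. r > 0 \<Longrightarrow> \<exists>N. \<forall>m\<ge>N. \<forall>n\<ge>N. q (inv (\<sigma> m) \<otimes> \<sigma> n) < r"
  shows "\<exists>x\<in>S1. \<forall>r>0. \<exists>N. \<forall>n\<ge>N. q (inv x \<otimes> \<sigma> n) < r"
proof -
  have sS: "\<sigma> n \<in> S1" for n using \<sigma> by auto
  have sG: "\<sigma> n \<in> carrier G" for n using S1G[OF sS] .
  have CauK: "\<exists>N. \<forall>m\<ge>N. \<forall>n\<ge>N. inv (\<sigma> m) \<otimes> \<sigma> n \<in> K r" if r: "r > 0" for r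
  proof -
    obtain N where N: "\<forall>m\<ge>N. \<forall>n\<ge>N. q (inv (\<sigma> m) \<otimes> \<sigma> n) < r" using Cau[OF r] by blast
    have "inv (\<sigma> m) \<otimes> \<sigma> n \<in> K r" if "m \<ge> N" "n \<ge> N" for m n
      using N that by (intro q_less[OF S1_diff[OF sS sS]]) simp
    then show ?thesis by blast
  qed
  obtain g where g: "polish_norm G g" and Tg: "T = norm_top G g" using ex_polish_norm by blast
  then have ggn: "group_norm G g" by (simp add: polish_norm_def)
  interpret g: normed_comm_group G g by (rule normed_comm_groupI[OF comm_group_axioms ggn])
  have "norm_Cauchy G g \<sigma>"
    unfolding norm_Cauchy_def
  proof (intro conjI allI impI)
    show "range \<sigma> \<subseteq> carrier G" using sG by auto
    fix r :: real assume r: "r > 0"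
    obtain s where s: "s > 0" "K s \<subseteq> {y \<in> carrier G. g y < r}"
      using K_small[of "{y \<in> carrier G. g y < r}"] g.norm_ball_one[of r] r unfolding Tg by auto
    then obtain N where N: "\<forall>m\<ge>N. \<forall>n\<ge>N. inv (\<sigma> m) \<otimes> \<sigma> n \<in> K s" using CauK by blast
    show "\<exists>N. \<forall>m\<ge>N. \<forall>n\<ge>N. g (inv (\<sigma> m) \<otimes> \<sigma> n) < r"
      by (intro exI[of _ N]) (use N s(2) in blast)
  qed
  then obtain x where xG: "x \<in> carrier G" and "norm_lim G g \<sigma> x" using g by (auto simp: polish_norm_def)
  then have lim: "limitin T \<sigma> x sequentially" unfolding Tg using g.limitin_norm_top[of \<sigma> x] sG by auto
  have near: "\<exists>N. \<forall>m\<ge>N. inv (\<sigma> m) \<otimes> x \<in> K r" if r: "r > 0" for r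
  proof -
    obtain N where N: "\<forall>m\<ge>N. \<forall>n\<ge>N. inv (\<sigma> m) \<otimes> \<sigma> n \<in> K r" using CauK[OF r] by blast
    have "inv (\<sigma> m) \<otimes> x \<in> K r" if m: "m \<ge> N" for m
    proof (rule limitin_closedin[OF _ closedin_K])
      show "limitin T (\<lambda>n. inv (\<sigma> m) \<otimes> \<sigma> n) (inv (\<sigma> m) \<otimes> x) sequentially"
        using continuous_map_limit[OF continuous_map_translate[of "inv (\<sigma> m)"] lim] sG[of m] by (simp add: o_def)
      show "\<forall>\<^sub>F n in sequentially. inv (\<sigma> m) \<otimes> \<sigma> n \<in> K r"
        unfolding eventually_sequentially by (intro exI[of _ N]) (use N m in blast)
    qed simp
    then show ?thesis by blast
  qed
  have xS: "x \<in> S1"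
    unfolding S1_def
  proof (intro CollectI conjI allI impI)
    show "x \<in> carrier G" by fact
    fix r :: real assume "r > 0"
    then have r2: "r / 2 > 0" by simp
    obtain m where m: "inv (\<sigma> m) \<otimes> x \<in> K (r/2)" using near[OF r2] by blast
    obtain z where z: "z \<in> N" "inv z \<otimes> \<sigma> m \<in> K (r/2)" using S1_ex[OF sS r2] by blast
    have "(inv z \<otimes> \<sigma> m) \<otimes> (inv (\<sigma> m) \<otimes> x) \<in> K r" using K_mult[OF z(2) m] by simp
    moreover have "(inv z \<otimes> \<sigma> m) \<otimes> (inv (\<sigma> m) \<otimes> x) = inv z \<otimes> x"
      using NG[OF z(1)] sG[of m] xG by (simp add: m_assoc)
    ultimately show "\<exists>z\<in>N. inv z \<otimes> x \<in> K r" using z(1) by (intro bexI[of _ z]) auto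
  qed
  show ?thesis
  proof (intro bexI[OF _ xS] allI impI)
    fix r :: real assume r: "r > 0"
    then have r2: "r / 2 > 0" by simp
    obtain N where N: "\<forall>m\<ge>N. inv (\<sigma> m) \<otimes> x \<in> K (r/2)" using near[OF r2] by blast
    have "q (inv x \<otimes> \<sigma> n) < r" if n: "n \<ge> N" for n
    proof -
      have "inv (inv (\<sigma> n) \<otimes> x) \<in> K (r/2)" using N n by (intro K_inv) blast
      moreover have "inv (inv (\<sigma> n) \<otimes> x) = inv x \<otimes> \<sigma> n" using sG[of n] xG by (simp add: inv_mult m_comm)
      ultimately have "q (inv x \<otimes> \<sigma> n) \<le> r / 2" using q_le[OF _ r2] by simp
      then show ?thesis using r by simp
    qed
    then show "\<exists>N. \<forall>n\<ge>N. q (inv x \<otimes> \<sigma> n) < r" by blast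
  qed
qed

text \<open>By its very formula \<open>S1\<close> is approximated by elements of \<open>N\<close> up
  to \<open>K r\<close>, and within \<open>N\<close> a dense set for \<open>p\<close> suffices,
  since \<open>B r\<close> is contained in \<open>K r\<close>.\<close>

lemma ex_dense:
  shows "\<exists>D\<subseteq>N. countable D \<and> (\<forall>x\<in>S1. \<forall>r>0. \<exists>y\<in>D. inv y \<otimes> x \<in> K r)"
proof -
  from p have "\<exists>D\<subseteq>N. countable D \<and> (\<forall>x\<in>N. \<forall>r>0. \<exists>y\<in>D. p (inv x \<otimes> y) < r)"
    unfolding polish_norm_sub_iff[OF N(1)] by (elim conjE)
  then obtain D where D: "D \<subseteq> N" "countable D" "\<And>x r. x \<in> N \<Longrightarrow> r > 0 \<Longrightarrow> \<exists>y\<in>D. p (inv x \<otimes> y) < r" by blast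
  have "\<exists>y\<in>D. inv y \<otimes> x \<in> K r" if x: "x \<in> S1" and r: "r > 0" for x r
  proof -
    have r2: "r / 2 > 0" using r by simp
    obtain z where z: "z \<in> N" "inv z \<otimes> x \<in> K (r/2)" using S1_ex[OF x r2] by blast
    obtain y where y: "y \<in> D" "p (inv z \<otimes> y) < r / 2" using D(3)[OF z(1) r2] by blast
    have yN: "y \<in> N" using y D by auto
    have "inv z \<otimes> y \<in> B (r/2)"
      using y(2) z(1) yN N(1) by (simp add: B_def subgroup.m_closed subgroup.m_inv_closed)
    then have "inv (inv z \<otimes> y) \<in> K (r/2)" using B_K K_inv by blast
    then have "inv (inv z \<otimes> y) \<otimes> (inv z \<otimes> x) \<in> K r" using K_mult[OF _ z(2)] by fastforce
    moreover have "inv (inv z \<otimes> y) \<otimes> (inv z \<otimes> x) = inv y \<otimes> x"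
      using NG[OF z(1)] NG[OF yN] S1G[OF x] by (simp add: inv_mult m_assoc m_comm[of z "inv y"])
    ultimately show ?thesis using y(1) by auto
  qed
  then show ?thesis using D(1,2) by blast
qed

lemma q_polish: "polish_norm (G\<lparr>carrier := S1\<rparr>) q"
  unfolding polish_norm_sub_iff[OF S1_subgroup]
proof (intro conjI allI impI)
  show "\<forall>x\<in>S1. 0 \<le> q x \<and> q (inv x) = q x \<and> (q x = 0) = (x = \<one>)" "\<forall>x\<in>S1. \<forall>y\<in>S1. q (x \<otimes> y) \<le> q x + q y"
    using q_norm[unfolded group_norm_sub_iff[OF S1_subgroup]] by (rule conjunct1, rule conjunct2)
next
  fix \<sigma> :: "nat \<Rightarrow> 'a"
  assume \<sigma>: "range \<sigma> \<subseteq> S1 \<and> (\<forall>r>0. \<exists>N. \<forall>m\<ge>N. \<forall>n\<ge>N. q (inv (\<sigma> m) \<otimes> \<sigma> n) < r)"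
  show "\<exists>x\<in>S1. \<forall>r>0. \<exists>N. \<forall>n\<ge>N. q (inv x \<otimes> \<sigma> n) < r"
    by (rule q_complete) (use \<sigma> in simp_all)
next
  obtain D where D: "D \<subseteq> N" "countable D" "\<And>x r. x \<in> S1 \<Longrightarrow> r > 0 \<Longrightarrow> \<exists>y\<in>D. inv y \<otimes> x \<in> K r"
    using ex_dense by blast
  have "\<exists>y\<in>D. q (inv x \<otimes> y) < r" if x: "x \<in> S1" and r: "r > 0" for x r
  proof -
    have r2: "r / 2 > 0" using r by simp
    obtain y where y: "y \<in> D" "inv y \<otimes> x \<in> K (r/2)" using D(3)[OF x r2] by blast
    have yG: "y \<in> carrier G" using y(1) D(1) NG by blast
    have "inv (inv y \<otimes> x) = inv x \<otimes> y" using yG S1G[OF x] by (simp add: inv_mult m_comm)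
    then have "q (inv x \<otimes> y) \<le> r / 2" using q_le[OF K_inv[OF y(2)] r2] by simp
    then show ?thesis using y(1) r by (intro bexI[of _ y]) auto
  qed
  then show "\<exists>D\<subseteq>S1. countable D \<and> (\<forall>x\<in>S1. \<forall>r>0. \<exists>y\<in>D. q (inv x \<otimes> y) < r)"
    using D(1,2) N_S1 by (intro exI[of _ D] conjI) auto
qed

text \<open>The union over \<open>N\<close> in the formula may be restricted to a countable dense
  \<open>D\<close>, which leaves a countable intersection of countable unions of closed
  sets.\<close>

lemma S1_borel: "S1 \<in> sets (borel_of T)"
proof -
  obtain D where D: "D \<subseteq> N" "countable D" "\<And>x r. x \<in> S1 \<Longrightarrow> r > 0 \<Longrightarrow> \<exists>y\<in>D. inv y \<otimes> x \<in> K r"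
    using ex_dense by blast
  define A where "A y n = (\<lambda>x. inv y \<otimes> x) -` K (inverse (real (Suc n))) \<inter> space (borel_of T)" for y n
  have "A y n \<in> sets (borel_of T)" if "y \<in> D" for y n
    unfolding A_def using that D(1) NG
    by (intro measurable_sets[OF continuous_map_measurable[OF continuous_map_translate]] closedin_borel_of closedin_K) auto
  then have "(\<Inter>n. \<Union>y\<in>D. A y n) \<in> sets (borel_of T)"
    by (intro sets.countable_INT image_subsetI sets.countable_UN'[OF D(2)]) auto
  moreover have "S1 = (\<Inter>n. \<Union>y\<in>D. A y n)"
  proof (intro equalityI subsetI)
    fix x assume x: "x \<in> S1"
    show "x \<in> (\<Inter>n. \<Union>y\<in>D. A y n)"
    proof (rule INT_I)
      fix n
      have "inverse (real (Suc n)) > 0" by simp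
      then obtain y where y: "y \<in> D" "inv y \<otimes> x \<in> K (inverse (real (Suc n)))" using D(3)[OF x] by blast
      then have "x \<in> A y n" unfolding A_def using S1G[OF x] by simp
      with y(1) show "x \<in> (\<Union>y\<in>D. A y n)" by (rule UN_I)
    qed
  next
    fix x assume x: "x \<in> (\<Inter>n. \<Union>y\<in>D. A y n)"
    show "x \<in> S1"
      unfolding S1_def
    proof (intro CollectI conjI allI impI)
      show "x \<in> carrier G" using x by (auto simp: A_def)
      fix r :: real assume "r > 0"
      then obtain n where n: "inverse (Suc n) < r" using reals_Archimedean by blast
      obtain y where y: "y \<in> D" "x \<in> A y n" using x by blast
      have "inv y \<otimes> x \<in> K r" using y(2) K_mono[of "inverse (Suc n)" r] n unfolding A_def by auto
      then show "\<exists>z\<in>N. inv z \<otimes> x \<in> K r" using y(1) D(1) by blast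
    qed
  qed
  ultimately show ?thesis by simp
qed

text \<open>The infimum need not be attained, so \<open>q x \<le> r\<close> amounts to membership in
  the closed sets of all slightly larger radii. A negative \<open>r\<close> is set apart because
  \<open>q_le\<close> asks for positive radii.\<close>

lemma q_ball_borel: "{x \<in> S1. q x \<le> r} \<in> sets (borel_of T)"
proof (cases "r \<ge> 0")
  case True
  have "{x \<in> S1. q x \<le> r} = S1 \<inter> (\<Inter>n. K (r + inverse (real (Suc n))))"
  proof (intro equalityI subsetI)
    fix x assume "x \<in> {x \<in> S1. q x \<le> r}"
    then have x: "x \<in> S1" "q x \<le> r" by auto
    have "x \<in> K (r + inverse (real (Suc n)))" for n
    proof (rule q_less[OF x(1)])
      have "inverse (real (Suc n)) > 0" by simp
      then show "q x < r + inverse (real (Suc n))" using x(2) by linarith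
    qed
    then show "x \<in> S1 \<inter> (\<Inter>n. K (r + inverse (real (Suc n))))" using x(1) by blast
  next
    fix x assume "x \<in> S1 \<inter> (\<Inter>n. K (r + inverse (real (Suc n))))"
    then have x: "x \<in> S1" "\<And>n. x \<in> K (r + inverse (real (Suc n)))" by auto
    have "q x \<le> r"
    proof (rule field_le_epsilon)
      fix e :: real assume "e > 0"
      then obtain n where n: "inverse (Suc n) < e" using reals_Archimedean by blast
      have "inverse (real (Suc n)) > 0" by simp
      then have "r + inverse (real (Suc n)) > 0" using True by linarith
      then have "q x \<le> r + inverse (real (Suc n))" by (rule q_le[OF x(2)])
      then show "q x \<le> r + e" using n by linarith
    qed
    then show "x \<in> {x \<in> S1. q x \<le> r}" using x(1) by simp
  qed
  moreover have "S1 \<inter> (\<Inter>n. K (r + inverse (real (Suc n)))) \<in> sets (borel_of T)"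
    by (intro sets.Int S1_borel sets.countable_INT image_subsetI closedin_borel_of closedin_K) auto
  ultimately show ?thesis by simp
next
  case False
  then have empty: "{x \<in> S1. q x \<le> r} = {}" using q_nonneg by force
  show ?thesis unfolding empty by simp
qed

text \<open>The closure in \<open>T\<close> of a small open subgroup of \<open>N\<close>, cut down
  to \<open>S1\<close>, is a subgroup squeezed between two balls of \<open>q\<close>.\<close>

lemma q_non_archimedean:
  assumes na: "non_archimedean (G\<lparr>carrier := N\<rparr>) TN"
  shows "non_archimedean (G\<lparr>carrier := S1\<rparr>) (norm_top (G\<lparr>carrier := S1\<rparr>) q)"
proof (rule non_archimedean_norm_topI[OF S1_subgroup q_norm])
  fix r :: real assume r: "r > 0"
  then have r2: "r / 2 > 0" by simp
  have "\<exists>V. openin TN V \<and> subgroup V (G\<lparr>carrier := N\<rparr>) \<and> V \<subseteq> B (r/2)"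
    using na[unfolded non_archimedean_def, rule_format, of "B (r/2)"] openin_B one_B[OF r2] by simp
  then obtain V where V: "openin TN V" "subgroup V (G\<lparr>carrier := N\<rparr>)" "V \<subseteq> B (r/2)" by (elim exE conjE)
  have "\<one> \<in> V" using subgroup.one_closed[OF V(2)] by simp
  with V(1) obtain s where s: "s > 0" "B s \<subseteq> V" by (rule openin_TN_B)
  have VG: "subgroup V G" by (rule incl_subgroup[OF N(1) V(2)])
  let ?V = "T closure_of V \<inter> S1"
  have "subgroup ?V G" by (rule subgroups_Inter_pair[OF subgroup_closure_of[OF VG] S1_subgroup])
  moreover have "?V \<subseteq> {x \<in> S1. q x < r}"
  proof
    fix x assume x: "x \<in> ?V"
    then have "x \<in> K (r/2)" unfolding K_def using closure_of_mono[OF V(3), of T] by blast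
    then have "q x \<le> r / 2" by (rule q_le[OF _ r2])
    then show "x \<in> {x \<in> S1. q x < r}" using x r by simp
  qed
  moreover have "{x \<in> S1. q x < s} \<subseteq> ?V"
  proof
    fix x assume "x \<in> {x \<in> S1. q x < s}"
    then have x: "x \<in> S1" "q x < s" by auto
    then have "x \<in> K s" by (rule q_less)
    then show "x \<in> ?V" using closure_of_mono[OF s(2), of T] x(1) unfolding K_def by blast
  qed
  ultimately show "\<exists>V. subgroup V G \<and> V \<subseteq> {x \<in> S1. q x < r} \<and> (\<exists>s>0. {x \<in> S1. q x < s} \<subseteq> V)"
    using s(1) by blast
qed

end

context polishable_pair
begin

lemma solecki_closure_polishable:
  shows "subgroup solecki_closure G" "N \<subseteq> solecki_closure" "solecki_closure \<in> sets (borel_of T)"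
    "\<exists>T'. polishing_topology G T solecki_closure T' \<and>
       (non_archimedean (G\<lparr>carrier := N\<rparr>) TN \<longrightarrow> non_archimedean (G\<lparr>carrier := solecki_closure\<rparr>) T')"
proof -
  obtain p where p: "polish_norm (G\<lparr>carrier := N\<rparr>) p" "TN = norm_top (G\<lparr>carrier := N\<rparr>) p"
    using polishing_ex_norm[OF TN] by blast
  interpret normed_polishable_pair G T N TN p
    by (intro normed_polishable_pair.intro polishable_pair_axioms normed_polishable_pair_axioms.intro p)
  show "subgroup solecki_closure G" "N \<subseteq> solecki_closure" "solecki_closure \<in> sets (borel_of T)"
    unfolding solecki_closure_eq by (rule S1_subgroup N_S1 S1_borel)+
  show "\<exists>T'. polishing_topology G T solecki_closure T' \<and>
       (non_archimedean (G\<lparr>carrier := N\<rparr>) TN \<longrightarrow> non_archimedean (G\<lparr>carrier := solecki_closure\<rparr>) T')"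
    unfolding solecki_closure_eq
    using polishing_norm_top[OF S1_subgroup S1_borel q_polish q_ball_borel] q_non_archimedean by blast
qed

end

section \<open>Borel lifts of homomorphisms\<close>

text \<open>Second countability makes an open set of the product a countable union of open
  rectangles.\<close>

lemma measurable_Pair_borel_of:
  assumes Y: "second_countable Y" and f: "f \<in> M \<rightarrow>\<^sub>M borel_of Y" and g: "g \<in> M \<rightarrow>\<^sub>M borel_of Y"
  shows "(\<lambda>x. (f x, g x)) \<in> M \<rightarrow>\<^sub>M borel_of (prod_topology Y Y)"
proof (rule measurable_borel_of)
  have fs: "f x \<in> topspace Y" "g x \<in> topspace Y" if "x \<in> space M" for x
    using measurable_space[OF f that] measurable_space[OF g that] by simp_all
  show "(\<lambda>x. (f x, g x)) \<in> space M \<rightarrow> topspace (prod_topology Y Y)" using fs by auto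
  obtain \<B> where \<B>: "countable \<B>" "\<And>V. V \<in> \<B> \<Longrightarrow> openin Y V"
    "\<And>U x. openin Y U \<Longrightarrow> x \<in> U \<Longrightarrow> \<exists>V\<in>\<B>. x \<in> V \<and> V \<subseteq> U"
    using Y by (auto simp: second_countable_def)
  fix U assume U: "openin (prod_topology Y Y) U"
  let ?I = "{(A, B). A \<in> \<B> \<and> B \<in> \<B> \<and> A \<times> B \<subseteq> U}"
  have "(\<lambda>x. (f x, g x)) -` U \<inter> space M = (\<Union>(A, B)\<in>?I. (f -` A \<inter> space M) \<inter> (g -` B \<inter> space M))"
  proof (intro equalityI subsetI)
    fix x assume x: "x \<in> (\<lambda>x. (f x, g x)) -` U \<inter> space M"
    then have "(f x, g x) \<in> U" by simp
    from U[unfolded openin_prod_topology_alt, rule_format, OF this]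
    obtain A' B' where AB': "openin Y A'" "openin Y B'" "f x \<in> A'" "g x \<in> B'" "A' \<times> B' \<subseteq> U"
      by (elim exE conjE)
    obtain A where A: "A \<in> \<B>" "f x \<in> A" "A \<subseteq> A'" using \<B>(3)[OF AB'(1,3)] by blast
    obtain B where B: "B \<in> \<B>" "g x \<in> B" "B \<subseteq> B'" using \<B>(3)[OF AB'(2,4)] by blast
    have "A \<times> B \<subseteq> U" using A(3) B(3) AB'(5) by blast
    then have "(A, B) \<in> ?I" using A(1) B(1) by simp
    then show "x \<in> (\<Union>(A, B)\<in>?I. (f -` A \<inter> space M) \<inter> (g -` B \<inter> space M))"
      by (rule UN_I) (use A(2) B(2) x in simp)
  qed auto
  moreover have "countable ?I" by (rule countable_subset[of _ "\<B> \<times> \<B>"]) (use \<B>(1) in auto)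
  then have "(\<Union>(A, B)\<in>?I. (f -` A \<inter> space M) \<inter> (g -` B \<inter> space M)) \<in> sets M"
  proof (rule sets.countable_UN', safe)
    fix A B assume "A \<in> \<B>" "B \<in> \<B>"
    then show "(f -` A \<inter> space M) \<inter> (g -` B \<inter> space M) \<in> sets M"
      using \<B>(2) by (intro sets.Int measurable_sets[OF f] measurable_sets[OF g] openin_borel_of)
  qed
  ultimately show "(\<lambda>x. (f x, g x)) -` U \<inter> space M \<in> sets M" by simp
qed

lemma (in abelian_polish) measurable_diff:
  assumes "f \<in> M \<rightarrow>\<^sub>M borel_of T" "g \<in> M \<rightarrow>\<^sub>M borel_of T"
  shows "(\<lambda>x. f x \<otimes> inv (g x)) \<in> M \<rightarrow>\<^sub>M borel_of T"
proof -
  have "continuous_map (prod_topology T T) T (\<lambda>z. fst z \<otimes> inv (snd z))"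
    by (intro continuous_map_mult continuous_map_m_inv continuous_map_fst continuous_map_snd)
  from measurable_compose[OF measurable_Pair_borel_of[OF second_countable assms] continuous_map_measurable[OF this]]
  show ?thesis by simp
qed

text \<open>A Borel lift of a homomorphism from \<open>G/N\<close> to \<open>H/M\<close>, with
  equality of cosets expressed by correction factors in \<open>M\<close>. This form survives
  unchanged when \<open>G\<close> and \<open>H\<close> shrink to subgroups with the same
  kernels.\<close>

locale borel_lift = G: polishable_pair G TG N TN + H: polishable_pair H TH M TM
  for G :: "('a, 'm) monoid_scheme" and TG N TN and H :: "('b, 'n) monoid_scheme" and TH M TM +
  fixes f :: "'a \<Rightarrow> 'b"
  assumes f: "f \<in> borel_of TG \<rightarrow>\<^sub>M borel_of TH"
    and f_mult: "x \<in> carrier G \<Longrightarrow> y \<in> carrier G \<Longrightarrow> \<exists>m\<in>M. f (x \<otimes>\<^bsub>G\<^esub> y) = m \<otimes>\<^bsub>H\<^esub> (f x \<otimes>\<^bsub>H\<^esub> f y)"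
    and f_ker: "n \<in> N \<Longrightarrow> f n \<in> M"
begin

lemma f_closed: "x \<in> carrier G \<Longrightarrow> f x \<in> carrier H"
  using measurable_space[OF f, of x] by simp

lemma f_ker_mult:
  assumes "n \<in> N" "t \<in> carrier G"
  obtains m where "m \<in> M" "f (n \<otimes>\<^bsub>G\<^esub> t) = m \<otimes>\<^bsub>H\<^esub> f t"
proof -
  obtain m where m: "m \<in> M" "f (n \<otimes>\<^bsub>G\<^esub> t) = m \<otimes>\<^bsub>H\<^esub> (f n \<otimes>\<^bsub>H\<^esub> f t)"
    using f_mult[OF G.NG[OF assms(1)] assms(2)] by blast
  have "f (n \<otimes>\<^bsub>G\<^esub> t) = (m \<otimes>\<^bsub>H\<^esub> f n) \<otimes>\<^bsub>H\<^esub> f t"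
    using m H.NG[OF m(1)] H.NG[OF f_ker[OF assms(1)]] f_closed[OF assms(2)] by (simp add: H.m_assoc)
  moreover have "m \<otimes>\<^bsub>H\<^esub> f n \<in> M" using subgroup.m_closed[OF H.N(1) m(1) f_ker[OF assms(1)]] .
  ultimately show ?thesis using that by blast
qed

lemma exceptional_set:
  shows "\<exists>E. meager TG E \<and>
    (\<forall>W. openin TH W \<longrightarrow> (\<exists>U. openin TG U \<and> (\<forall>x\<in>carrier G - E. f x \<in> W \<longleftrightarrow> x \<in> U)))"
proof -
  have bp: "baire_property TG {x \<in> topspace TG. f x \<in> W}" if "openin TH W" for W
  proof -
    have "f -` W \<inter> space (borel_of TG) \<in> sets (borel_of TG)"
      by (rule measurable_sets[OF f openin_borel_of[OF that]])
    moreover have "f -` W \<inter> space (borel_of TG) = {x \<in> topspace TG. f x \<in> W}" by auto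
    ultimately show ?thesis using borel_baire_property by metis
  qed
  show ?thesis
    by (rule baire_measurable_continuous_off_meager[OF H.second_countable bp]) auto
qed

text \<open>All of \<open>\<sigma> k \<otimes> t\<close> and \<open>x \<otimes> t\<close> avoid
  \<open>E\<close>, where preimages of open sets are relatively open, so \<open>f\<close> passes to
  the limit along them. The factor \<open>c\<close> will be the inverse of \<open>f t\<close> for
  the closure of \<open>M\<close>, and the inverse of \<open>f (\<sigma> 0 \<otimes> t)\<close> for
  the first Solecki subgroup.\<close>

lemma lift_limit:
  assumes E: "\<And>W. openin TH W \<Longrightarrow> \<exists>U. openin TG U \<and> (\<forall>x\<in>carrier G - E. f x \<in> W \<longleftrightarrow> x \<in> U)"
    and \<sigma>: "range \<sigma> \<subseteq> carrier G" "limitin TG \<sigma> x sequentially"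
    and t: "t \<in> carrier G" "\<And>a. a \<in> insert x (range \<sigma>) \<Longrightarrow> a \<otimes>\<^bsub>G\<^esub> t \<notin> E"
    and c: "c \<in> carrier H" and A: "\<And>k. f (\<sigma> k \<otimes>\<^bsub>G\<^esub> t) \<otimes>\<^bsub>H\<^esub> c \<in> A"
  shows "f (x \<otimes>\<^bsub>G\<^esub> t) \<otimes>\<^bsub>H\<^esub> c \<in> TH closure_of A"
  unfolding in_closure_of
proof (intro conjI allI impI)
  have xG: "x \<in> carrier G" using limitin_topspace[OF \<sigma>(2)] by simp
  have sG: "\<sigma> k \<in> carrier G" for k using \<sigma>(1) by auto
  show "f (x \<otimes>\<^bsub>G\<^esub> t) \<otimes>\<^bsub>H\<^esub> c \<in> topspace TH" using xG t(1) c f_closed by simp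
  fix W assume W: "f (x \<otimes>\<^bsub>G\<^esub> t) \<otimes>\<^bsub>H\<^esub> c \<in> W \<and> openin TH W"
  let ?W = "{y \<in> topspace TH. y \<otimes>\<^bsub>H\<^esub> c \<in> W}"
  have "openin TH ?W"
    by (rule openin_continuous_map_preimage[OF H.continuous_map_rtranslate[OF c]]) (use W in simp)
  then obtain U where U: "openin TG U" "\<And>y. y \<in> carrier G - E \<Longrightarrow> f y \<in> ?W \<longleftrightarrow> y \<in> U"
    using E[of ?W] by fast
  have "x \<otimes>\<^bsub>G\<^esub> t \<in> carrier G - E" using t(1) t(2)[of x] xG by simp
  from U(2)[OF this] have "x \<otimes>\<^bsub>G\<^esub> t \<in> U" using W f_closed[of "x \<otimes>\<^bsub>G\<^esub> t"] xG t(1) by simp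
  moreover have "limitin TG (\<lambda>k. \<sigma> k \<otimes>\<^bsub>G\<^esub> t) (x \<otimes>\<^bsub>G\<^esub> t) sequentially"
    using continuous_map_limit[OF G.continuous_map_rtranslate[OF t(1)] \<sigma>(2)] by (simp add: o_def)
  ultimately have "\<forall>\<^sub>F k in sequentially. \<sigma> k \<otimes>\<^bsub>G\<^esub> t \<in> U" using U(1) by (simp add: limitin_def)
  then obtain k where k: "\<sigma> k \<otimes>\<^bsub>G\<^esub> t \<in> U" by (auto simp: eventually_sequentially)
  have "\<sigma> k \<otimes>\<^bsub>G\<^esub> t \<in> carrier G - E" using t(1) t(2)[of "\<sigma> k"] sG by simp
  from U(2)[OF this] have "f (\<sigma> k \<otimes>\<^bsub>G\<^esub> t) \<otimes>\<^bsub>H\<^esub> c \<in> W" using k by simp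
  then show "\<exists>y. y \<in> A \<and> y \<in> W" using A by blast
qed

text \<open>Along the sequence \<open>f (\<sigma> k \<otimes> t)\<close> divided by
  \<open>f t\<close> lies in \<open>M\<close>, so its limit lies in the closure of \<open>M\<close>.
  That limit agrees with \<open>f x\<close> up to a factor in \<open>M\<close>, which the closure
  absorbs because it is a subgroup.\<close>

lemma lift_closure:
  assumes x: "x \<in> TG closure_of N"
  shows "f x \<in> TH closure_of M"
proof -
  obtain E where E: "meager TG E"
    "\<And>W. openin TH W \<Longrightarrow> \<exists>U. openin TG U \<and> (\<forall>x\<in>carrier G - E. f x \<in> W \<longleftrightarrow> x \<in> U)"
    using exceptional_set by (elim exE conjE) blast
  obtain \<sigma> where \<sigma>: "range \<sigma> \<subseteq> N" "limitin TG \<sigma> x sequentially"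
    by (rule metrizable_closure_of_sequence[OF G.metrizable x])
  have xG: "x \<in> carrier G" using limitin_topspace[OF \<sigma>(2)] by simp
  have sN: "\<sigma> k \<in> N" for k using \<sigma>(1) by auto
  have sG: "range \<sigma> \<subseteq> carrier G" using G.NG[OF sN] by auto
  obtain t where t: "t \<in> carrier G" "\<And>a. a \<in> insert x (range \<sigma>) \<Longrightarrow> a \<otimes>\<^bsub>G\<^esub> t \<notin> E"
  proof (rule G.generic_translates[OF E(1) meager_empty, of "topspace TG" "insert x (range \<sigma>)"])
    show "insert x (range \<sigma>) \<subseteq> carrier G" using sG xG by auto
    show "openin TG (topspace TG)" by (rule openin_topspace)
  qed (use G.one_closed in auto)
  have ft: "f t \<in> carrier H" "f x \<in> carrier H" using f_closed t(1) xG by auto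
  have "f (x \<otimes>\<^bsub>G\<^esub> t) \<otimes>\<^bsub>H\<^esub> inv\<^bsub>H\<^esub> (f t) \<in> TH closure_of M"
  proof (rule lift_limit[OF E(2) sG \<sigma>(2) t])
    fix k
    obtain m where m: "m \<in> M" "f (\<sigma> k \<otimes>\<^bsub>G\<^esub> t) = m \<otimes>\<^bsub>H\<^esub> f t" by (rule f_ker_mult[OF sN t(1)])
    then show "f (\<sigma> k \<otimes>\<^bsub>G\<^esub> t) \<otimes>\<^bsub>H\<^esub> inv\<^bsub>H\<^esub> (f t) \<in> M" using H.NG[OF m(1)] ft by (simp add: H.m_assoc)
  qed (use ft in simp_all)
  moreover obtain m where m: "m \<in> M" "f (x \<otimes>\<^bsub>G\<^esub> t) = m \<otimes>\<^bsub>H\<^esub> (f x \<otimes>\<^bsub>H\<^esub> f t)"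
    using f_mult[OF xG t(1)] by blast
  moreover have "(m \<otimes>\<^bsub>H\<^esub> (f x \<otimes>\<^bsub>H\<^esub> f t)) \<otimes>\<^bsub>H\<^esub> inv\<^bsub>H\<^esub> (f t) = m \<otimes>\<^bsub>H\<^esub> f x"
    using H.NG[OF m(1)] ft by (simp add: H.m_assoc)
  ultimately have mf: "m \<otimes>\<^bsub>H\<^esub> f x \<in> TH closure_of M" by simp
  have cl: "subgroup (TH closure_of M) H" by (rule H.subgroup_closure_of[OF H.N(1)])
  have "m \<in> TH closure_of M" using m(1) closure_of_subset[of M TH] H.NG by auto
  then have "inv\<^bsub>H\<^esub> m \<otimes>\<^bsub>H\<^esub> (m \<otimes>\<^bsub>H\<^esub> f x) \<in> TH closure_of M"
    by (intro subgroup.m_closed[OF cl] subgroup.m_inv_closed[OF cl] mf)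
  then show ?thesis using H.NG[OF m(1)] ft by simp
qed

text \<open>Covering \<open>M\<close> by countably many translates of a small \<open>U'\<close> gives, by the Baire category theorem
  in \<open>G\<close> and then in \<open>N\<close>, a single translate \<open>m U'\<close> and open set \<open>O\<close> such that the \<open>n \<in> N\<close> with
  \<open>f (n t) f(t)\<^sup>-\<^sup>1 \<in> m U'\<close> for generic \<open>t \<in> O\<close> are dense in an open subset of \<open>N\<close>. The
  generic continuity of \<open>f\<close> then transfers this to the closure in \<open>G\<close>.\<close>

lemma lift_solecki_closure:
  assumes x: "x \<in> G.solecki_closure"
  shows "f x \<in> H.solecki_closure"
  unfolding H.solecki_closure_def
proof (rule INT_I)
  interpret M: abelian_polish "H\<lparr>carrier := M\<rparr>" TM by (rule abelian_polishI[OF polishing_topologyD(1)[OF H.TN]])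
  interpret N: abelian_polish "G\<lparr>carrier := N\<rparr>" TN by (rule abelian_polishI[OF polishing_topologyD(1)[OF G.TN]])
  fix U assume "U \<in> {V. openin TM V \<and> \<one>\<^bsub>H\<^esub> \<in> V}"
  then have U: "openin TM U" "\<one>\<^bsub>H\<^esub> \<in> U" by auto
  have UH: "U \<subseteq> carrier H" using openin_subset[OF U(1)] H.NG by auto
  \<comment> \<open>Only quotients \<open>u \<otimes> inv v\<close> of elements of \<open>U'\<close>
    are used; the third factor is spent on the identity.\<close>
  obtain U' where U': "openin TM U'" "\<one>\<^bsub>H\<^esub> \<in> U'" "\<forall>x\<in>U'. inv\<^bsub>H\<lparr>carrier := M\<rparr>\<^esub> x \<in> U'"
      "\<forall>x\<in>U'. \<forall>y\<in>U'. \<forall>z\<in>U'. x \<otimes>\<^bsub>H\<^esub> (y \<otimes>\<^bsub>H\<^esub> z) \<in> U"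
    using M.one_nhd_cube[of U] U by auto
  have U'M: "u \<in> M" if "u \<in> U'" for u using openin_subset[OF U'(1)] that by auto
  have U'inv: "inv\<^bsub>H\<^esub> u \<in> U'" if "u \<in> U'" for u
    using U'(3) that H.m_inv_consistent[OF H.N(1) U'M[OF that]] by auto
  have U'diff: "u \<otimes>\<^bsub>H\<^esub> inv\<^bsub>H\<^esub> v \<in> U" if uv: "u \<in> U'" "v \<in> U'" for u v
  proof -
    have "u \<otimes>\<^bsub>H\<^esub> (inv\<^bsub>H\<^esub> v \<otimes>\<^bsub>H\<^esub> \<one>\<^bsub>H\<^esub>) \<in> U" using U'(4) uv(1) U'inv[OF uv(2)] U'(2) by blast
    then show ?thesis using H.NG[OF U'M[OF uv(2)]] by simp
  qed
  obtain D where D: "countable D" "D \<subseteq> M" "TM closure_of D = M"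
    using M.separable unfolding separable_space_def by auto
  \<comment> \<open>A point \<open>m\<close> of \<open>D\<close> in the neighbourhood
    \<open>y U'\<close> gives \<open>inv m \<otimes> y\<close> in \<open>U'\<close> by symmetry, so
    countably many translates \<open>m U'\<close> cover \<open>M\<close>.\<close>
  have cover: "\<exists>m\<in>D. inv\<^bsub>H\<^esub> m \<otimes>\<^bsub>H\<^esub> y \<in> U'" if y: "y \<in> M" for y
  proof -
    have "openin TM ((\<lambda>u. y \<otimes>\<^bsub>H\<^esub> u) ` U')" using M.openin_translate[of y U'] y U'(1) by simp
    moreover have "y \<otimes>\<^bsub>H\<^esub> \<one>\<^bsub>H\<^esub> \<in> (\<lambda>u. y \<otimes>\<^bsub>H\<^esub> u) ` U'" using U'(2) by (rule imageI)
    then have "y \<in> (\<lambda>u. y \<otimes>\<^bsub>H\<^esub> u) ` U'" using H.NG[OF y] by simp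
    moreover have "y \<in> TM closure_of D" using y D(3) by simp
    ultimately obtain m where m: "m \<in> D" "m \<in> (\<lambda>u. y \<otimes>\<^bsub>H\<^esub> u) ` U'" unfolding in_closure_of by blast
    then obtain u where u: "u \<in> U'" "m = y \<otimes>\<^bsub>H\<^esub> u" by auto
    have "inv\<^bsub>H\<^esub> m \<otimes>\<^bsub>H\<^esub> y = inv\<^bsub>H\<^esub> u"
    proof -
      have "inv\<^bsub>H\<^esub> m = inv\<^bsub>H\<^esub> u \<otimes>\<^bsub>H\<^esub> inv\<^bsub>H\<^esub> y"
        using u(2) H.NG[OF y] H.NG[OF U'M[OF u(1)]] by (simp add: H.inv_mult H.m_comm)
      then show ?thesis using H.NG[OF y] H.NG[OF U'M[OF u(1)]] by (simp add: H.m_assoc)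
    qed
    then show ?thesis using m(1) U'inv[OF u(1)] by (intro bexI[of _ m]) auto
  qed
  define \<psi> where "\<psi> n t = f (n \<otimes>\<^bsub>G\<^esub> t) \<otimes>\<^bsub>H\<^esub> inv\<^bsub>H\<^esub> (f t)" for n t
  have \<psi>M: "\<psi> n t \<in> M" if nt: "n \<in> N" "t \<in> carrier G" for n t
  proof -
    obtain m where m: "m \<in> M" "f (n \<otimes>\<^bsub>G\<^esub> t) = m \<otimes>\<^bsub>H\<^esub> f t" by (rule f_ker_mult[OF nt])
    then show ?thesis unfolding \<psi>_def using H.NG[OF m(1)] f_closed[OF nt(2)] by (simp add: H.m_assoc)
  qed
  define P where "P n m = {t \<in> carrier G. inv\<^bsub>H\<^esub> m \<otimes>\<^bsub>H\<^esub> \<psi> n t \<in> U'}" for n m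
  \<comment> \<open>The translate \<open>m U'\<close> is open only in \<open>M\<close>; that it is
    nevertheless Borel in \<open>TH\<close> is what the measurability of \<open>\<psi> n\<close> can
    use.\<close>
  have P_borel: "P n m \<in> sets (borel_of TG)" if nm: "n \<in> N" "m \<in> M" for n m
  proof -
    have "(\<lambda>t. f (n \<otimes>\<^bsub>G\<^esub> t)) \<in> borel_of TG \<rightarrow>\<^sub>M borel_of TH"
      by (rule measurable_compose[OF continuous_map_measurable[OF G.continuous_map_translate[OF G.NG[OF nm(1)]]] f])
    then have \<psi>: "\<psi> n \<in> borel_of TG \<rightarrow>\<^sub>M borel_of TH" unfolding \<psi>_def by (rule H.measurable_diff[OF _ f])
    have "openin TM ((\<lambda>u. m \<otimes>\<^bsub>H\<^esub> u) ` U')" using M.openin_translate[of m U'] nm(2) U'(1) by simp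
    then have "\<psi> n -` ((\<lambda>u. m \<otimes>\<^bsub>H\<^esub> u) ` U') \<inter> space (borel_of TG) \<in> sets (borel_of TG)"
      by (intro measurable_sets[OF \<psi>] polishing_topologyD(2)[OF H.TN])
    moreover have "\<psi> n -` ((\<lambda>u. m \<otimes>\<^bsub>H\<^esub> u) ` U') \<inter> space (borel_of TG) = P n m"
    proof (intro equalityI subsetI)
      fix t assume "t \<in> \<psi> n -` ((\<lambda>u. m \<otimes>\<^bsub>H\<^esub> u) ` U') \<inter> space (borel_of TG)"
      then obtain u where u: "u \<in> U'" "\<psi> n t = m \<otimes>\<^bsub>H\<^esub> u" "t \<in> carrier G" by auto
      then show "t \<in> P n m" unfolding P_def using H.NG[OF nm(2)] H.NG[OF U'M[OF u(1)]] by simp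
    next
      fix t assume t: "t \<in> P n m"
      then have tG: "t \<in> carrier G" by (simp add: P_def)
      have "m \<otimes>\<^bsub>H\<^esub> (inv\<^bsub>H\<^esub> m \<otimes>\<^bsub>H\<^esub> \<psi> n t) \<in> (\<lambda>u. m \<otimes>\<^bsub>H\<^esub> u) ` U'"
        using t unfolding P_def by (intro imageI) simp
      then show "t \<in> \<psi> n -` ((\<lambda>u. m \<otimes>\<^bsub>H\<^esub> u) ` U') \<inter> space (borel_of TG)"
        using H.NG[OF nm(2)] H.NG[OF \<psi>M[OF nm(1) tG]] tG by simp
    qed
    ultimately show ?thesis by simp
  qed
  obtain \<B> where \<B>: "countable \<B>" "\<And>V. V \<in> \<B> \<Longrightarrow> openin TG V"
    "\<And>U x. openin TG U \<Longrightarrow> x \<in> U \<Longrightarrow> \<exists>V\<in>\<B>. x \<in> V \<and> V \<subseteq> U"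
    using G.second_countable by (auto simp: second_countable_def)
  define L where "L V m = {n \<in> N. meager TG (V - P n m)}" for V m
  \<comment> \<open>For fixed \<open>n\<close> the countably many Borel sets \<open>P n m\<close>
    cover \<open>G\<close>, so one of them is comeager in a nonempty open set. Shrinking that set to
    a basic \<open>V\<close> leaves countably many pairs \<open>(V, m)\<close> for all
    \<open>n\<close> together.\<close>
  have LN: "\<exists>V\<in>\<B> - {{}}. \<exists>m\<in>D. n \<in> L V m" if n: "n \<in> N" for n
  proof -
    have "carrier G \<subseteq> (\<Union>m\<in>D. P n m)"
    proof
      fix t assume t: "t \<in> carrier G"
      obtain m where "m \<in> D" "inv\<^bsub>H\<^esub> m \<otimes>\<^bsub>H\<^esub> \<psi> n t \<in> U'" using cover[OF \<psi>M[OF n t]] by blast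
      then show "t \<in> (\<Union>m\<in>D. P n m)" using t by (auto simp: P_def)
    qed
    moreover have "\<not> meager TG (carrier G)"
      using Baire_open_not_meager[OF G.completely_metrizable openin_topspace] G.one_closed by auto
    ultimately have "\<not> meager TG (\<Union>m\<in>D. P n m)" using meager_subset by blast
    then obtain m where m: "m \<in> D" "\<not> meager TG (P n m)" using meager_UN[OF D(1)] by blast
    have "baire_property TG (P n m)" using P_borel[OF n] m(1) D(2) by (intro borel_baire_property) auto
    then obtain O' where O': "openin TG O'" "O' \<noteq> {}" "meager TG (O' - P n m)"
      using m(2) by (rule baire_property_nonmeager)
    then obtain y where "y \<in> O'" by blast
    then obtain V where V: "V \<in> \<B>" "y \<in> V" "V \<subseteq> O'" using \<B>(3)[OF O'(1)] by blast
    have "meager TG (V - P n m)" by (rule meager_subset[OF O'(3)]) (use V(3) in auto)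
    then have "n \<in> L V m" using n by (simp add: L_def)
    then show ?thesis using V(1,2) m(1) by blast
  qed
  \<comment> \<open>The countably many sets \<open>L V m\<close> cover \<open>N\<close>, which is
    not meager in its own Polish topology, so one of them is somewhere dense there.\<close>
  have "\<exists>V\<in>\<B> - {{}}. \<exists>m\<in>D. TN interior_of (TN closure_of (L V m)) \<noteq> {}"
  proof (rule ccontr)
    assume neg: "\<not> ?thesis"
    have "meager TN (L V m)" if "V \<in> \<B> - {{}}" "m \<in> D" for V m
    proof (rule meager_nowhere_dense)
      show "TN interior_of (TN closure_of (L V m)) = {}" using neg that by blast
      show "L V m \<subseteq> topspace TN" by (auto simp: L_def)
    qed
    then have "meager TN (\<Union>V\<in>\<B> - {{}}. \<Union>m\<in>D. L V m)"
      using \<B>(1) D(1) by (intro meager_UN) auto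
    then have "meager TN N" by (rule meager_subset) (use LN in blast)
    moreover have "\<not> meager TN N"
      using Baire_open_not_meager[OF N.completely_metrizable openin_topspace] N.one_closed by auto
    ultimately show False by simp
  qed
  then obtain V m where V: "V \<in> \<B>" "V \<noteq> {}" and m: "m \<in> D" and
    ne: "TN interior_of (TN closure_of (L V m)) \<noteq> {}" by blast
  define Q where "Q = TN interior_of (TN closure_of (L V m))"
  have Q: "openin TN Q" "Q \<subseteq> TN closure_of (L V m)" unfolding Q_def by (auto simp: interior_of_subset)
  have QN: "Q \<subseteq> N" using openin_subset[OF Q(1)] by simp
  obtain n1 where n1: "n1 \<in> Q" using ne Q_def by blast
  have n1N: "n1 \<in> N" using n1 QN by blast
  have n1i: "inv\<^bsub>G\<^esub> n1 \<in> N" using subgroup.m_inv_closed[OF G.N(1) n1N] .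
  \<comment> \<open>Moved back to the identity, \<open>Q\<close> becomes one of the neighbourhoods
    in the intersection defining \<open>solecki_closure\<close>. This places \<open>x\<close> in the
    closure of a translate \<open>w Q\<close> with \<open>w\<close> in \<open>N\<close>.\<close>
  let ?V = "(\<lambda>y. inv\<^bsub>G\<^esub> n1 \<otimes>\<^bsub>G\<^esub> y) ` Q"
  have "openin TN ?V" using N.openin_translate[of "inv\<^bsub>G\<^esub> n1" Q] n1i Q(1) by simp
  moreover have "inv\<^bsub>G\<^esub> n1 \<otimes>\<^bsub>G\<^esub> n1 \<in> ?V" using n1 by (rule imageI)
  then have "\<one>\<^bsub>G\<^esub> \<in> ?V" using G.NG[OF n1N] by simp
  ultimately have "?V \<in> {V. openin TN V \<and> \<one>\<^bsub>G\<^esub> \<in> V}" by simp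
  then obtain z where z: "z \<in> N" "x \<in> TG closure_of (z <#\<^bsub>G\<^esub> ?V)"
    using x unfolding G.solecki_closure_def by blast
  define w where "w = z \<otimes>\<^bsub>G\<^esub> inv\<^bsub>G\<^esub> n1"
  have wN: "w \<in> N" unfolding w_def using subgroup.m_closed[OF G.N(1) z(1) n1i] .
  have "z <#\<^bsub>G\<^esub> ?V = (\<lambda>y. w \<otimes>\<^bsub>G\<^esub> y) ` Q"
    unfolding G.l_coset_image image_image w_def
    by (rule image_cong) (use G.NG[OF z(1)] G.NG[OF n1i] G.NG QN in \<open>auto simp: G.m_assoc\<close>)
  then have "x \<in> (\<lambda>y. w \<otimes>\<^bsub>G\<^esub> y) ` (TG closure_of Q)"
    using z(2) G.closure_translate[OF G.NG[OF wN], of Q] QN G.NG by auto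
  then obtain x' where x': "x' \<in> TG closure_of Q" "x = w \<otimes>\<^bsub>G\<^esub> x'" by blast
  have "Q \<subseteq> TG closure_of (L V m)"
    using Q(2) continuous_map_image_closure_subset[OF G.TN_inclusion, of "L V m"] by auto
  then have "TG closure_of Q \<subseteq> TG closure_of (TG closure_of (L V m))" by (rule closure_of_mono)
  then have x'L: "x' \<in> TG closure_of (L V m)" using x'(1) by auto
  obtain \<sigma> where \<sigma>: "range \<sigma> \<subseteq> L V m" "limitin TG \<sigma> x' sequentially"
    by (rule metrizable_closure_of_sequence[OF G.metrizable x'L])
  have x'G: "x' \<in> carrier G" using limitin_topspace[OF \<sigma>(2)] by simp
  have sL: "\<sigma> k \<in> N" "meager TG (V - P (\<sigma> k) m)" for k using \<sigma>(1) by (auto simp: L_def)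
  have sG: "range \<sigma> \<subseteq> carrier G" using G.NG[OF sL(1)] by auto
  obtain E where E: "meager TG E"
    "\<And>W. openin TH W \<Longrightarrow> \<exists>U. openin TG U \<and> (\<forall>x\<in>carrier G - E. f x \<in> W \<longleftrightarrow> x \<in> U)"
    using exceptional_set by (elim exE conjE) blast
  have mg: "meager TG (\<Union>k. V - P (\<sigma> k) m)" by (rule meager_UN) (auto simp: sL(2))
  have ctb: "countable (insert x' (range \<sigma>))" by simp
  have insG: "insert x' (range \<sigma>) \<subseteq> carrier G" using x'G sG by auto
  \<comment> \<open>Countably many generic conditions on one \<open>t\<close> in \<open>V\<close>:
    it lies in \<open>P (\<sigma> k) m\<close> for all \<open>k\<close>, and its translates by
    \<open>x'\<close> and all \<open>\<sigma> k\<close> avoid \<open>E\<close>.\<close>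
  obtain t where t: "t \<in> V" "t \<notin> (\<Union>k. V - P (\<sigma> k) m)" "\<And>a. a \<in> insert x' (range \<sigma>) \<Longrightarrow> a \<otimes>\<^bsub>G\<^esub> t \<notin> E"
    by (rule G.generic_translates[OF E(1) mg \<B>(2)[OF V(1)] V(2) ctb insG]) blast
  have tG: "t \<in> carrier G" using t(1) openin_subset[OF \<B>(2)[OF V(1)]] by auto
  have tP: "inv\<^bsub>H\<^esub> m \<otimes>\<^bsub>H\<^esub> \<psi> (\<sigma> k) t \<in> U'" for k using t(1,2) by (auto simp: P_def)
  have mM: "m \<in> M" using m D(2) by blast
  define c where "c = inv\<^bsub>H\<^esub> (f (\<sigma> 0 \<otimes>\<^bsub>G\<^esub> t))"
  have fs: "f (\<sigma> k \<otimes>\<^bsub>G\<^esub> t) \<in> carrier H" for k using f_closed G.NG[OF sL(1)] tG by simp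
  have ft: "f t \<in> carrier H" "f x' \<in> carrier H" "f x \<in> carrier H" "f w \<in> carrier H"
    using f_closed tG x'G G.NG[OF wN] x'(2) by auto
  have y: "f (x' \<otimes>\<^bsub>G\<^esub> t) \<otimes>\<^bsub>H\<^esub> c \<in> TH closure_of U"
  proof (rule lift_limit[OF E(2) sG \<sigma>(2) tG t(3)])
    show "c \<in> carrier H" using fs by (simp add: c_def)
    fix k
    have "(inv\<^bsub>H\<^esub> m \<otimes>\<^bsub>H\<^esub> \<psi> (\<sigma> k) t) \<otimes>\<^bsub>H\<^esub> inv\<^bsub>H\<^esub> (inv\<^bsub>H\<^esub> m \<otimes>\<^bsub>H\<^esub> \<psi> (\<sigma> 0) t) \<in> U"
      by (rule U'diff[OF tP tP])
    \<comment> \<open>Dividing by the value at the reference index \<open>0\<close> cancels both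
      \<open>m\<close> and \<open>f t\<close>. The chain of products in the proof only brings every
      inverse next to its factor.\<close>
    moreover have "(inv\<^bsub>H\<^esub> m \<otimes>\<^bsub>H\<^esub> \<psi> (\<sigma> k) t) \<otimes>\<^bsub>H\<^esub> inv\<^bsub>H\<^esub> (inv\<^bsub>H\<^esub> m \<otimes>\<^bsub>H\<^esub> \<psi> (\<sigma> 0) t)
        = f (\<sigma> k \<otimes>\<^bsub>G\<^esub> t) \<otimes>\<^bsub>H\<^esub> c"
    proof -
      define a b where "a = f (\<sigma> k \<otimes>\<^bsub>G\<^esub> t)" and "b = f (\<sigma> 0 \<otimes>\<^bsub>G\<^esub> t)"
      have ab: "a \<in> carrier H" "b \<in> carrier H" "m \<in> carrier H" using fs H.NG[OF mM] by (auto simp: a_def b_def)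
      have "(inv\<^bsub>H\<^esub> m \<otimes>\<^bsub>H\<^esub> (a \<otimes>\<^bsub>H\<^esub> inv\<^bsub>H\<^esub> (f t))) \<otimes>\<^bsub>H\<^esub> inv\<^bsub>H\<^esub> (inv\<^bsub>H\<^esub> m \<otimes>\<^bsub>H\<^esub> (b \<otimes>\<^bsub>H\<^esub> inv\<^bsub>H\<^esub> (f t)))
        = inv\<^bsub>H\<^esub> m \<otimes>\<^bsub>H\<^esub> (m \<otimes>\<^bsub>H\<^esub> (inv\<^bsub>H\<^esub> (f t) \<otimes>\<^bsub>H\<^esub> (f t \<otimes>\<^bsub>H\<^esub> (a \<otimes>\<^bsub>H\<^esub> inv\<^bsub>H\<^esub> b))))"
        using ab ft(1) by (simp only: H.inv_mult H.inv_inv H.m_ac H.inv_closed H.m_closed)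
      also have "\<dots> = a \<otimes>\<^bsub>H\<^esub> inv\<^bsub>H\<^esub> b" using ab ft(1) by simp
      finally show ?thesis by (simp add: \<psi>_def c_def a_def b_def)
    qed
    ultimately show "f (\<sigma> k \<otimes>\<^bsub>G\<^esub> t) \<otimes>\<^bsub>H\<^esub> c \<in> U" by simp
  qed
  define v where "v = f (x' \<otimes>\<^bsub>G\<^esub> t) \<otimes>\<^bsub>H\<^esub> c"
  obtain m1 where m1: "m1 \<in> M" "f x = m1 \<otimes>\<^bsub>H\<^esub> f x'"
    using f_ker_mult[OF wN x'G] unfolding x'(2)[symmetric] by blast
  obtain m2 where m2: "m2 \<in> M" "f (x' \<otimes>\<^bsub>G\<^esub> t) = m2 \<otimes>\<^bsub>H\<^esub> (f x' \<otimes>\<^bsub>H\<^esub> f t)"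
    using f_mult[OF x'G tG] by blast
  obtain m3 where m3: "m3 \<in> M" "f (\<sigma> 0 \<otimes>\<^bsub>G\<^esub> t) = m3 \<otimes>\<^bsub>H\<^esub> f t" by (rule f_ker_mult[OF sL(1) tG])
  \<comment> \<open>Here \<open>v\<close> equals \<open>m2 \<otimes> inv m3 \<otimes> f x'\<close>,
    while \<open>f x\<close> is \<open>m1 \<otimes> f x'\<close>; \<open>m4\<close> is the quotient
    of the two.\<close>
  define m4 where "m4 = m1 \<otimes>\<^bsub>H\<^esub> (inv\<^bsub>H\<^esub> m2 \<otimes>\<^bsub>H\<^esub> m3)"
  have m4M: "m4 \<in> M" unfolding m4_def
    using subgroup.m_closed[OF H.N(1)] subgroup.m_inv_closed[OF H.N(1)] m1(1) m2(1) m3(1) by simp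
  have mH: "m1 \<in> carrier H" "m2 \<in> carrier H" "m3 \<in> carrier H" using H.NG m1(1) m2(1) m3(1) by auto
  have "m4 \<otimes>\<^bsub>H\<^esub> v = f x"
  proof -
    have "m4 \<otimes>\<^bsub>H\<^esub> v = inv\<^bsub>H\<^esub> m2 \<otimes>\<^bsub>H\<^esub> (m2 \<otimes>\<^bsub>H\<^esub> (inv\<^bsub>H\<^esub> m3 \<otimes>\<^bsub>H\<^esub> (m3 \<otimes>\<^bsub>H\<^esub> (inv\<^bsub>H\<^esub> (f t) \<otimes>\<^bsub>H\<^esub> (f t \<otimes>\<^bsub>H\<^esub> (m1 \<otimes>\<^bsub>H\<^esub> f x'))))))"
      unfolding m4_def v_def c_def m2(2) m3(2)
      using mH ft by (simp only: H.inv_mult H.inv_inv H.m_ac H.inv_closed H.m_closed)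
    also have "\<dots> = m1 \<otimes>\<^bsub>H\<^esub> f x'" using mH ft by simp
    finally show ?thesis using m1(2) by simp
  qed
  moreover have "m4 \<otimes>\<^bsub>H\<^esub> v \<in> (\<lambda>y. m4 \<otimes>\<^bsub>H\<^esub> y) ` (TH closure_of U)" using y unfolding v_def by (rule imageI)
  ultimately have "f x \<in> TH closure_of (m4 <#\<^bsub>H\<^esub> U)"
    unfolding H.l_coset_image H.closure_translate[OF H.NG[OF m4M] UH] by simp
  then show "f x \<in> (\<Union>z\<in>M. TH closure_of (z <#\<^bsub>H\<^esub> U))" using m4M by blast
qed

end

section \<open>Subcovers\<close>

lemma countable_ordinal_rep:
  fixes y :: countable_ordinal
  obtains s where "(s, s) \<in> ordIso" "y = abs_countable_ordinal s"
  by (metis Quotient_abs_rep[OF Quotient_countable_ordinal] Quotient_rep_reflp[OF Quotient_countable_ordinal])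

text \<open>A smaller ordinal is the order type of an initial segment of a representative on
  \<open>nat\<close>, determined by the element that cuts it off. This turns the intersection at a
  limit stage into a countable one.\<close>

lemma countable_initial_segment:
  fixes \<alpha> :: countable_ordinal
  shows "countable {..<\<alpha>}"
proof -
  obtain r where r: "(r, r) \<in> ordIso" "\<alpha> = abs_countable_ordinal r" by (rule countable_ordinal_rep)
  have wr: "Well_order r" using r(1) unfolding ordIso_def by auto
  have "{..<\<alpha>} \<subseteq> range (\<lambda>a. abs_countable_ordinal (Restr r (underS r a)))"
  proof
    fix y assume y: "y \<in> {..<\<alpha>}"
    obtain s where s: "(s, s) \<in> ordIso" "y = abs_countable_ordinal s" by (rule countable_ordinal_rep)
    have "(s, r) \<in> ordLess" using y s r by (simp add: less_countable_ordinal.abs_eq)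
    moreover have "Well_order s" using s(1) unfolding ordIso_def by auto
    ultimately obtain a where a: "(s, Restr r (underS r a)) \<in> ordIso"
      using ordLess_iff_ordIso_Restr[OF wr] by blast
    then have "y = abs_countable_ordinal (Restr r (underS r a))"
      unfolding s(2) by (rule Quotient_rel_abs[OF Quotient_countable_ordinal])
    then show "y \<in> range (\<lambda>a. abs_countable_ordinal (Restr r (underS r a)))" by blast
  qed
  then show ?thesis by (rule countable_subset) simp
qed

text \<open>\<open>subcover G S\<close> and \<open>G\<lparr>carrier := S\<rparr>\<close> are
  different records, as the former also changes \<open>cover_top\<close>; the group notions see only
  carrier, product and unit.\<close>

lemma group_ops_cong:
  assumes "carrier G = carrier G'" "mult G = mult G'" "one G = one G'"
  shows "comm_group G \<longleftrightarrow> comm_group G'" "m_inv G = m_inv G'" "subgroup A G \<longleftrightarrow> subgroup A G'"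
proof -
  show inv: "m_inv G = m_inv G'" by (intro ext) (simp add: m_inv_def assms)
  show "comm_group G \<longleftrightarrow> comm_group G'"
    unfolding comm_group_def group_def group_axioms_def comm_monoid_def comm_monoid_axioms_def monoid_def Units_def
    by (simp add: assms)
  show "subgroup A G \<longleftrightarrow> subgroup A G'" unfolding subgroup_def by (simp add: assms inv)
qed

lemma abelian_polish_group_cong:
  assumes "carrier G = carrier G'" "mult G = mult G'" "one G = one G'"
  shows "abelian_polish_group G T \<longleftrightarrow> abelian_polish_group G' T"
  unfolding abelian_polish_group_def by (simp add: group_ops_cong[OF assms] assms)

lemma non_archimedean_cong:
  assumes "carrier G = carrier G'" "mult G = mult G'" "one G = one G'"
  shows "non_archimedean G T \<longleftrightarrow> non_archimedean G' T"
  unfolding non_archimedean_def by (simp add: group_ops_cong[OF assms] assms)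

lemma subcover_simps [simp]:
  "carrier (subcover G S) = S" "mult (subcover G S) = mult G" "one (subcover G S) = one G"
  "cover_ker (subcover G S) = cover_ker G" "cover_top (subcover G S) = polish_top_of G (cover_top G) S"
  by (simp_all add: subcover_def)

lemma cover_polishable_pair:
  assumes "abelian_polish_cover G"
  shows "polishable_pair G (cover_top G) (cover_ker G) (ker_top G)"
proof -
  have G: "abelian_polish_group G (cover_top G)" "polishable_subgroup G (cover_top G) (cover_ker G)"
    using assms by (simp_all add: abelian_polish_cover_def)
  show ?thesis
    using G polish_top_of_polishing[OF G] abelian_polishI[OF G(1)]
    by (simp add: polishable_pair_def polishable_pair_axioms_def polishable_subgroup_def ker_top_def)
qed

lemma solecki_one_set_eq:
  assumes "abelian_polish_cover G"
  shows "solecki_one_set G = polishable_pair.solecki_closure G (cover_top G) (cover_ker G) (ker_top G)"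
  unfolding solecki_one_set_def polishable_pair.solecki_closure_def[OF cover_polishable_pair[OF assms]] by simp

locale cover_subgroup =
  fixes G :: "'a cover" and S :: "'a set"
  assumes cover: "abelian_polish_cover G" and S: "polishable_subgroup G (cover_top G) S" and ker: "cover_ker G \<subseteq> S"
begin

sublocale pair: polishable_pair G "cover_top G" "cover_ker G" "ker_top G"
  by (rule cover_polishable_pair[OF cover])

abbreviation "TS \<equiv> polish_top_of G (cover_top G) S"

lemma S_sub: "subgroup S G" and S_borel: "S \<in> sets (borel_of (cover_top G))"
  using S by (simp_all add: polishable_subgroup_def)

lemma SG: "x \<in> S \<Longrightarrow> x \<in> carrier G"
  using subgroup.mem_carrier[OF S_sub] .

lemma TS: "polishing_topology G (cover_top G) S TS"
  by (rule polish_top_of_polishing[OF pair.abelian_polish_group S])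

lemma topspace_TS: "topspace TS = S"
  by (rule polishing_topologyD(3)[OF TS])

lemma TS_inclusion: "continuous_map TS (cover_top G) (\<lambda>x. x)"
  by (rule polishing_inclusion_continuous[OF pair.abelian_polish_group S_borel TS])

lemma borel_TS: "A \<in> sets (borel_of (cover_top G)) \<Longrightarrow> A \<inter> S \<in> sets (borel_of TS)"
  by (rule polishing_borel[OF pair.abelian_polish_group S_borel TS])

lemma borel_TS_imp:
  assumes "A \<in> sets (borel_of TS)"
  shows "A \<in> sets (borel_of (cover_top G))"
  using assms unfolding sets_borel_of[of TS] topspace_TS
proof induction
  case (Basic a) then show ?case using polishing_topologyD(2)[OF TS] by simp
next
  case Empty then show ?case by simp
next
  case (Compl a) then show ?case using S_borel by blast
next
  case (Union a) then show ?case by blast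
qed

lemma subcover_group: "abelian_polish_group (subcover G S) TS"
  using polishing_topologyD(1)[OF TS] by (subst abelian_polish_group_cong[of _ "G\<lparr>carrier := S\<rparr>"]) auto

lemma subgroup_subcover_iff: "subgroup A (subcover G S) \<longleftrightarrow> subgroup A G \<and> A \<subseteq> S"
proof -
  have "subgroup A (subcover G S) \<longleftrightarrow> subgroup A (G\<lparr>carrier := S\<rparr>)"
    by (rule group_ops_cong(3)) auto
  then show ?thesis
    using pair.incl_subgroup[OF S_sub] pair.subgroup_incl[OF _ S_sub] subgroup.subset[of A "G\<lparr>carrier := S\<rparr>"] by auto
qed

text \<open>Inside \<open>S\<close> the topologies \<open>TS\<close> and \<open>cover_top G\<close>
  have the same Borel sets, so a Polish topology on \<open>A\<close> can be found in either ambient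
  group. This is what lets the iteration change the ambient group at each stage.\<close>

lemma polishing_subcover_iff:
  assumes "A \<subseteq> S"
  shows "polishing_topology (subcover G S) TS A T' \<longleftrightarrow> polishing_topology G (cover_top G) A T'"
proof -
  have 1: "abelian_polish_group (subcover G S\<lparr>carrier := A\<rparr>) T' \<longleftrightarrow> abelian_polish_group (G\<lparr>carrier := A\<rparr>) T'"
    by (rule abelian_polish_group_cong) auto
  have 2: "U \<in> sets (borel_of TS)" if "U \<in> sets (borel_of (cover_top G))" "topspace T' = A" "openin T' U" for U
    using borel_TS[OF that(1)] openin_subset[OF that(3)] that(2) assms by (simp add: Int_absorb2)
  show ?thesis
    unfolding polishing_topology_def 1
  proof (rule conj_cong[OF refl], rule iff_allI, rule imp_cong[OF refl])
    fix U assume "abelian_polish_group (G\<lparr>carrier := A\<rparr>) T'" and U: "openin T' U"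
    then have "topspace T' = A" by (simp add: abelian_polish_group_def)
    then show "U \<in> sets (borel_of TS) \<longleftrightarrow> U \<in> sets (borel_of (cover_top G))"
      using 2[OF _ _ U] borel_TS_imp by blast
  qed
qed

lemma subcover_cover: "abelian_polish_cover (subcover G S)"
  and ker_top_subcover: "ker_top (subcover G S) = ker_top G"
proof -
  have N: "cover_ker G \<in> sets (borel_of TS)"
    using borel_TS[OF pair.N(2)] ker by (simp add: Int_absorb2)
  have P: "polishing_topology (subcover G S) TS (cover_ker G) (ker_top G)"
    using pair.TN by (simp add: polishing_subcover_iff[OF ker])
  show "abelian_polish_cover (subcover G S)"
    unfolding abelian_polish_cover_def polishable_subgroup_def
    using subcover_group N P pair.N(1) ker by (auto simp: subgroup_subcover_iff)
  show "ker_top (subcover G S) = ker_top G"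
    unfolding ker_top_def[of "subcover G S"] subcover_simps by (rule polish_top_of_eq[OF subcover_group N P])
qed

end

text \<open>The invariant of the transfinite induction. Its last clause is conditional so that one
  induction serves both categories.\<close>

definition good_subgroup :: "'a cover \<Rightarrow> 'a set \<Rightarrow> bool" where
  "good_subgroup G S \<longleftrightarrow> polishable_subgroup G (cover_top G) S \<and> cover_ker G \<subseteq> S \<and>
     (non_archimedean_polish_cover G \<longrightarrow>
        non_archimedean (G\<lparr>carrier := S\<rparr>) (polish_top_of G (cover_top G) S))"

lemma good_subgroupI:
  assumes G: "abelian_polish_cover G" and S: "subgroup S G" "S \<in> sets (borel_of (cover_top G))" "cover_ker G \<subseteq> S"
    and T': "polishing_topology G (cover_top G) S T'"
    and na: "non_archimedean_polish_cover G \<Longrightarrow> non_archimedean (G\<lparr>carrier := S\<rparr>) T'"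
  shows "good_subgroup G S"
proof -
  have "polish_top_of G (cover_top G) S = T'"
    using G S(2) T' by (intro polish_top_of_eq) (auto simp: abelian_polish_cover_def)
  then show ?thesis
    using S T' na unfolding good_subgroup_def polishable_subgroup_def by blast
qed

lemma good_subgroup_cover_subgroup:
  "abelian_polish_cover G \<Longrightarrow> good_subgroup G S \<Longrightarrow> cover_subgroup G S"
  by (simp add: cover_subgroup_def good_subgroup_def)

text \<open>The Polish topology is the subspace topology of a closed subgroup at zero, comes from
  the regularised norm at successors and from the truncated supremum of norms at limits. At a
  successor it arises inside \<open>subcover\<close> and has to be carried back to
  \<open>G\<close>.\<close>

lemma good_solecki_set:
  assumes G: "abelian_polish_cover G"
  shows "good_subgroup G (solecki_set G \<alpha>)"
proof (induction \<alpha> rule: less_induct)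
  case (less \<alpha>)
  interpret pair: polishable_pair G "cover_top G" "cover_ker G" "ker_top G" by (rule cover_polishable_pair[OF G])
  let ?N = "cover_ker G"
  consider "{..<\<alpha>} = {}" | \<beta> where "{..<\<alpha>} = {..\<beta>}" | "{..<\<alpha>} \<noteq> {}" "\<nexists>\<beta>. {..<\<alpha>} = {..\<beta>}" by blast
  then show ?case
  proof cases
    case 1
    have "subgroup (cover_top G closure_of ?N) G" by (rule pair.subgroup_closure_of[OF pair.N(1)])
    moreover have "closedin (cover_top G) (cover_top G closure_of ?N)" by simp
    moreover have "?N \<subseteq> cover_top G closure_of ?N" using closure_of_subset[of ?N "cover_top G"] pair.NG by auto
    ultimately show ?thesis
      unfolding solecki_set_zero[OF 1]
      by (intro good_subgroupI[OF G _ _ _ pair.polishing_closed_subgroup pair.non_archimedean_subtopology]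
          closedin_borel_of) (auto simp: non_archimedean_polish_cover_def)
  next
    case (2 \<beta>)
    then have "\<beta> < \<alpha>" by auto
    then have gs: "good_subgroup G (solecki_set G \<beta>)" by (rule less.IH)
    interpret S: cover_subgroup G "solecki_set G \<beta>" by (rule good_subgroup_cover_subgroup[OF G gs])
    let ?C = "subcover G (solecki_set G \<beta>)"
    interpret C: polishable_pair ?C "cover_top ?C" "cover_ker ?C" "ker_top ?C"
      by (rule cover_polishable_pair[OF S.subcover_cover])
    have eq: "solecki_set G \<alpha> = C.solecki_closure"
      unfolding solecki_set_succ[OF 2] solecki_def by (rule solecki_one_set_eq[OF S.subcover_cover])
    have sub: "subgroup C.solecki_closure G" "C.solecki_closure \<subseteq> solecki_set G \<beta>"
      using C.solecki_closure_polishable(1) S.subgroup_subcover_iff by auto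
    have borel: "C.solecki_closure \<in> sets (borel_of (cover_top G))"
      using C.solecki_closure_polishable(3) by (intro S.borel_TS_imp) simp
    obtain T' where T': "polishing_topology ?C (cover_top ?C) C.solecki_closure T'"
      "non_archimedean (?C\<lparr>carrier := cover_ker ?C\<rparr>) (ker_top ?C) \<Longrightarrow> non_archimedean (?C\<lparr>carrier := C.solecki_closure\<rparr>) T'"
      using C.solecki_closure_polishable(4) by blast
    show ?thesis
      unfolding eq
    proof (rule good_subgroupI[OF G sub(1) borel])
      show "?N \<subseteq> C.solecki_closure" using C.solecki_closure_polishable(2) by simp
      show "polishing_topology G (cover_top G) C.solecki_closure T'"
        using T'(1) S.polishing_subcover_iff[OF sub(2)] by simp
      assume "non_archimedean_polish_cover G"
      then have "non_archimedean (G\<lparr>carrier := ?N\<rparr>) (ker_top G)" by (simp add: non_archimedean_polish_cover_def)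
      then have "non_archimedean (?C\<lparr>carrier := cover_ker ?C\<rparr>) (ker_top ?C)"
        unfolding S.ker_top_subcover by (subst non_archimedean_cong[of _ "G\<lparr>carrier := ?N\<rparr>"]) auto
      then have "non_archimedean (?C\<lparr>carrier := C.solecki_closure\<rparr>) T'" by (rule T'(2))
      then show "non_archimedean (G\<lparr>carrier := C.solecki_closure\<rparr>) T'"
        by (subst non_archimedean_cong[of _ "?C\<lparr>carrier := C.solecki_closure\<rparr>"]) auto
    qed
  next
    case 3
    obtain e :: "nat \<Rightarrow> countable_ordinal" where e: "range e = {..<\<alpha>}"
      using countable_initial_segment[of \<alpha>] 3(1) by (metis uncountable_def)
    let ?S = "\<lambda>k. solecki_set G (e k)"
    have gs: "good_subgroup G (?S k)" for k using less.IH[of "e k"] e by blast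
    have cs: "cover_subgroup G (?S k)" for k by (rule good_subgroup_cover_subgroup[OF G gs])
    have eq: "solecki_set G \<alpha> = (\<Inter>k. ?S k)"
      unfolding solecki_set_limit[OF 3] e[symmetric] by (simp add: image_image)
    obtain T'' where T'': "polishing_topology G (cover_top G) (\<Inter>k. ?S k) T''"
      "(\<forall>k. non_archimedean (G\<lparr>carrier := ?S k\<rparr>) (polish_top_of G (cover_top G) (?S k)))
        \<longrightarrow> non_archimedean (G\<lparr>carrier := \<Inter>k. ?S k\<rparr>) T''"
      using pair.polishing_Inter[where S = ?S, OF cover_subgroup.S_sub[OF cs] cover_subgroup.S_borel[OF cs]
          cover_subgroup.TS[OF cs]] by (elim exE conjE)
    show ?thesis
      unfolding eq
    proof (rule good_subgroupI[OF G _ _ _ T''(1)])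
      show "subgroup (\<Inter>k. ?S k) G" using cover_subgroup.S_sub[OF cs] by (intro pair.subgroups_Inter) auto
      show "(\<Inter>k. ?S k) \<in> sets (borel_of (cover_top G))"
        using cover_subgroup.S_borel[OF cs] by (intro sets.countable_INT) auto
      show "?N \<subseteq> (\<Inter>k. ?S k)" using cover_subgroup.ker[OF cs] by blast
      assume "non_archimedean_polish_cover G"
      then show "non_archimedean (G\<lparr>carrier := \<Inter>k. ?S k\<rparr>) T''"
        using T''(2) gs unfolding good_subgroup_def by simp
    qed
  qed
qed

lemma cover_subgroup_solecki: "abelian_polish_cover G \<Longrightarrow> cover_subgroup G (solecki_set G \<alpha>)"
  by (intro good_subgroup_cover_subgroup good_solecki_set)

lemma solecki_cover: "abelian_polish_cover G \<Longrightarrow> abelian_polish_cover (solecki \<alpha> G)"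
  unfolding solecki_def by (rule cover_subgroup.subcover_cover[OF cover_subgroup_solecki])

lemma solecki_non_archimedean:
  assumes "non_archimedean_polish_cover G"
  shows "non_archimedean_polish_cover (solecki \<alpha> G)"
proof -
  have G: "abelian_polish_cover G" using assms by (simp add: non_archimedean_polish_cover_def)
  interpret S: cover_subgroup G "solecki_set G \<alpha>" by (rule cover_subgroup_solecki[OF G])
  let ?C = "subcover G (solecki_set G \<alpha>)"
  have "non_archimedean (G\<lparr>carrier := solecki_set G \<alpha>\<rparr>) S.TS"
    using good_solecki_set[OF G, of \<alpha>] assms by (simp add: good_subgroup_def)
  then have "non_archimedean ?C (cover_top ?C)"
    by (subst non_archimedean_cong[of _ "G\<lparr>carrier := solecki_set G \<alpha>\<rparr>"]) auto
  moreover have "non_archimedean (G\<lparr>carrier := cover_ker G\<rparr>) (ker_top G)"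
    using assms by (simp add: non_archimedean_polish_cover_def)
  then have "non_archimedean (?C\<lparr>carrier := cover_ker ?C\<rparr>) (ker_top ?C)"
    unfolding S.ker_top_subcover by (subst non_archimedean_cong[of _ "G\<lparr>carrier := cover_ker G\<rparr>"]) auto
  ultimately show ?thesis
    unfolding non_archimedean_polish_cover_def solecki_def using S.subcover_cover by simp
qed

section \<open>Functoriality\<close>

definition cover_lift :: "'a cover \<Rightarrow> 'b cover \<Rightarrow> ('a \<Rightarrow> 'b) \<Rightarrow> bool" where
  "cover_lift G H f \<longleftrightarrow> borel_lift G (cover_top G) (cover_ker G) (ker_top G) H (cover_top H) (cover_ker H) (ker_top H) f"

text \<open>An open set of the Polish topology of \<open>S'\<close> is Borel in \<open>H\<close>, so
  its preimage is Borel in \<open>G\<close> and its trace on \<open>S\<close> is Borel for the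
  topology of \<open>S\<close>. The kernels, and with them the correction factors, do not
  change.\<close>

lemma cover_lift_subcover:
  assumes G: "cover_subgroup G S" and H: "cover_subgroup H S'" and f: "cover_lift G H f" and fS: "f ` S \<subseteq> S'"
  shows "cover_lift (subcover G S) (subcover H S') f"
proof -
  interpret G: cover_subgroup G S by fact
  interpret H: cover_subgroup H S' by fact
  interpret f: borel_lift G "cover_top G" "cover_ker G" "ker_top G" H "cover_top H" "cover_ker H" "ker_top H" f
    using f by (simp add: cover_lift_def)
  have "f \<in> borel_of G.TS \<rightarrow>\<^sub>M borel_of H.TS"
  proof (rule measurable_borel_of)
    show "f \<in> space (borel_of G.TS) \<rightarrow> topspace H.TS" using fS by (auto simp: G.topspace_TS H.topspace_TS)
    fix U assume "openin H.TS U"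
    then have "U \<in> sets (borel_of (cover_top H))" by (rule polishing_topologyD(2)[OF H.TS])
    then have "f -` U \<inter> space (borel_of (cover_top G)) \<in> sets (borel_of (cover_top G))"
      by (rule measurable_sets[OF f.f])
    then have "f -` U \<inter> space (borel_of (cover_top G)) \<inter> S \<in> sets (borel_of G.TS)" by (rule G.borel_TS)
    moreover have "f -` U \<inter> space (borel_of (cover_top G)) \<inter> S = f -` U \<inter> space (borel_of G.TS)"
      using G.SG by (auto simp: G.topspace_TS)
    ultimately show "f -` U \<inter> space (borel_of G.TS) \<in> sets (borel_of G.TS)" by simp
  qed
  then show ?thesis
    unfolding cover_lift_def borel_lift_def borel_lift_axioms_def
    using cover_polishable_pair[OF G.subcover_cover] cover_polishable_pair[OF H.subcover_cover]
      f.f_mult[OF G.SG G.SG] f.f_ker by simp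
qed

lemma cover_lift_solecki_set:
  fixes G :: "'a cover" and H :: "'b cover"
  assumes G: "abelian_polish_cover G" and H: "abelian_polish_cover H" and f: "cover_lift G H f"
  shows "f ` solecki_set G \<alpha> \<subseteq> solecki_set H \<alpha>"
proof (induction \<alpha> rule: less_induct)
  case (less \<alpha>)
  consider "{..<\<alpha>} = {}" | \<beta> where "{..<\<alpha>} = {..\<beta>}" | "{..<\<alpha>} \<noteq> {}" "\<nexists>\<beta>. {..<\<alpha>} = {..\<beta>}" by blast
  then show ?case
  proof cases
    case 1
    then show ?thesis
      unfolding solecki_set_zero[OF 1] using borel_lift.lift_closure[OF f[unfolded cover_lift_def]] by blast
  next
    case (2 \<beta>)
    then have "\<beta> < \<alpha>" by auto
    then have "f ` solecki_set G \<beta> \<subseteq> solecki_set H \<beta>" by (rule less.IH)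
    \<comment> \<open>The induction hypothesis makes \<open>f\<close> a lift between the covers at
      stage \<open>\<beta>\<close>, to which the case of \<open>s_1\<close> applies.\<close>
    then have "cover_lift (solecki \<beta> G) (solecki \<beta> H) f"
      unfolding solecki_def by (intro cover_lift_subcover cover_subgroup_solecki G H f)
    then show ?thesis
      unfolding solecki_set_succ[OF 2] solecki_one_set_eq[OF solecki_cover[OF G]] solecki_one_set_eq[OF solecki_cover[OF H]]
      using borel_lift.lift_solecki_closure[of "solecki \<beta> G"] unfolding cover_lift_def by blast
  next
    case 3
    then show ?thesis unfolding solecki_set_limit[OF 3] using less.IH by blast
  qed
qed

section \<open>From lifts to homomorphisms of the quotients\<close>

lemma r_coset_subcover: "N #>\<^bsub>subcover G S\<^esub> x = N #>\<^bsub>G\<^esub> x"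
  by (simp add: r_coset_def)

lemma carrier_cover_quot_subcover: "carrier (cover_quot (subcover G S)) = (\<lambda>x. cover_ker G #>\<^bsub>G\<^esub> x) ` S"
  by (simp add: carrier_FactGroup r_coset_subcover)

lemma set_mult_subcover: "A <#>\<^bsub>subcover G S\<^esub> B = A <#>\<^bsub>G\<^esub> B"
  by (simp add: set_mult_def)

lemma cover_quot_mult:
  assumes G: "abelian_polish_cover G" and xy: "x \<in> carrier G" "y \<in> carrier G"
  shows "(cover_ker G #>\<^bsub>G\<^esub> x) \<otimes>\<^bsub>cover_quot G\<^esub> (cover_ker G #>\<^bsub>G\<^esub> y) = cover_ker G #>\<^bsub>G\<^esub> (x \<otimes>\<^bsub>G\<^esub> y)"
proof -
  interpret polishable_pair G "cover_top G" "cover_ker G" "ker_top G" by (rule cover_polishable_pair[OF G])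
  interpret normal "cover_ker G" G by (rule subgroup_imp_normal[OF N(1)])
  show ?thesis using rcos_sum[OF xy] by (simp add: FactGroup_def)
qed

lemma cover_quot_group:
  assumes G: "abelian_polish_cover G"
  shows "group (cover_quot G)"
proof -
  interpret polishable_pair G "cover_top G" "cover_ker G" "ker_top G" by (rule cover_polishable_pair[OF G])
  interpret normal "cover_ker G" G by (rule subgroup_imp_normal[OF N(1)])
  show ?thesis by (rule factorgroup_is_group)
qed

text \<open>An element lies in its own coset, so equal cosets yield the correction factor in
  \<open>cover_ker H\<close>.\<close>

lemma borel_definable_hom_lift:
  assumes G: "abelian_polish_cover G" and H: "abelian_polish_cover H" and f: "borel_definable_hom G H f"
  obtains f' where "cover_lift G H f'" "\<And>x. x \<in> carrier G \<Longrightarrow> f (cover_ker G #>\<^bsub>G\<^esub> x) = cover_ker H #>\<^bsub>H\<^esub> f' x"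
proof -
  interpret G: polishable_pair G "cover_top G" "cover_ker G" "ker_top G" by (rule cover_polishable_pair[OF G])
  interpret H: polishable_pair H "cover_top H" "cover_ker H" "ker_top H" by (rule cover_polishable_pair[OF H])
  obtain f' where f': "f' \<in> borel_of (cover_top G) \<rightarrow>\<^sub>M borel_of (cover_top H)"
    and ff': "\<And>x. x \<in> carrier G \<Longrightarrow> f (cover_ker G #>\<^bsub>G\<^esub> x) = cover_ker H #>\<^bsub>H\<^esub> f' x"
    using f unfolding borel_definable_hom_def by blast
  have hom: "f \<in> hom (cover_quot G) (cover_quot H)" using f by (simp add: borel_definable_hom_def)
  have f'H: "f' x \<in> carrier H" if "x \<in> carrier G" for x using measurable_space[OF f', of x] that by simp
  have "\<exists>m\<in>cover_ker H. f' (x \<otimes>\<^bsub>G\<^esub> y) = m \<otimes>\<^bsub>H\<^esub> (f' x \<otimes>\<^bsub>H\<^esub> f' y)" if xy: "x \<in> carrier G" "y \<in> carrier G" for x y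
  proof -
    have xyG: "x \<otimes>\<^bsub>G\<^esub> y \<in> carrier G" using xy by simp
    have "cover_ker H #>\<^bsub>H\<^esub> f' (x \<otimes>\<^bsub>G\<^esub> y) = f (cover_ker G #>\<^bsub>G\<^esub> (x \<otimes>\<^bsub>G\<^esub> y))" by (rule ff'[OF xyG, symmetric])
    also have "\<dots> = f ((cover_ker G #>\<^bsub>G\<^esub> x) \<otimes>\<^bsub>cover_quot G\<^esub> (cover_ker G #>\<^bsub>G\<^esub> y))"
      by (simp only: cover_quot_mult[OF G xy])
    also have "\<dots> = f (cover_ker G #>\<^bsub>G\<^esub> x) \<otimes>\<^bsub>cover_quot H\<^esub> f (cover_ker G #>\<^bsub>G\<^esub> y)"
      by (rule hom_mult[OF hom]) (use xy in \<open>auto simp: carrier_FactGroup\<close>)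
    also have "\<dots> = cover_ker H #>\<^bsub>H\<^esub> (f' x \<otimes>\<^bsub>H\<^esub> f' y)"
      unfolding ff'[OF xy(1)] ff'[OF xy(2)] by (rule cover_quot_mult[OF H f'H[OF xy(1)] f'H[OF xy(2)]])
    finally have "f' (x \<otimes>\<^bsub>G\<^esub> y) \<in> cover_ker H #>\<^bsub>H\<^esub> (f' x \<otimes>\<^bsub>H\<^esub> f' y)"
      using H.rcos_self[OF f'H[OF xyG] H.N(1)] by simp
    then show ?thesis by (auto simp: r_coset_def)
  qed
  moreover have "f' n \<in> cover_ker H" if n: "n \<in> cover_ker G" for n
  proof -
    have "cover_ker H #>\<^bsub>H\<^esub> f' n = f (cover_ker G #>\<^bsub>G\<^esub> n)" by (rule ff'[OF G.NG[OF n], symmetric])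
    also have "cover_ker G #>\<^bsub>G\<^esub> n = cover_ker G" by (rule G.coset_join2[OF G.NG[OF n] G.N(1) n])
    also have "f (cover_ker G) = cover_ker H"
      using hom_one[OF hom cover_quot_group[OF G] cover_quot_group[OF H]] by (simp add: FactGroup_def)
    finally show ?thesis using H.rcos_self[OF f'H[OF G.NG[OF n]] H.N(1)] by simp
  qed
  ultimately have "cover_lift G H f'"
    unfolding cover_lift_def borel_lift_def borel_lift_axioms_def
    using cover_polishable_pair[OF G] cover_polishable_pair[OF H] f' by blast
  then show ?thesis using that ff' by blast
qed

lemma borel_definable_hom_solecki_subset:
  assumes G: "abelian_polish_cover G" and H: "abelian_polish_cover H" and f: "borel_definable_hom G H f"
  shows "f ` carrier (cover_quot (solecki \<alpha> G)) \<subseteq> carrier (cover_quot (solecki \<alpha> H))"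
proof -
  obtain f' where f': "cover_lift G H f'" "\<And>x. x \<in> carrier G \<Longrightarrow> f (cover_ker G #>\<^bsub>G\<^esub> x) = cover_ker H #>\<^bsub>H\<^esub> f' x"
    by (rule borel_definable_hom_lift[OF G H f]) blast
  interpret S: cover_subgroup G "solecki_set G \<alpha>" by (rule cover_subgroup_solecki[OF G])
  have sub: "f' ` solecki_set G \<alpha> \<subseteq> solecki_set H \<alpha>" by (rule cover_lift_solecki_set[OF G H f'(1)])
  have "f (cover_ker G #>\<^bsub>G\<^esub> x) \<in> (\<lambda>x. cover_ker H #>\<^bsub>H\<^esub> x) ` solecki_set H \<alpha>" if x: "x \<in> solecki_set G \<alpha>" for x
  proof -
    have "f' x \<in> solecki_set H \<alpha>" using sub x by blast
    then show ?thesis unfolding f'(2)[OF S.SG[OF x]] by (rule imageI)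
  qed
  then show ?thesis unfolding solecki_def carrier_cover_quot_subcover by auto
qed

lemma carrier_solecki_subset:
  assumes "abelian_polish_cover G"
  shows "carrier (cover_quot (solecki \<alpha> G)) \<subseteq> carrier (cover_quot G)"
  unfolding solecki_def carrier_cover_quot_subcover carrier_FactGroup[of G]
  using cover_subgroup.SG[OF cover_subgroup_solecki[OF assms]] by auto

lemma cover_quot_m_closed:
  assumes "abelian_polish_cover G" "a \<in> carrier (cover_quot G)" "b \<in> carrier (cover_quot G)"
  shows "a \<otimes>\<^bsub>cover_quot G\<^esub> b \<in> carrier (cover_quot G)"
proof -
  interpret group "cover_quot G" by (rule cover_quot_group[OF assms(1)])
  show ?thesis using assms(2,3) by (rule m_closed)
qed

text \<open>The lift of \<open>f\<close> serves again: it is Borel for the topologies of the Solecki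
  subgroups, and cosets and their products are the same sets in both covers.\<close>

lemma borel_definable_hom_solecki_map:
  assumes G: "abelian_polish_cover G" and H: "abelian_polish_cover H" and f: "borel_definable_hom G H f"
  shows "borel_definable_hom (solecki \<alpha> G) (solecki \<alpha> H) (solecki_map \<alpha> G H f)"
proof -
  let ?QG = "cover_quot (solecki \<alpha> G)" and ?QH = "cover_quot (solecki \<alpha> H)"
  obtain f' where f': "cover_lift G H f'" "\<And>x. x \<in> carrier G \<Longrightarrow> f (cover_ker G #>\<^bsub>G\<^esub> x) = cover_ker H #>\<^bsub>H\<^esub> f' x"
    by (rule borel_definable_hom_lift[OF G H f]) blast
  interpret S: cover_subgroup G "solecki_set G \<alpha>" by (rule cover_subgroup_solecki[OF G])
  have sub: "f' ` solecki_set G \<alpha> \<subseteq> solecki_set H \<alpha>" by (rule cover_lift_solecki_set[OF G H f'(1)])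
  have "cover_lift (solecki \<alpha> G) (solecki \<alpha> H) f'"
    unfolding solecki_def by (rule cover_lift_subcover[OF cover_subgroup_solecki[OF G] cover_subgroup_solecki[OF H] f'(1) sub])
  then have meas: "f' \<in> borel_of (cover_top (solecki \<alpha> G)) \<rightarrow>\<^sub>M borel_of (cover_top (solecki \<alpha> H))"
    unfolding cover_lift_def by (rule borel_lift.f)
  have into: "f a \<in> carrier ?QH" if "a \<in> carrier ?QG" for a
    using borel_definable_hom_solecki_subset[OF G H f] that by blast
  have hom: "f \<in> hom (cover_quot G) (cover_quot H)" using f by (simp add: borel_definable_hom_def)
  have "solecki_map \<alpha> G H f \<in> hom ?QG ?QH"
  proof (rule homI)
    fix a b assume ab: "a \<in> carrier ?QG" "b \<in> carrier ?QG"
    show "solecki_map \<alpha> G H f a \<in> carrier ?QH" using into[OF ab(1)] ab(1) by (simp add: solecki_map_def)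
    have "a \<otimes>\<^bsub>?QG\<^esub> b \<in> carrier ?QG" by (rule cover_quot_m_closed[OF solecki_cover[OF G] ab])
    then have "solecki_map \<alpha> G H f (a \<otimes>\<^bsub>?QG\<^esub> b) = f (a \<otimes>\<^bsub>?QG\<^esub> b)" by (simp add: solecki_map_def)
    also have "\<dots> = f (a \<otimes>\<^bsub>cover_quot G\<^esub> b)" by (simp add: solecki_def set_mult_subcover)
    also have "\<dots> = f a \<otimes>\<^bsub>cover_quot H\<^esub> f b"
      by (rule hom_mult[OF hom]) (use ab carrier_solecki_subset[OF G] in auto)
    also have "\<dots> = solecki_map \<alpha> G H f a \<otimes>\<^bsub>?QH\<^esub> solecki_map \<alpha> G H f b"
      using ab unfolding solecki_map_def by (simp add: solecki_def set_mult_subcover)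
    finally show "solecki_map \<alpha> G H f (a \<otimes>\<^bsub>?QG\<^esub> b) = solecki_map \<alpha> G H f a \<otimes>\<^bsub>?QH\<^esub> solecki_map \<alpha> G H f b" .
  qed
  moreover have "solecki_map \<alpha> G H f (cover_ker (solecki \<alpha> G) #>\<^bsub>solecki \<alpha> G\<^esub> x) = cover_ker (solecki \<alpha> H) #>\<^bsub>solecki \<alpha> H\<^esub> f' x"
    if x: "x \<in> carrier (solecki \<alpha> G)" for x
  proof -
    have xS: "x \<in> solecki_set G \<alpha>" using x by (simp add: solecki_def)
    have "cover_ker G #>\<^bsub>G\<^esub> x \<in> carrier ?QG" unfolding solecki_def carrier_cover_quot_subcover using xS by (rule imageI)
    then have "solecki_map \<alpha> G H f (cover_ker G #>\<^bsub>G\<^esub> x) = cover_ker H #>\<^bsub>H\<^esub> f' x"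
      using f'(2)[OF S.SG[OF xS]] by (simp add: solecki_map_def)
    then show ?thesis by (simp add: solecki_def r_coset_subcover)
  qed
  ultimately show ?thesis unfolding borel_definable_hom_def using meas by blast
qed

text \<open>Lifted by the identity, which is continuous because the Polish topology of the subgroup
  is finer.\<close>

lemma borel_definable_hom_solecki_incl:
  assumes G: "abelian_polish_cover G"
  shows "borel_definable_hom (solecki \<alpha> G) G (solecki_incl \<alpha> G)"
proof -
  let ?QG = "cover_quot (solecki \<alpha> G)"
  interpret S: cover_subgroup G "solecki_set G \<alpha>" by (rule cover_subgroup_solecki[OF G])
  have meas: "(\<lambda>x. x) \<in> borel_of (cover_top (solecki \<alpha> G)) \<rightarrow>\<^sub>M borel_of (cover_top G)"
    using continuous_map_measurable[OF S.TS_inclusion] by (simp add: solecki_def)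
  have "solecki_incl \<alpha> G \<in> hom ?QG (cover_quot G)"
  proof (rule homI)
    fix a b assume ab: "a \<in> carrier ?QG" "b \<in> carrier ?QG"
    show "solecki_incl \<alpha> G a \<in> carrier (cover_quot G)"
      using ab(1) carrier_solecki_subset[OF G] by (auto simp: solecki_incl_def)
    have "a \<otimes>\<^bsub>?QG\<^esub> b \<in> carrier ?QG" by (rule cover_quot_m_closed[OF solecki_cover[OF G] ab])
    then show "solecki_incl \<alpha> G (a \<otimes>\<^bsub>?QG\<^esub> b) = solecki_incl \<alpha> G a \<otimes>\<^bsub>cover_quot G\<^esub> solecki_incl \<alpha> G b"
      using ab unfolding solecki_incl_def by (simp add: solecki_def set_mult_subcover)
  qed
  moreover have "solecki_incl \<alpha> G (cover_ker (solecki \<alpha> G) #>\<^bsub>solecki \<alpha> G\<^esub> x) = cover_ker G #>\<^bsub>G\<^esub> x"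
    if x: "x \<in> carrier (solecki \<alpha> G)" for x
  proof -
    have xS: "x \<in> solecki_set G \<alpha>" using x by (simp add: solecki_def)
    have "cover_ker G #>\<^bsub>G\<^esub> x \<in> carrier ?QG" unfolding solecki_def carrier_cover_quot_subcover using xS by (rule imageI)
    then have "solecki_incl \<alpha> G (cover_ker G #>\<^bsub>G\<^esub> x) = cover_ker G #>\<^bsub>G\<^esub> x" by (simp add: solecki_incl_def)
    then show ?thesis by (simp add: solecki_def r_coset_subcover)
  qed
  ultimately show ?thesis
    unfolding borel_definable_hom_def using meas by (intro conjI bexI[of _ "\<lambda>x. x"] ballI)
qed

lemma borel_definable_hom_id:
  assumes G: "abelian_polish_cover G"
  shows "borel_definable_hom G G (restrict (\<lambda>c. c) (carrier (cover_quot G)))"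
proof -
  have "restrict (\<lambda>c. c) (carrier (cover_quot G)) \<in> hom (cover_quot G) (cover_quot G)"
    by (rule homI) (use cover_quot_m_closed[OF G] in auto)
  moreover have "restrict (\<lambda>c. c) (carrier (cover_quot G)) (cover_ker G #>\<^bsub>G\<^esub> x) = cover_ker G #>\<^bsub>G\<^esub> x"
    if "x \<in> carrier G" for x
    using that by (simp add: carrier_FactGroup)
  ultimately show ?thesis
    unfolding borel_definable_hom_def by (intro conjI bexI[of _ "\<lambda>x. x"]) auto
qed

lemma borel_definable_hom_closed:
  "borel_definable_hom G H f \<Longrightarrow> a \<in> carrier (cover_quot G) \<Longrightarrow> f a \<in> carrier (cover_quot H)"
  unfolding borel_definable_hom_def by (auto simp: hom_def)

lemma borel_definable_hom_compose:
  assumes X: "abelian_polish_cover X" and Y: "abelian_polish_cover Y"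
    and f: "borel_definable_hom X Y f" and g: "borel_definable_hom Y Z g"
  shows "borel_definable_hom X Z (compose (carrier (cover_quot X)) g f)"
proof -
  interpret X: abelian_polish X "cover_top X" by (rule abelian_polishI) (use X in \<open>simp add: abelian_polish_cover_def\<close>)
  interpret Y: abelian_polish Y "cover_top Y" by (rule abelian_polishI) (use Y in \<open>simp add: abelian_polish_cover_def\<close>)
  obtain f' where f': "f' \<in> borel_of (cover_top X) \<rightarrow>\<^sub>M borel_of (cover_top Y)"
    "\<And>x. x \<in> carrier X \<Longrightarrow> f (cover_ker X #>\<^bsub>X\<^esub> x) = cover_ker Y #>\<^bsub>Y\<^esub> f' x"
    using f unfolding borel_definable_hom_def by blast
  obtain g' where g': "g' \<in> borel_of (cover_top Y) \<rightarrow>\<^sub>M borel_of (cover_top Z)"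
    "\<And>x. x \<in> carrier Y \<Longrightarrow> g (cover_ker Y #>\<^bsub>Y\<^esub> x) = cover_ker Z #>\<^bsub>Z\<^esub> g' x"
    using g unfolding borel_definable_hom_def by blast
  have f'Y: "f' x \<in> carrier Y" if "x \<in> carrier X" for x using measurable_space[OF f'(1), of x] that by simp
  have "compose (carrier (cover_quot X)) g f \<in> hom (cover_quot X) (cover_quot Z)"
    using f g by (intro group.hom_compose[OF cover_quot_group[OF X]]) (auto simp: borel_definable_hom_def)
  moreover have "(\<lambda>x. g' (f' x)) \<in> borel_of (cover_top X) \<rightarrow>\<^sub>M borel_of (cover_top Z)"
    by (rule measurable_compose[OF f'(1) g'(1)])
  moreover have "compose (carrier (cover_quot X)) g f (cover_ker X #>\<^bsub>X\<^esub> x) = cover_ker Z #>\<^bsub>Z\<^esub> g' (f' x)"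
    if x: "x \<in> carrier X" for x
  proof -
    have "cover_ker X #>\<^bsub>X\<^esub> x \<in> carrier (cover_quot X)" using x by (simp add: carrier_FactGroup)
    then show ?thesis using f'(2)[OF x] g'(2)[OF f'Y[OF x]] by (simp add: compose_def)
  qed
  ultimately show ?thesis
    unfolding borel_definable_hom_def by (intro conjI bexI[of _ "\<lambda>x. g' (f' x)"] ballI)
qed

section \<open>The category of covers and the subfunctor\<close>

lemma cover_category_simps:
  "objs (cover_category P) = {G. abelian_polish_cover G \<and> P G}"
  "arrs (cover_category P) G H = {f \<in> extensional (carrier (cover_quot G)). borel_definable_hom G H f}"
  "id_arr (cover_category P) G = restrict (\<lambda>c. c) (carrier (cover_quot G))"
  "comp_arr (cover_category P) G H K g f = compose (carrier (cover_quot G)) g f"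
  by (simp_all add: cover_category_def)

lemma is_category_cover_category: "is_category (cover_category P)"
  unfolding is_category_def cover_category_simps
proof (intro conjI ballI)
  fix X assume "X \<in> {G. abelian_polish_cover G \<and> P G}"
  then show "restrict (\<lambda>c. c) (carrier (cover_quot X)) \<in> {f \<in> extensional (carrier (cover_quot X)). borel_definable_hom X X f}"
    using borel_definable_hom_id by auto
next
  fix X Y Z f g
  assume "X \<in> {G. abelian_polish_cover G \<and> P G}" "Y \<in> {G. abelian_polish_cover G \<and> P G}"
    "f \<in> {f \<in> extensional (carrier (cover_quot X)). borel_definable_hom X Y f}"
    "g \<in> {f \<in> extensional (carrier (cover_quot Y)). borel_definable_hom Y Z f}"
  then show "compose (carrier (cover_quot X)) g f \<in> {f \<in> extensional (carrier (cover_quot X)). borel_definable_hom X Z f}"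
    using borel_definable_hom_compose by auto
next
  fix X Y f
  assume f: "f \<in> {f \<in> extensional (carrier (cover_quot X)). borel_definable_hom X Y f}"
  show "compose (carrier (cover_quot X)) f (restrict (\<lambda>c. c) (carrier (cover_quot X))) = f"
    by (rule extensionalityI[of _ "carrier (cover_quot X)"]) (use f in \<open>auto simp: compose_def\<close>)
  show "compose (carrier (cover_quot X)) (restrict (\<lambda>c. c) (carrier (cover_quot Y))) f = f"
    by (rule extensionalityI[of _ "carrier (cover_quot X)"])
      (use f borel_definable_hom_closed in \<open>auto simp: compose_def\<close>)
next
  fix W X Y Z f g h
  assume f: "f \<in> {f \<in> extensional (carrier (cover_quot W)). borel_definable_hom W X f}"
  show "compose (carrier (cover_quot W)) (compose (carrier (cover_quot X)) h g) f =
      compose (carrier (cover_quot W)) h (compose (carrier (cover_quot W)) g f)"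
    by (rule extensionalityI[of _ "carrier (cover_quot W)"])
      (use f borel_definable_hom_closed in \<open>auto simp: compose_def\<close>)
qed

text \<open>The predicate \<open>P\<close> allows for both categories at once. The inclusion is
  injective on cosets, hence left cancellable on arrows, since extensional maps are equal when they
  agree on the carrier.\<close>

lemma solecki_subfunctor:
  assumes P: "\<And>G. abelian_polish_cover G \<Longrightarrow> P G \<Longrightarrow> P (solecki \<alpha> G)"
  shows "is_subfunctor_of_identity (cover_category P) (solecki \<alpha>) (solecki_map \<alpha>) (solecki_incl \<alpha>)"
proof -
  let ?C = "cover_category P"
  have objD: "abelian_polish_cover G" if "G \<in> objs ?C" for G using that by (simp add: cover_category_simps)
  have arrD: "borel_definable_hom G H f" "f \<in> extensional (carrier (cover_quot G))" if "f \<in> arrs ?C G H" for G H f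
    using that by (simp_all add: cover_category_simps)
  have obj: "solecki \<alpha> G \<in> objs ?C" if "G \<in> objs ?C" for G
    using that P[of G] solecki_cover[of G \<alpha>] by (simp add: cover_category_simps)
  have incl_arr: "solecki_incl \<alpha> G \<in> arrs ?C (solecki \<alpha> G) G" if "G \<in> objs ?C" for G
    using borel_definable_hom_solecki_incl[OF objD[OF that]] by (simp add: cover_category_simps solecki_incl_def)
  have into: "f a \<in> carrier (cover_quot (solecki \<alpha> Y))"
    if "X \<in> objs ?C" "Y \<in> objs ?C" "f \<in> arrs ?C X Y" "a \<in> carrier (cover_quot (solecki \<alpha> X))" for X Y f a
    using borel_definable_hom_solecki_subset[OF objD[OF that(1)] objD[OF that(2)] arrD(1)[OF that(3)]] that(4) by blast
  have sub: "a \<in> carrier (cover_quot X)" if "X \<in> objs ?C" "a \<in> carrier (cover_quot (solecki \<alpha> X))" for X a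
    using carrier_solecki_subset[OF objD[OF that(1)]] that(2) by blast
  have F: "is_functor ?C ?C (solecki \<alpha>) (solecki_map \<alpha>)"
    unfolding is_functor_def
  proof (intro conjI ballI is_category_cover_category)
    show "solecki \<alpha> X \<in> objs ?C" if "X \<in> objs ?C" for X by (rule obj[OF that])
    show "solecki_map \<alpha> X Y f \<in> arrs ?C (solecki \<alpha> X) (solecki \<alpha> Y)"
      if "X \<in> objs ?C" "Y \<in> objs ?C" "f \<in> arrs ?C X Y" for X Y f
      using borel_definable_hom_solecki_map[OF objD[OF that(1)] objD[OF that(2)] arrD(1)[OF that(3)]]
      by (simp add: cover_category_simps solecki_map_def)
    show "solecki_map \<alpha> X X (id_arr ?C X) = id_arr ?C (solecki \<alpha> X)" if X: "X \<in> objs ?C" for X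
      unfolding cover_category_simps solecki_map_def
      by (rule restrict_ext) (use sub[OF X] in simp)
    show "solecki_map \<alpha> X Z (comp_arr ?C X Y Z g f) =
        comp_arr ?C (solecki \<alpha> X) (solecki \<alpha> Y) (solecki \<alpha> Z) (solecki_map \<alpha> Y Z g) (solecki_map \<alpha> X Y f)"
      if X: "X \<in> objs ?C" and Y: "Y \<in> objs ?C" and f: "f \<in> arrs ?C X Y" for X Y Z f g
      unfolding cover_category_simps solecki_map_def compose_def
      by (rule restrict_ext) (use sub[OF X] into[OF X Y f] in simp)
  qed
  have I: "is_functor ?C ?C (\<lambda>X. X) (\<lambda>X Y f. f)"
    unfolding is_functor_def using is_category_cover_category by simp
  show ?thesis
    unfolding is_subfunctor_of_identity_def is_nat_trans_def
  proof (intro conjI ballI F I)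
    show "solecki_incl \<alpha> X \<in> arrs ?C (solecki \<alpha> X) X" if "X \<in> objs ?C" for X by (rule incl_arr[OF that])
    show "comp_arr ?C (solecki \<alpha> X) (solecki \<alpha> Y) Y (solecki_incl \<alpha> Y) (solecki_map \<alpha> X Y f) =
        comp_arr ?C (solecki \<alpha> X) X Y f (solecki_incl \<alpha> X)"
      if X: "X \<in> objs ?C" and Y: "Y \<in> objs ?C" and f: "f \<in> arrs ?C X Y" for X Y f
      unfolding cover_category_simps solecki_map_def solecki_incl_def compose_def
      by (rule restrict_ext) (use into[OF X Y f] in simp)
    show "is_mono ?C (solecki \<alpha> X) X (solecki_incl \<alpha> X)" if X: "X \<in> objs ?C" for X
      unfolding is_mono_def
    proof (intro conjI ballI impI incl_arr[OF X])
      fix W f g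
      assume f: "f \<in> arrs ?C W (solecki \<alpha> X)" and g: "g \<in> arrs ?C W (solecki \<alpha> X)"
        and eq: "comp_arr ?C W (solecki \<alpha> X) X (solecki_incl \<alpha> X) f = comp_arr ?C W (solecki \<alpha> X) X (solecki_incl \<alpha> X) g"
      show "f = g"
      proof (rule extensionalityI[OF arrD(2)[OF f] arrD(2)[OF g]])
        fix a assume a: "a \<in> carrier (cover_quot W)"
        have "f a \<in> carrier (cover_quot (solecki \<alpha> X))" "g a \<in> carrier (cover_quot (solecki \<alpha> X))"
          using borel_definable_hom_closed[OF arrD(1)[OF f] a] borel_definable_hom_closed[OF arrD(1)[OF g] a] by auto
        then show "f a = g a"
          using fun_cong[OF eq, of a] a by (simp add: cover_category_simps compose_def solecki_incl_def)
      qed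
    qed
  qed
qed

theorem theorem6p3:
  fixes \<alpha> :: countable_ordinal
  shows "(\<forall>(G :: 'a cover) (H :: 'b cover) f.
            abelian_polish_cover G \<and> abelian_polish_cover H \<and> borel_definable_hom G H f \<longrightarrow>
            f ` carrier (cover_quot (solecki \<alpha> G)) \<subseteq> carrier (cover_quot (solecki \<alpha> H))) \<and>
         is_subfunctor_of_identity
           (cover_category (\<lambda>G :: 'c cover. True))
           (solecki \<alpha>) (solecki_map \<alpha>) (solecki_incl \<alpha>) \<and>
         is_subfunctor_of_identity
           (cover_category (non_archimedean_polish_cover :: 'c cover \<Rightarrow> bool))
           (solecki \<alpha>) (solecki_map \<alpha>) (solecki_incl \<alpha>)"
proof (intro conjI allI impI)
  fix G :: "'a cover" and H :: "'b cover" and f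
  assume "abelian_polish_cover G \<and> abelian_polish_cover H \<and> borel_definable_hom G H f"
  then show "f ` carrier (cover_quot (solecki \<alpha> G)) \<subseteq> carrier (cover_quot (solecki \<alpha> H))"
    by (intro borel_definable_hom_solecki_subset) auto
qed (rule solecki_subfunctor; simp add: solecki_non_archimedean)+

end
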